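(* Each of the following groups can be embedded in $QI(\mathbb{R})$, i.e. is isomorphic to a subgroup of $QI(\mathbb{R})$: (i) the groups $\widetilde{Diff}(\mathbb{S}^1)$ and $\widetilde{PL}(\mathbb{S}^1)$; (ii) the group $PL_\kappa(\mathbb{R})$; (iii) Richard Thompson's group $F$; (iv) the free group of rank $c$, the cardinality of the continuum.
   Context: $\mathbb{R}$ carries its usual metric. A map $f:X\to X'$ between metric spaces $(X,d)$, $(X',d')$, not assumed continuous, is a $C$-quasi-isometric embedding, where $C>1$, if $C^{-1}d(x,y)-C\le d'(f(x),f(y))\le C\,d(x,y)+C$ for all $x,y\in X$. It is a $C$-quasi-isometry if moreover every $x'\in X'$ is within distance $C$ of the image of $f$. It is a quasi-isometry if it is a $C$-quasi-isometry for some $C>1$. Two maps $f,g:X\to X$ are equivalent if there is a constant $M$ with $d(f(x),g(x))\le M$ for all $x\in X$. $[f]$ denotes the equivalence class of a quasi-isometry $f:X\to X$, and $QI(X)$ is the group of all equivalence classes of quasi-isometries of $X$, with product $[f]\cdot[g]=[f\circ g]$. Let $p:\mathbb{R}\to\mathbb{S}^1$, $p(t)=\exp(2\pi\sqrt{-1}\,t)$, be the covering projection. For a group $\Gamma$ of homeomorphisms of $\mathbb{S}^1$, $\widetilde{\Gamma}$ denotes the group of all homeomorphisms $\tilde f$ of $\mathbb{R}$ that are lifts of elements of $\Gamma$, i.e. such that $p\circ\tilde f=f\circ p$ for some $f\in\Gamma$. $Diff(\mathbb{S}^1)$ is the group of all $C^\infty$ diffeomorphisms of $\mathbb{S}^1$,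 and $PL(\mathbb{S}^1)$ is the group of all piecewise-linear homeomorphisms of $\mathbb{S}^1=[0,1]/\{0,1\}$ (those homeomorphisms whose lifts to $\mathbb{R}$ are piecewise-linear). $\widetilde{Diff}(\mathbb{S}^1)$ and $\widetilde{PL}(\mathbb{S}^1)$ are the corresponding groups of lifts. $PL_\kappa(\mathbb{R})$ is the group of all piecewise-linear homeomorphisms of $\mathbb{R}$ with compact support, where the support of $f$ is the closure of $\{x\in\mathbb{R}: f(x)\ne x\}$. Thompson's group is $F=\langle x_0,x_1,\dots \mid x_ix_jx_i^{-1}=x_{j+1},\ i<j\rangle$. It is isomorphic to the group of piecewise-linear homeomorphisms of $\mathbb{R}$ that are the identity outside $[0,1]$, have all points of non-differentiability in the dyadic rationals, and have all slopes in the multiplicative subgroup of $\mathbb{R}^*$ generated by $2$. *)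

theory Defs
  imports "HOL-Analysis.Analysis" "HOL-Algebra.Coset" "HOL-Library.Equipollence"
begin

section \<open>Embeddings of groups\<close>

definition embeds_in :: "('a, 'c) monoid_scheme \<Rightarrow> ('b, 'd) monoid_scheme \<Rightarrow> bool" where
  "embeds_in G K \<longleftrightarrow> (\<exists>H. subgroup H K \<and> G \<cong> K\<lparr>carrier := H\<rparr>)"


section \<open>Quasi-isometries\<close>

definition qi_embedding_const :: "real \<Rightarrow> ('a::metric_space \<Rightarrow> 'b::metric_space) \<Rightarrow> bool" where
  "qi_embedding_const C f \<longleftrightarrow> C > 1 \<and>
     (\<forall>x y. inverse C * dist x y - C \<le> dist (f x) (f y) \<and> dist (f x) (f y) \<le> C * dist x y + C)"

definition quasi_isometry_const :: "real \<Rightarrow> ('a::metric_space \<Rightarrow> 'b::metric_space) \<Rightarrow> bool" where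
  "quasi_isometry_const C f \<longleftrightarrow> qi_embedding_const C f \<and> (\<forall>x'. \<exists>x. dist x' (f x) \<le> C)"

definition quasi_isometry :: "('a::metric_space \<Rightarrow> 'b::metric_space) \<Rightarrow> bool" where
  "quasi_isometry f \<longleftrightarrow> (\<exists>C>1. quasi_isometry_const C f)"

definition qi_rel :: "(('a::metric_space \<Rightarrow> 'a) \<times> ('a \<Rightarrow> 'a)) set" where
  "qi_rel = {(f, g). quasi_isometry f \<and> quasi_isometry g \<and> (\<exists>M. \<forall>x. dist (f x) (g x) \<le> M)}"

text \<open>The product of two classes is computed on representatives; it is well defined by
  \<open>qi_mult_class\<close> below.\<close>

definition QI :: "('a::metric_space \<Rightarrow> 'a) set monoid" where
  "QI = \<lparr>carrier = {f. quasi_isometry f} // qi_rel,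
         mult = (\<lambda>A B. \<Union>f\<in>A. \<Union>g\<in>B. qi_rel `` {f \<circ> g}),
         one = qi_rel `` {id}\<rparr>"

lemma quasi_isometryI:
  assumes "C > 1"
    and "\<And>x y. dist x y \<le> C * (dist (f x) (f y) + C)"
    and "\<And>x y. dist (f x) (f y) \<le> C * dist x y + C"
    and "\<And>x'. \<exists>x. dist x' (f x) \<le> C"
  shows "quasi_isometry f"
proof -
  have "inverse C * dist x y - C \<le> dist (f x) (f y)" for x y
    using assms(1) assms(2)[of x y] by (simp add: field_simps)
  then show ?thesis
    using assms unfolding quasi_isometry_def quasi_isometry_const_def qi_embedding_const_def by blast
qed

lemma quasi_isometryE:
  assumes "quasi_isometry f"
  obtains C where "C > 1"
    and "\<And>x y. dist x y \<le> C * (dist (f x) (f y) + C)"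
    and "\<And>x y. dist (f x) (f y) \<le> C * dist x y + C"
    and "\<And>x'. \<exists>x. dist x' (f x) \<le> C"
proof -
  obtain C where C: "C > 1"
    "\<And>x y. inverse C * dist x y - C \<le> dist (f x) (f y)"
    "\<And>x y. dist (f x) (f y) \<le> C * dist x y + C"
    "\<And>x'. \<exists>x. dist x' (f x) \<le> C"
    using assms unfolding quasi_isometry_def quasi_isometry_const_def qi_embedding_const_def by blast
  have "dist x y \<le> C * (dist (f x) (f y) + C)" for x y
    using C(1) C(2)[of x y] by (simp add: field_simps)
  with C show ?thesis using that by blast
qed

lemma quasi_isometry_id: "quasi_isometry (id :: 'a::metric_space \<Rightarrow> 'a)"
proof (rule quasi_isometryI[of 2])
  show "\<exists>x. dist x' (id x) \<le> 2" for x' :: 'a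
    by (rule exI[of _ x']) simp
qed auto

lemma quasi_isometry_comp:
  fixes f :: "'b::metric_space \<Rightarrow> 'c::metric_space" and g :: "'a::metric_space \<Rightarrow> 'b"
  assumes "quasi_isometry f" "quasi_isometry g"
  shows "quasi_isometry (f \<circ> g)"
proof -
  obtain C where C: "C > 1" "\<And>x y. dist x y \<le> C * (dist (f x) (f y) + C)"
    "\<And>x y. dist (f x) (f y) \<le> C * dist x y + C" "\<And>x'. \<exists>x. dist x' (f x) \<le> C"
    by (rule quasi_isometryE[OF assms(1)]) (rule that)
  obtain D where D: "D > 1" "\<And>x y. dist x y \<le> D * (dist (g x) (g y) + D)"
    "\<And>x y. dist (g x) (g y) \<le> D * dist x y + D" "\<And>x'. \<exists>x. dist x' (g x) \<le> D"
    by (rule quasi_isometryE[OF assms(2)]) (rule that)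
  have CD: "C \<le> C * D" "D \<le> C * D" "1 < C * D"
    using C(1) D(1) by (auto simp: less_1_mult)
  show ?thesis
  proof (rule quasi_isometryI[of "3 * (C * D)"])
    show "3 * (C * D) > 1" using CD by simp
  next
    fix x y
    have "dist x y \<le> D * (C * (dist (f (g x)) (f (g y)) + C) + D)"
      by (rule order_trans[OF D(2)]) (use C(2) D(1) in \<open>auto intro!: mult_left_mono\<close>)
    also have "\<dots> = (C * D) * (dist (f (g x)) (f (g y)) + C) + D * D"
      by (simp add: algebra_simps)
    also have "\<dots> \<le> (C * D) * (dist (f (g x)) (f (g y)) + C * D) + (C * D) * (C * D)"
      using CD C(1) D(1) by (intro add_mono mult_left_mono mult_mono) auto
    also have "\<dots> \<le> (3 * (C * D)) * (dist (f (g x)) (f (g y)) + 3 * (C * D))"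
    proof -
      have "0 \<le> (C * D) * dist (f (g x)) (f (g y))" "0 \<le> (C * D) * (C * D)"
        using CD by auto
      then show ?thesis by (simp add: algebra_simps)
    qed
    finally show "dist x y \<le> (3 * (C * D)) * (dist ((f \<circ> g) x) ((f \<circ> g) y) + 3 * (C * D))"
      by simp
  next
    fix x y
    have "dist (f (g x)) (f (g y)) \<le> C * (D * dist x y + D) + C"
      by (rule order_trans[OF C(3)]) (use D(3) C(1) in \<open>auto intro!: mult_left_mono\<close>)
    also have "\<dots> = (C * D) * dist x y + C * D + C" by (simp add: algebra_simps)
    also have "\<dots> \<le> 3 * (C * D) * dist x y + 3 * (C * D)"
    proof -
      have "0 \<le> (C * D) * dist x y" using CD by auto
      then show ?thesis using CD unfolding mult.assoc by linarith
    qed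
    finally show "dist ((f \<circ> g) x) ((f \<circ> g) y) \<le> 3 * (C * D) * dist x y + 3 * (C * D)" by simp
  next
    fix x'
    obtain y where y: "dist x' (f y) \<le> C" using C(4) by blast
    obtain x where x: "dist y (g x) \<le> D" using D(4) by blast
    have "dist x' (f (g x)) \<le> dist x' (f y) + dist (f y) (f (g x))" by (rule dist_triangle)
    also have "\<dots> \<le> C + (C * dist y (g x) + C)" using y C(3) by (intro add_mono) auto
    also have "\<dots> \<le> C + (C * D + C)" using x C(1) by (intro add_mono mult_left_mono) auto
    also have "\<dots> \<le> 3 * (C * D)" using CD by simp
    finally show "\<exists>x. dist x' ((f \<circ> g) x) \<le> 3 * (C * D)" by auto
  qed
qed

lemma equiv_qi_rel: "equiv {f :: 'a::metric_space \<Rightarrow> 'a. quasi_isometry f} qi_rel"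
proof (rule equivI)
  show "qi_rel \<subseteq> {f :: 'a \<Rightarrow> 'a. quasi_isometry f} \<times> {f. quasi_isometry f}"
    by (auto simp: qi_rel_def)
  show "refl_on {f :: 'a \<Rightarrow> 'a. quasi_isometry f} qi_rel"
    by (auto simp: refl_on_def qi_rel_def)
  show "sym (qi_rel :: (('a \<Rightarrow> 'a) \<times> _) set)"
    by (auto simp: sym_def qi_rel_def dist_commute)
  show "trans (qi_rel :: (('a \<Rightarrow> 'a) \<times> _) set)"
  proof (rule transI)
    fix f g h :: "'a \<Rightarrow> 'a"
    assume "(f, g) \<in> qi_rel" "(g, h) \<in> qi_rel"
    then obtain M N where "quasi_isometry f" "quasi_isometry h"
      "\<And>x. dist (f x) (g x) \<le> M" "\<And>x. dist (g x) (h x) \<le> N"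
      unfolding qi_rel_def by auto
    moreover from this have "dist (f x) (h x) \<le> M + N" for x
      using dist_triangle[of "f x" "h x" "g x"] calculation(3)[of x] calculation(4)[of x] by linarith
    ultimately show "(f, h) \<in> qi_rel" unfolding qi_rel_def by blast
  qed
qed

lemma qi_rel_comp:
  assumes "(f, f') \<in> qi_rel" "(g, g') \<in> qi_rel"
  shows "(f \<circ> g, f' \<circ> g') \<in> qi_rel"
proof -
  from assms obtain M N where *: "quasi_isometry f" "quasi_isometry f'"
      "quasi_isometry g" "quasi_isometry g'"
      "\<And>x. dist (f x) (f' x) \<le> M" "\<And>x. dist (g x) (g' x) \<le> N"
    unfolding qi_rel_def by auto
  obtain C where C: "C > 1" "\<And>x y. dist (f x) (f y) \<le> C * dist x y + C"
    by (rule quasi_isometryE[OF *(1)]) (rule that)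
  have "dist (f (g x)) (f' (g' x)) \<le> (C * N + C) + M" for x
  proof -
    have "dist (f (g x)) (f' (g' x)) \<le> dist (f (g x)) (f (g' x)) + dist (f (g' x)) (f' (g' x))"
      by (rule dist_triangle)
    also have "dist (f (g x)) (f (g' x)) \<le> C * dist (g x) (g' x) + C" by (rule C)
    also have "C * dist (g x) (g' x) + C \<le> C * N + C" using C(1) *(6) by simp
    finally show ?thesis using *(5)[of "g' x"] by simp
  qed
  then show ?thesis unfolding qi_rel_def using * quasi_isometry_comp by fastforce
qed

lemma qi_mult_class:
  assumes "quasi_isometry f" "quasi_isometry g"
  shows "(qi_rel `` {f}) \<otimes>\<^bsub>QI\<^esub> (qi_rel `` {g}) = qi_rel `` {f \<circ> g}"
proof -
  have "congruent2 qi_rel qi_rel (\<lambda>f g. qi_rel `` {f \<circ> g})"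
    by (rule congruent2I') (meson equiv_class_eq equiv_qi_rel qi_rel_comp)
  from UN_equiv_class2[OF equiv_qi_rel equiv_qi_rel this] assms
  show ?thesis by (simp add: QI_def)
qed

lemma quasi_isometry_inverse:
  fixes f :: "'a::metric_space \<Rightarrow> 'a"
  assumes "quasi_isometry f"
  shows "\<exists>g. quasi_isometry g \<and> (g \<circ> f, id) \<in> qi_rel"
proof -
  obtain C where C: "C > 1" "\<And>x y. dist x y \<le> C * (dist (f x) (f y) + C)"
    "\<And>x y. dist (f x) (f y) \<le> C * dist x y + C" "\<And>x'. \<exists>x. dist x' (f x) \<le> C"
    by (rule quasi_isometryE[OF assms]) (rule that)
  from C(4) obtain g where g: "\<And>y. dist y (f (g y)) \<le> C" by metis
  have CC: "C < C * C" "0 < C" "1 < C * C" using C(1) by (auto simp: less_1_mult)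
  have near: "dist x (g (f x)) \<le> 3 * (C * C)" for x
  proof -
    have "dist x (g (f x)) \<le> C * (dist (f x) (f (g (f x))) + C)" by (rule C(2))
    also have "\<dots> \<le> C * (C + C)" using C(1) g by (intro mult_left_mono add_mono) auto
    also have "\<dots> \<le> 3 * (C * C)" using CC unfolding distrib_left by linarith
    finally show ?thesis .
  qed
  have "quasi_isometry g"
  proof (rule quasi_isometryI[of "3 * (C * C)"])
    show "3 * (C * C) > 1" using C(1) CC by linarith
  next
    fix y z
    have "dist y z \<le> dist y (f (g y)) + dist (f (g y)) (f (g z)) + dist z (f (g z))"
      using dist_triangle[of y z "f (g y)"] dist_triangle[of "f (g y)" z "f (g z)"]
      by (simp add: dist_commute)
    also have "\<dots> \<le> C + (C * dist (g y) (g z) + C) + C" using g C(3) by (intro add_mono) auto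
    also have "\<dots> = C * (dist (g y) (g z) + 3)" by (simp add: algebra_simps)
    also have "\<dots> \<le> 3 * (C * C) * (dist (g y) (g z) + 3 * (C * C))"
    proof (intro mult_mono add_mono)
      show "C \<le> 3 * (C * C)" "3 \<le> 3 * (C * C)" "0 \<le> 3 * (C * C)" using CC by linarith+
    qed auto
    finally show "dist y z \<le> 3 * (C * C) * (dist (g y) (g z) + 3 * (C * C))" .
  next
    fix y z
    have "dist (f (g y)) (f (g z)) \<le> dist y (f (g y)) + dist y z + dist z (f (g z))"
      using dist_triangle[of "f (g y)" "f (g z)" y] dist_triangle[of y "f (g z)" z]
      by (simp add: dist_commute)
    also have "\<dots> \<le> C + dist y z + C" using g by (intro add_mono) auto
    finally have 1: "dist (f (g y)) (f (g z)) + C \<le> dist y z + 3 * C" by simp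
    have "dist (g y) (g z) \<le> C * (dist (f (g y)) (f (g z)) + C)" by (rule C(2))
    also have "\<dots> \<le> C * (dist y z + 3 * C)" using 1 C(1) by (intro mult_left_mono) auto
    also have "\<dots> = C * dist y z + 3 * (C * C)" by (simp add: algebra_simps)
    also have "\<dots> \<le> 3 * (C * C) * dist y z + 3 * (C * C)"
      using CC by (intro add_mono mult_right_mono) auto
    finally show "dist (g y) (g z) \<le> 3 * (C * C) * dist y z + 3 * (C * C)" .
  next
    show "\<exists>y. dist x (g y) \<le> 3 * (C * C)" for x using near by blast
  qed
  moreover have "(g \<circ> f, id) \<in> qi_rel"
    unfolding qi_rel_def using calculation assms near
    by (auto simp: quasi_isometry_comp quasi_isometry_id dist_commute intro!: exI[of _ "3 * (C * C)"])
  ultimately show ?thesis by blast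
qed

lemma group_QI: "group (QI :: ('a::metric_space \<Rightarrow> 'a) set monoid)"
proof (rule groupI)
  show "\<one>\<^bsub>QI\<^esub> \<in> carrier QI"
    by (auto simp: QI_def intro!: quotientI quasi_isometry_id)
next
  fix A B :: "('a \<Rightarrow> 'a) set"
  assume "A \<in> carrier QI" "B \<in> carrier QI"
  then obtain f g where "A = qi_rel `` {f}" "quasi_isometry f" "B = qi_rel `` {g}" "quasi_isometry g"
    by (auto simp: QI_def elim!: quotientE)
  then show "A \<otimes>\<^bsub>QI\<^esub> B \<in> carrier QI"
    by (simp add: qi_mult_class) (auto simp: QI_def intro!: quotientI quasi_isometry_comp)
next
  fix A B D :: "('a \<Rightarrow> 'a) set"
  assume "A \<in> carrier QI" "B \<in> carrier QI" "D \<in> carrier QI"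
  then obtain f g h where "A = qi_rel `` {f}" "quasi_isometry f" "B = qi_rel `` {g}"
      "quasi_isometry g" "D = qi_rel `` {h}" "quasi_isometry h"
    by (auto simp: QI_def elim!: quotientE)
  then show "A \<otimes>\<^bsub>QI\<^esub> B \<otimes>\<^bsub>QI\<^esub> D = A \<otimes>\<^bsub>QI\<^esub> (B \<otimes>\<^bsub>QI\<^esub> D)"
    by (simp add: qi_mult_class quasi_isometry_comp comp_assoc)
next
  fix A :: "('a \<Rightarrow> 'a) set"
  assume "A \<in> carrier QI"
  then obtain f where f: "A = qi_rel `` {f}" "quasi_isometry f"
    by (auto simp: QI_def elim!: quotientE)
  have one: "\<one>\<^bsub>QI\<^esub> = qi_rel `` {id}" by (simp add: QI_def)
  show "\<one>\<^bsub>QI\<^esub> \<otimes>\<^bsub>QI\<^esub> A = A"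
    by (simp add: one f qi_mult_class quasi_isometry_id)
  obtain g where g: "quasi_isometry g" "(g \<circ> f, id) \<in> qi_rel"
    using quasi_isometry_inverse f(2) by blast
  have "(qi_rel `` {g}) \<otimes>\<^bsub>QI\<^esub> A = \<one>\<^bsub>QI\<^esub>"
    using f g by (simp add: one qi_mult_class equiv_class_eq[OF equiv_qi_rel])
  moreover have "qi_rel `` {g} \<in> carrier QI" using g by (auto simp: QI_def intro!: quotientI)
  ultimately show "\<exists>B\<in>carrier QI. B \<otimes>\<^bsub>QI\<^esub> A = \<one>\<^bsub>QI\<^esub>" by blast
qed


section \<open>Groups of homeomorphisms\<close>

definition real_homeo :: "(real \<Rightarrow> real) \<Rightarrow> bool" where
  "real_homeo f \<longleftrightarrow> (\<exists>g. homeomorphism UNIV UNIV f g)"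

definition comp_group :: "(real \<Rightarrow> real) set \<Rightarrow> (real \<Rightarrow> real) monoid" where
  "comp_group H = \<lparr>carrier = H, mult = (\<circ>), one = id\<rparr>"

definition circle_proj :: "real \<Rightarrow> complex" where
  "circle_proj t = exp (2 * of_real pi * \<i> * of_real t)"

abbreviation circle :: "complex set" where
  "circle \<equiv> sphere 0 1"

text \<open>A self-map of the circle is represented by a map on \<open>\<complex>\<close>, whose values off the circle are
  irrelevant.\<close>

definition is_lift :: "(real \<Rightarrow> real) \<Rightarrow> (complex \<Rightarrow> complex) \<Rightarrow> bool" where
  "is_lift F f \<longleftrightarrow> real_homeo F \<and> circle_proj \<circ> F = f \<circ> circle_proj"

definition lifts :: "(complex \<Rightarrow> complex) set \<Rightarrow> (real \<Rightarrow> real) set" where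
  "lifts \<Gamma> = {F. \<exists>f\<in>\<Gamma>. is_lift F f}"

definition smooth_curve :: "(real \<Rightarrow> complex) \<Rightarrow> bool" where
  "smooth_curve \<gamma> \<longleftrightarrow> (\<exists>D. D 0 = \<gamma> \<and>
     (\<forall>n t. (D n has_vector_derivative D (Suc n) t) (at t)))"

text \<open>The local inverses of \<^const>\<open>circle_proj\<close> are the charts of the circle, and the circle is an
  embedded submanifold of the plane. So a map \<open>f\<close> from the circle to itself is \<open>C\<^sup>\<infinity>\<close> iff
  \<open>f \<circ> circle_proj\<close> is \<open>C\<^sup>\<infinity>\<close> as a map into \<open>\<complex>\<close>.\<close>

definition Diff_circle :: "(complex \<Rightarrow> complex) set" where
  "Diff_circle = {f. \<exists>g. homeomorphism circle circle f g \<and>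
     smooth_curve (f \<circ> circle_proj) \<and> smooth_curve (g \<circ> circle_proj)}"

text \<open>The set \<open>B\<close> of breakpoints is locally finite, not necessarily finite: a lift of a
  piecewise-linear homeomorphism of the circle has in general infinitely many of them.\<close>

definition piecewise_linear :: "(real \<Rightarrow> real) \<Rightarrow> bool" where
  "piecewise_linear f \<longleftrightarrow> continuous_on UNIV f \<and>
     (\<exists>B. (\<forall>a b. finite (B \<inter> {a..b})) \<and>
          (\<forall>a b. B \<inter> {a<..<b} = {} \<longrightarrow> (\<exists>m c. \<forall>x\<in>{a<..<b}. f x = m * x + c)))"

definition PL_circle :: "(complex \<Rightarrow> complex) set" where
  "PL_circle = {f. (\<exists>g. homeomorphism circle circle f g) \<and>
     (\<forall>F. is_lift F f \<longrightarrow> piecewise_linear F)}"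

definition PL_kappa :: "(real \<Rightarrow> real) set" where
  "PL_kappa = {f. real_homeo f \<and> piecewise_linear f \<and> compact (closure {x. f x \<noteq> x})}"


section \<open>Free groups, presentations and Thompson's group\<close>

text \<open>In a word over \<open>S\<close>, the letter \<open>(x, True)\<close> stands for the generator \<open>x\<close> and
  \<open>(x, False)\<close> for its formal inverse.\<close>

type_synonym 'a fg_word = "('a \<times> bool) list"

inductive_set free_rel :: "'a set \<Rightarrow> ('a fg_word \<times> 'a fg_word) set" for S :: "'a set" where
  refl: "w \<in> lists (S \<times> UNIV) \<Longrightarrow> (w, w) \<in> free_rel S"
| sym: "(v, w) \<in> free_rel S \<Longrightarrow> (w, v) \<in> free_rel S"
| trans: "(u, v) \<in> free_rel S \<Longrightarrow> (v, w) \<in> free_rel S \<Longrightarrow> (u, w) \<in> free_rel S"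
| cancel: "u \<in> lists (S \<times> UNIV) \<Longrightarrow> v \<in> lists (S \<times> UNIV) \<Longrightarrow> x \<in> S \<Longrightarrow>
    (u @ [(x, b), (x, \<not> b)] @ v, u @ v) \<in> free_rel S"

definition free_group :: "'a set \<Rightarrow> 'a fg_word set monoid" where
  "free_group S = \<lparr>carrier = lists (S \<times> UNIV) // free_rel S,
     mult = (\<lambda>A B. \<Union>u\<in>A. \<Union>v\<in>B. free_rel S `` {u @ v}),
     one = free_rel S `` {[]}\<rparr>"

definition free_gen :: "'a set \<Rightarrow> 'a \<Rightarrow> 'a fg_word set" where
  "free_gen S x = free_rel S `` {[(x, True)]}"

definition normal_closure :: "('a, 'b) monoid_scheme \<Rightarrow> 'a set \<Rightarrow> 'a set" where
  "normal_closure G R = \<Inter>{N. N \<lhd> G \<and> R \<subseteq> N}"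

definition presented_group :: "'a set \<Rightarrow> 'a fg_word set set \<Rightarrow> 'a fg_word set set monoid" where
  "presented_group S R = free_group S Mod normal_closure (free_group S) R"

definition thompson_relators :: "nat fg_word set set" where
  "thompson_relators =
    (let G = free_group (UNIV :: nat set); x = free_gen UNIV
     in {x i \<otimes>\<^bsub>G\<^esub> x j \<otimes>\<^bsub>G\<^esub> inv\<^bsub>G\<^esub> (x i) \<otimes>\<^bsub>G\<^esub> inv\<^bsub>G\<^esub> (x (j + 1)) | i j. i < j})"

definition Thompson_F :: "nat fg_word set set monoid" where
  "Thompson_F = presented_group UNIV thompson_relators"

lemma free_rel_words:
  "(v, w) \<in> free_rel S \<Longrightarrow> v \<in> lists (S \<times> UNIV) \<and> w \<in> lists (S \<times> UNIV)"
  by (induction rule: free_rel.induct) auto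

lemma equiv_free_rel: "equiv (lists (S \<times> UNIV)) (free_rel S)"
proof (rule equivI)
  show "free_rel S \<subseteq> lists (S \<times> UNIV) \<times> lists (S \<times> UNIV)"
    by (rule subrelI, drule free_rel_words, rule SigmaI, simp_all)
  show "refl_on (lists (S \<times> UNIV)) (free_rel S)"
    by (auto simp: refl_on_def intro: free_rel.refl)
  show "sym (free_rel S)" by (auto simp: sym_def intro: free_rel.sym)
  show "trans (free_rel S)" by (auto simp: trans_def intro: free_rel.trans)
qed

lemma free_rel_append:
  assumes "(u, u') \<in> free_rel S" "(v, v') \<in> free_rel S"
  shows "(u @ v, u' @ v') \<in> free_rel S"
proof -
  have left: "(u @ w, u' @ w) \<in> free_rel S"
    if "(u, u') \<in> free_rel S" "w \<in> lists (S \<times> UNIV)" for u u' w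
    using that
  proof (induction rule: free_rel.induct)
    case (cancel u v x b)
    then show ?case using free_rel.cancel[of u S "v @ w" x b] by simp
  next
    case (refl v)
    then show ?case by (intro free_rel.refl) simp
  qed (blast intro: free_rel.sym free_rel.trans)+
  have right: "(w @ v, w @ v') \<in> free_rel S"
    if "(v, v') \<in> free_rel S" "w \<in> lists (S \<times> UNIV)" for v v' w
    using that
  proof (induction rule: free_rel.induct)
    case (cancel u v x b)
    then show ?case using free_rel.cancel[of "w @ u" S v x b] by simp
  next
    case (refl v)
    then show ?case by (intro free_rel.refl) simp
  qed (blast intro: free_rel.sym free_rel.trans)+
  show ?thesis
    using left[OF assms(1)] right[OF assms(2)] free_rel_words[OF assms(1)]
      free_rel_words[OF assms(2)] by (blast intro: free_rel.trans)
qed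

lemma free_mult_class:
  assumes "u \<in> lists (S \<times> UNIV)" "v \<in> lists (S \<times> UNIV)"
  shows "(free_rel S `` {u}) \<otimes>\<^bsub>free_group S\<^esub> (free_rel S `` {v}) = free_rel S `` {u @ v}"
proof -
  have "congruent2 (free_rel S) (free_rel S) (\<lambda>u v. free_rel S `` {u @ v})"
    by (rule congruent2I') (meson equiv_class_eq equiv_free_rel free_rel_append)
  from UN_equiv_class2[OF equiv_free_rel equiv_free_rel this] assms
  show ?thesis by (simp add: free_group_def)
qed

lemma free_rel_left_inverse:
  "w \<in> lists (S \<times> UNIV) \<Longrightarrow>
    (rev (map (\<lambda>(x, b). (x, \<not> b)) w) @ w, []) \<in> free_rel S"
proof (induction w)
  case Nil
  then show ?case by (simp add: free_rel.refl)
next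
  case (Cons a w)
  obtain x b where a: "a = (x, b)" by (cases a)
  let ?r = "rev (map (\<lambda>(x, b). (x, \<not> b)) w)"
  have w: "w \<in> lists (S \<times> UNIV)" "x \<in> S" using Cons.prems a by auto
  then have "?r \<in> lists (S \<times> UNIV)" by (auto simp: in_lists_conv_set)
  from free_rel.cancel[OF this w, of "\<not> b"] Cons.IH[OF w(1)]
  show ?case by (auto simp: a intro: free_rel.trans)
qed

lemma group_free_group: "group (free_group S)"
proof (rule groupI)
  show "\<one>\<^bsub>free_group S\<^esub> \<in> carrier (free_group S)"
    by (auto simp: free_group_def intro!: quotientI)
next
  fix A B assume "A \<in> carrier (free_group S)" "B \<in> carrier (free_group S)"
  then obtain u v where "A = free_rel S `` {u}" "u \<in> lists (S \<times> UNIV)"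
      "B = free_rel S `` {v}" "v \<in> lists (S \<times> UNIV)"
    by (auto simp: free_group_def elim!: quotientE)
  then show "A \<otimes>\<^bsub>free_group S\<^esub> B \<in> carrier (free_group S)"
    by (simp add: free_mult_class) (auto simp: free_group_def intro!: quotientI)
next
  fix A B D
  assume "A \<in> carrier (free_group S)" "B \<in> carrier (free_group S)" "D \<in> carrier (free_group S)"
  then obtain u v w where "A = free_rel S `` {u}" "u \<in> lists (S \<times> UNIV)"
      "B = free_rel S `` {v}" "v \<in> lists (S \<times> UNIV)"
      "D = free_rel S `` {w}" "w \<in> lists (S \<times> UNIV)"
    by (auto simp: free_group_def elim!: quotientE)
  moreover from this have "u @ v \<in> lists (S \<times> UNIV)" "v @ w \<in> lists (S \<times> UNIV)" by auto
  ultimately show "A \<otimes>\<^bsub>free_group S\<^esub> B \<otimes>\<^bsub>free_group S\<^esub> D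
      = A \<otimes>\<^bsub>free_group S\<^esub> (B \<otimes>\<^bsub>free_group S\<^esub> D)"
    by (simp only: free_mult_class append_assoc)
next
  fix A assume "A \<in> carrier (free_group S)"
  then obtain u where u: "A = free_rel S `` {u}" "u \<in> lists (S \<times> UNIV)"
    by (auto simp: free_group_def elim!: quotientE)
  have one: "\<one>\<^bsub>free_group S\<^esub> = free_rel S `` {[]}" by (simp add: free_group_def)
  have nil: "[] \<in> lists (S \<times> UNIV)" by simp
  show "\<one>\<^bsub>free_group S\<^esub> \<otimes>\<^bsub>free_group S\<^esub> A = A"
    by (simp only: one u(1) free_mult_class[OF nil u(2)] append_Nil)
  let ?v = "rev (map (\<lambda>(x, b). (x, \<not> b)) u)"
  have v: "?v \<in> lists (S \<times> UNIV)" using u(2) by (auto simp: in_lists_conv_set)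
  have "(free_rel S `` {?v}) \<otimes>\<^bsub>free_group S\<^esub> A = \<one>\<^bsub>free_group S\<^esub>"
    unfolding one u(1) free_mult_class[OF v u(2)]
    by (rule equiv_class_eq[OF equiv_free_rel free_rel_left_inverse[OF u(2)]])
  moreover have "free_rel S `` {?v} \<in> carrier (free_group S)"
    using v unfolding free_group_def by (auto intro!: quotientI)
  ultimately show "\<exists>B\<in>carrier (free_group S). B \<otimes>\<^bsub>free_group S\<^esub> A = \<one>\<^bsub>free_group S\<^esub>"
    by blast
qed

lemma normal_normal_closure:
  assumes "group G" "R \<subseteq> carrier G"
  shows "normal_closure G R \<lhd> G"
proof -
  interpret group G by fact
  have "carrier G \<lhd> G" by (simp add: normal_inv_iff subgroup_self)
  then have "carrier G \<in> {N. N \<lhd> G \<and> R \<subseteq> N}" using assms(2) by simp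
  then have "subgroup (normal_closure G R) G"
    unfolding normal_closure_def
    by (intro subgroups_Inter) (auto intro: normal_imp_subgroup)
  then show ?thesis
    unfolding normal_inv_iff by (auto simp: normal_closure_def normal_inv_iff)
qed

lemma group_presented_group:
  "R \<subseteq> carrier (free_group S) \<Longrightarrow> group (presented_group S R)"
  unfolding presented_group_def
  by (intro normal.factorgroup_is_group normal_normal_closure group_free_group)

lemma group_Thompson_F: "group Thompson_F"
proof -
  let ?G = "free_group (UNIV :: nat set)"
  interpret group ?G by (rule group_free_group)
  have "free_gen UNIV i \<in> carrier ?G" for i
    by (auto simp: free_group_def free_gen_def intro!: quotientI)
  then have "thompson_relators \<subseteq> carrier ?G"
    by (auto simp: thompson_relators_def Let_def)
  then show ?thesis unfolding Thompson_F_def by (rule group_presented_group)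
qed

end

theory Submission
  imports Defs
begin

text \<open>
  An element of \<^term>\<open>QI\<close> is trivial iff its representatives move points by uniformly bounded
  distances. So to embed a group it is enough to represent its elements by bi-Lipschitz maps of the
  line, multiplicatively up to
  bounded error, in such a way that nontrivial elements have unbounded displacement. There are two
  sources of unbounded displacement.

  \<^bold>\<open>Exponentiation.\<close> A lift \<open>F\<close> of a circle homeomorphism satisfies \<open>F (t + 1) = F t \<plusminus> 1\<close>. Under the
  coordinate \<open>x = exp t\<close> the translation by \<open>1\<close> becomes the multiplication by \<open>e\<close>, and an increasing
  \<open>F\<close> becomes a map of the half-line that commutes with it. This map is Lipschitz if \<open>F\<close> is
  (\<open>exponentiate_lipschitz\<close>), and a point that it moves has multiples by powers of \<open>e\<close> that are
  moved arbitrarily far.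
  Decreasing lifts turn the half-line around; they are accommodated by letting the whole group act on
  two half-lines, which the decreasing lifts exchange. This gives \<open>embeds_in_QI_lifts\<close>. For smooth
  diffeomorphisms it remains to see that they form a group and that their lifts, being \<open>C\<^sup>1\<close>, are
  Lipschitz on \<open>[0, 1]\<close>; for piecewise-linear homeomorphisms the group property and the Lipschitz bound follow from a local description of piecewise linearity.

  \<^bold>\<open>Copies on growing scales.\<close> A compactly supported bi-Lipschitz homeomorphism \<open>f\<close> is copied by affine
  maps into a sequence of disjoint intervals, the blocks, on scales that tend to infinity. The Lipschitz
  constants do not depend on the scale, and a point moved by \<open>f\<close> has copies that are moved arbitrarily
  far. So every group of such homeomorphisms embeds (\<open>embeds_in_QI_if_BL_compact\<close>), in particular the
  compactly supported piecewise-linear ones. Thompson's group acts by such homeomorphisms. Faithfulness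
  of the action on the group given by the presentation uses that every element is a fraction of
  products of generators with nonincreasing indices, and that such a product can be recovered from
  the map (\<open>thompson_pos_inj\<close>).

  The free group uses the freedom to act differently in different blocks. For a reduced word of
  length \<open>l\<close> there are increasing maps, one for each letter and all with slopes in \<open>[1/3, 3]\<close>, for
  which the word moves \<open>l\<close> to \<open>0\<close>: each letter only has to move certain integers by one, and in a
  reduced word these requirements are compatible (\<open>moves_compatible\<close>). There are uncountably
  many words in real numbers, but only countably many in integers, and the letters of a
  word in real numbers \<open>r\<close> can be told apart by the integers \<open>\<lfloor>N r\<rfloor>\<close> for all large \<open>N\<close>. So countably
  many blocks, indexed by \<open>N\<close> and a word in integers, detect all reduced words in real numbers.
\<close>


section \<open>Embedding criteria\<close>

text \<open>A map into \<^term>\<open>QI\<close> is most conveniently given by representatives, and those need only be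
  multiplicative up to bounded error.\<close>

lemma embeds_in_QI_by_representatives:
  fixes \<phi> :: "'g \<Rightarrow> 'a::metric_space \<Rightarrow> 'a"
  assumes "group G"
    and qi: "\<And>x. x \<in> carrier G \<Longrightarrow> quasi_isometry (\<phi> x)"
    and mult: "\<And>x y. x \<in> carrier G \<Longrightarrow> y \<in> carrier G \<Longrightarrow> (\<phi> (x \<otimes>\<^bsub>G\<^esub> y), \<phi> x \<circ> \<phi> y) \<in> qi_rel"
    and triv: "\<And>x. x \<in> carrier G \<Longrightarrow> (\<phi> x, id) \<in> qi_rel \<Longrightarrow> x = \<one>\<^bsub>G\<^esub>"
  shows "embeds_in G (QI :: ('a \<Rightarrow> 'a) set monoid)"
proof -
  let ?Q = "QI :: ('a \<Rightarrow> 'a) set monoid"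
  define h where "h x = qi_rel `` {\<phi> x}" for x
  have hom: "h \<in> hom G ?Q"
  proof (rule homI)
    show "h x \<in> carrier ?Q" if "x \<in> carrier G" for x
      using qi[OF that] by (auto simp: QI_def h_def intro!: quotientI)
    show "h (x \<otimes>\<^bsub>G\<^esub> y) = h x \<otimes>\<^bsub>?Q\<^esub> h y" if "x \<in> carrier G" "y \<in> carrier G" for x y
      using that mult by (simp add: h_def qi_mult_class qi equiv_class_eq[OF equiv_qi_rel])
  qed
  interpret group_hom G ?Q h
    using hom assms(1) group_QI by (simp add: group_hom_def group_hom_axioms_def)
  have "x = \<one>\<^bsub>G\<^esub>" if x: "x \<in> carrier G" and hx: "h x = \<one>\<^bsub>?Q\<^esub>" for x
  proof -
    have "qi_rel `` {\<phi> x} = qi_rel `` {id}" using hx by (simp add: h_def QI_def)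
    moreover have "(id, id) \<in> (qi_rel :: (('a \<Rightarrow> 'a) \<times> _) set)"
      using quasi_isometry_id by (auto simp: qi_rel_def intro: exI[of _ 0])
    ultimately have "(\<phi> x, id) \<in> qi_rel" by blast
    with x show ?thesis by (rule triv)
  qed
  then have "inj_on h (carrier G)" by (simp add: inj_on_one_iff)
  then have "h \<in> iso G (?Q\<lparr>carrier := h ` carrier G\<rparr>)"
    using hom by (auto simp: iso_def hom_def bij_betw_def)
  then show ?thesis
    unfolding embeds_in_def using img_is_subgroup is_isoI by blast
qed

lemma embeds_in_by_hom:
  assumes "group G" "group K" "h \<in> hom G K"
    and triv: "\<And>x. x \<in> carrier G \<Longrightarrow> h x = \<one>\<^bsub>K\<^esub> \<Longrightarrow> x = \<one>\<^bsub>G\<^esub>"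
  shows "embeds_in G K"
proof -
  interpret group_hom G K h using assms by (simp add: group_hom_def group_hom_axioms_def)
  have "inj_on h (carrier G)" using triv by (simp add: inj_on_one_iff)
  then have "h \<in> iso G (K\<lparr>carrier := h ` carrier G\<rparr>)"
    using assms(3) by (auto simp: iso_def hom_def bij_betw_def)
  then show ?thesis
    unfolding embeds_in_def using img_is_subgroup is_isoI by blast
qed

lemma embeds_in_trans:
  assumes "group G" "group K" "group L" "embeds_in G K" "embeds_in K L"
  shows "embeds_in G L"
proof -
  have emb: "\<exists>h. h \<in> hom A B \<and> inj_on h (carrier A)" if emb: "embeds_in A B"
    for A :: "('x, 'y) monoid_scheme" and B :: "('z, 'w) monoid_scheme"
  proof -
    obtain H h where "subgroup H B" "h \<in> iso A (B\<lparr>carrier := H\<rparr>)"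
      using emb unfolding embeds_in_def is_iso_def by blast
    then have "h \<in> hom A B" "inj_on h (carrier A)"
      using subgroup.subset by (fastforce simp: iso_def hom_def bij_betw_def)+
    then show ?thesis by blast
  qed
  obtain h k where hk: "h \<in> hom G K" "inj_on h (carrier G)" "k \<in> hom K L" "inj_on k (carrier K)"
    using emb assms(4,5) by meson
  have "h ` carrier G \<subseteq> carrier K" using hk(1) by (auto simp: hom_def)
  then have inj: "inj_on (k \<circ> h) (carrier G)"
    using hk by (meson comp_inj_on inj_on_subset)
  have "k \<circ> h \<in> hom G L" using hk(1,3) by (rule hom_compose)
  with assms(1,3) inj show ?thesis
    by (intro embeds_in_by_hom[of G L "k \<circ> h"]) (auto simp: inj_on_one_iff' )
qed

text \<open>Here \<open>inv\<close> stands for inverses in a group; the inverse of a function has its own name.\<close>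

abbreviation finv :: "('a \<Rightarrow> 'b) \<Rightarrow> 'b \<Rightarrow> 'a" where
  "finv f \<equiv> inv_into UNIV f"

lemma surj_if_solvable: "(\<And>y. \<exists>x. f x = y) \<Longrightarrow> surj f"
  by (metis surjI)

lemma comp_group_groupI:
  assumes "id \<in> H"
    and "\<And>f g. f \<in> H \<Longrightarrow> g \<in> H \<Longrightarrow> f \<circ> g \<in> H"
    and "\<And>f. f \<in> H \<Longrightarrow> finv f \<in> H"
    and "\<And>f. f \<in> H \<Longrightarrow> bij f"
  shows "group (comp_group H)"
proof (rule groupI)
  show "\<exists>y\<in>carrier (comp_group H). y \<otimes>\<^bsub>comp_group H\<^esub> x = \<one>\<^bsub>comp_group H\<^esub>"
    if "x \<in> carrier (comp_group H)" for x
    using that assms(3)[of x] assms(4)[of x] inv_o_cancel[of x]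
    by (auto simp: comp_group_def bij_def intro!: bexI[of _ "finv x"])
qed (use assms in \<open>auto simp: comp_group_def comp_assoc\<close>)


section \<open>Bi-Lipschitz homeomorphisms\<close>

definition bilipschitz :: "real \<Rightarrow> ('a::metric_space \<Rightarrow> 'a) \<Rightarrow> bool" where
  "bilipschitz L f \<longleftrightarrow> L \<ge> 1 \<and> surj f \<and>
     (\<forall>x y. dist (f x) (f y) \<le> L * dist x y \<and> dist x y \<le> L * dist (f x) (f y))"

lemma bilipschitzD:
  assumes "bilipschitz L f"
  shows "L \<ge> 1" "bij f" "dist (f x) (f y) \<le> L * dist x y" "dist x y \<le> L * dist (f x) (f y)"
proof -
  show "L \<ge> 1" "dist (f x) (f y) \<le> L * dist x y" "dist x y \<le> L * dist (f x) (f y)"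
    using assms by (auto simp: bilipschitz_def)
  have "inj f"
  proof (rule injI)
    fix x y assume "f x = f y"
    then have "dist x y \<le> L * 0" using assms by (metis bilipschitz_def dist_self)
    then show "x = y" by simp
  qed
  then show "bij f" using assms by (simp add: bilipschitz_def bij_def)
qed

lemma bilipschitz_mono: "bilipschitz L f \<Longrightarrow> L \<le> M \<Longrightarrow> bilipschitz M f"
  unfolding bilipschitz_def by (meson mult_right_mono order_trans zero_le_dist)

lemma bilipschitz_id: "1 \<le> L \<Longrightarrow> bilipschitz L id"
  by (auto simp: bilipschitz_def mult_le_cancel_right1 not_less)

lemma bilipschitz_comp:
  assumes "bilipschitz L f" "bilipschitz M g"
  shows "bilipschitz (L * M) (f \<circ> g)"
proof -
  have L: "L \<ge> 1" "M \<ge> 1" using assms bilipschitzD(1) by blast+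
  have 1: "dist (f (g x)) (f (g y)) \<le> L * M * dist x y" for x y
  proof -
    have "dist (f (g x)) (f (g y)) \<le> L * dist (g x) (g y)" by (rule bilipschitzD(3)[OF assms(1)])
    also have "\<dots> \<le> L * (M * dist x y)"
      using L by (intro mult_left_mono bilipschitzD(3)[OF assms(2)]) auto
    finally show ?thesis by (simp add: mult.assoc)
  qed
  have 2: "dist x y \<le> L * M * dist (f (g x)) (f (g y))" for x y
  proof -
    have "dist x y \<le> M * dist (g x) (g y)" by (rule bilipschitzD(4)[OF assms(2)])
    also have "\<dots> \<le> M * (L * dist (f (g x)) (f (g y)))"
      using L by (intro mult_left_mono bilipschitzD(4)[OF assms(1)]) auto
    finally show ?thesis by (simp add: mult_ac)
  qed
  have "1 \<le> L * M" using L mult_mono[of 1 L 1 M] by simp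
  moreover have "surj (f \<circ> g)" 
    using assms comp_surj[of g f] unfolding bilipschitz_def by blast
  ultimately show ?thesis using 1 2 by (simp add: bilipschitz_def)
qed

lemma bilipschitz_inv:
  assumes "bilipschitz L f"
  shows "bilipschitz L (finv f)"
proof -
  have s: "surj f" and b: "bij f" using assms bilipschitzD(2) by (auto simp: bilipschitz_def)
  have "dist (finv f x) (finv f y) \<le> L * dist x y \<and> dist x y \<le> L * dist (finv f x) (finv f y)" for x y
    using bilipschitzD(3,4)[OF assms, of "finv f x" "finv f y"] by (simp add: s surj_f_inv_f)
  then show ?thesis using bilipschitzD(1)[OF assms] b
    by (simp add: bilipschitz_def bij_imp_bij_inv bij_is_surj)
qed

lemma bilipschitz_quasi_isometry:
  assumes "bilipschitz L f"
  shows "quasi_isometry f"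
proof (rule quasi_isometryI[of "L + 1"])
  have L: "L \<ge> 1" using assms bilipschitzD(1) by blast
  then show "L + 1 > 1" by simp
  show "dist x y \<le> (L + 1) * (dist (f x) (f y) + (L + 1))" for x y
  proof -
    have "dist x y \<le> L * dist (f x) (f y)" by (rule bilipschitzD(4)[OF assms])
    also have "\<dots> \<le> (L + 1) * (dist (f x) (f y) + (L + 1))"
      using L by (intro mult_mono) auto
    finally show ?thesis .
  qed
  show "dist (f x) (f y) \<le> (L + 1) * dist x y + (L + 1)" for x y
  proof -
    have "dist (f x) (f y) \<le> L * dist x y" by (rule bilipschitzD(3)[OF assms])
    also have "\<dots> \<le> (L + 1) * dist x y + (L + 1)" using L by (simp add: distrib_right add_increasing2)
    finally show ?thesis .
  qed
  show "\<exists>x. dist x' (f x) \<le> L + 1" for x'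
    using assms L unfolding bilipschitz_def by (metis add_increasing2 dist_self surjD zero_le_one order_trans)
qed

text \<open>Increasing functions of the line with all difference quotients in \<open>[1/L, L]\<close> are unbounded in
  both directions, so that the intermediate value theorem makes them surjective.\<close>

lemma bilipschitz_from_slopes:
  fixes f :: "real \<Rightarrow> real"
  assumes L: "L \<ge> 1"
    and lo: "\<And>x y. x \<le> y \<Longrightarrow> y - x \<le> L * (f y - f x)"
    and up: "\<And>x y. x \<le> y \<Longrightarrow> f y - f x \<le> L * (y - x)"
  shows "bilipschitz L f"
proof -
  have mono: "f x \<le> f y" if "x \<le> y" for x y
  proof -
    have "0 \<le> L * (f y - f x)" using lo[OF that] that by linarith
    then show ?thesis using L by (simp add: zero_le_mult_iff)
  qed
  have d: "dist (f x) (f y) \<le> L * dist x y \<and> dist x y \<le> L * dist (f x) (f y)" for x y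
  proof (cases "x \<le> y")
    case True
    then show ?thesis using lo[OF True] up[OF True] mono[OF True] by (simp add: dist_real_def)
  next
    case False
    then have "y \<le> x" by simp
    then show ?thesis using lo[of y x] up[of y x] mono[of y x] by (simp add: dist_real_def)
  qed
  have "L-lipschitz_on UNIV f" using d L by (auto simp: lipschitz_on_def)
  then have cont: "continuous_on UNIV f" by (rule lipschitz_on_continuous_on)
  have "surj f"
  proof (rule surj_if_solvable)
    fix v
    have "\<exists>x. f x = v"
    proof (cases "f 0 \<le> v")
      case True
      let ?b = "L * (v - f 0)"
      have b: "0 \<le> ?b" using True L by simp
      then have "L * (v - f 0) \<le> L * (f ?b - f 0)" using lo[of 0 ?b] by simp
      then have "v \<le> f ?b" using L by simp
      then show ?thesis using IVT'[of f 0 v ?b] True b cont continuous_on_subset by blast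
    next
      case False
      let ?b = "L * (v - f 0)"
      have b: "?b \<le> 0" using False L by (simp add: mult_le_0_iff)
      then have "L * (f 0 - v) \<le> L * (f 0 - f ?b)" using lo[of ?b 0] by (simp add: algebra_simps)
      then have "f ?b \<le> v" using L by simp
      then show ?thesis using IVT'[of f ?b v 0] False b cont continuous_on_subset
        by (meson linear subset_UNIV)
    qed
    then show "\<exists>x. f x = v" .
  qed
  with L d show ?thesis by (simp add: bilipschitz_def)
qed


section \<open>Exponentiating lifts of circle maps\<close>

text \<open>The degree of the circle map that \<open>F\<close> lifts: \<open>1\<close> for increasing and \<open>-1\<close> for decreasing
  lifts.\<close>

definition lift_degree :: "(real \<Rightarrow> real) \<Rightarrow> real" where
  "lift_degree F = F 1 - F 0"

definition equivariant :: "(real \<Rightarrow> real) \<Rightarrow> bool" where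
  "equivariant F \<longleftrightarrow> (lift_degree F = 1 \<or> lift_degree F = - 1) \<and> (\<forall>t. F (t + 1) = F t + lift_degree F)"

lemma shift_iterate:
  fixes F :: "real \<Rightarrow> real"
  assumes "\<And>t. F (t + 1) = F t + c"
  shows "F (t + of_int n) = F t + c * of_int n"
proof -
  have up: "F (t + real n) = F t + c * real n" for t n
  proof (induction n)
    case (Suc n)
    then show ?case using assms[of "t + real n"] by (simp add: algebra_simps)
  qed simp
  show ?thesis
  proof (cases n)
    case (nonneg m)
    then show ?thesis using up by simp
  next
    case (neg m)
    then have "real_of_int n = - real (Suc m)" by simp
    then show ?thesis using up[of "t - real (Suc m)" "Suc m"]
      by (simp only: diff_add_cancel) (simp add: algebra_simps)
  qed
qed

lemma equivariant_shift: "equivariant F \<Longrightarrow> F (t + of_int n) = F t + lift_degree F * of_int n"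
  by (rule shift_iterate) (simp add: equivariant_def)

lemma lift_degree_comp:
  assumes "equivariant F" "equivariant G"
  shows "lift_degree (F \<circ> G) = lift_degree F * lift_degree G"
proof -
  obtain n :: int where n: "lift_degree G = of_int n"
    using assms(2) unfolding equivariant_def by (metis of_int_1 of_int_minus)
  have "G 1 = G 0 + of_int n" using n by (simp add: lift_degree_def)
  then show ?thesis
    using equivariant_shift[OF assms(1), of "G 0" n] n by (simp add: lift_degree_def[of "F \<circ> G"])
qed

text \<open>\<open>F t - lift_degree F * t\<close> has period \<open>1\<close>, so it is bounded by its values on \<open>[0, 1]\<close>.\<close>

lemma equivariant_near_linear:
  assumes "equivariant F" and L: "\<And>s t. \<bar>F s - F t\<bar> \<le> L * \<bar>s - t\<bar>"
  obtains D where "\<And>t. \<bar>F t - lift_degree F * t\<bar> \<le> D"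
proof -
  have d: "\<bar>lift_degree F\<bar> = 1" using assms(1) by (auto simp: equivariant_def)
  have "0 \<le> L" using L[of 0 1] by simp
  have "\<bar>F t - lift_degree F * t\<bar> \<le> \<bar>F 0\<bar> + L + 1" for t
  proof -
    let ?r = "frac t"
    have t: "t = ?r + of_int \<lfloor>t\<rfloor>" by (simp add: frac_def)
    have r: "0 \<le> ?r" "?r < 1" by (simp_all add: frac_lt_1)
    have "F t = F ?r + lift_degree F * of_int \<lfloor>t\<rfloor>"
      using equivariant_shift[OF assms(1), of ?r "\<lfloor>t\<rfloor>"] t by simp
    moreover have "lift_degree F * t = lift_degree F * ?r + lift_degree F * of_int \<lfloor>t\<rfloor>"
      by (metis t distrib_left)
    ultimately have "F t - lift_degree F * t = F 0 + (F ?r - F 0) - lift_degree F * ?r" by simp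
    moreover have "\<bar>F ?r - F 0\<bar> \<le> L"
    proof -
      have "\<bar>F ?r - F 0\<bar> \<le> L * ?r" using L[of ?r 0] r by simp
      also have "\<dots> \<le> L" using r \<open>0 \<le> L\<close> by (simp add: mult_left_le)
      finally show ?thesis .
    qed
    moreover have "\<bar>lift_degree F * ?r\<bar> \<le> 1" using d r by (simp add: abs_mult)
    ultimately show ?thesis by linarith
  qed
  then show ?thesis using that by blast
qed

text \<open>For a sign \<open>s\<close>, the map \<open>t \<mapsto> s exp (s t)\<close> is a coordinate on the half-line of that sign. In
  these two coordinates \<open>exponentiate F\<close> is \<open>F\<close> on both half-lines if \<open>F\<close> increases. A decreasing
  \<open>F\<close> takes the end of a half-line at infinity to the other end, and this is corrected by letting it
  exchange the half-lines, whose coordinates have opposite orientations.\<close>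

definition exponentiate :: "(real \<Rightarrow> real) \<Rightarrow> real \<Rightarrow> real" where
  "exponentiate F x = (if x = 0 then 0 else
     lift_degree F * sgn x * exp (lift_degree F * sgn x * F (sgn x * ln \<bar>x\<bar>)))"

lemma exponentiate_comp:
  assumes "equivariant F" "equivariant G"
  shows "exponentiate (F \<circ> G) = exponentiate F \<circ> exponentiate G"
proof
  fix x
  show "exponentiate (F \<circ> G) x = (exponentiate F \<circ> exponentiate G) x"
  proof (cases "x = 0")
    case False
    have dG: "lift_degree G = 1 \<or> lift_degree G = - 1" using assms(2) by (simp add: equivariant_def)
    have s: "sgn x = 1 \<or> sgn x = - 1" using False by (simp add: sgn_if)
    let ?u = "G (sgn x * ln \<bar>x\<bar>)"
    have y: "exponentiate G x = (lift_degree G * sgn x) * exp (lift_degree G * sgn x * ?u)"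
      using False by (simp add: exponentiate_def)
    have "exponentiate G x \<noteq> 0" unfolding y using dG s by auto
    moreover have "sgn (exponentiate G x) = lift_degree G * sgn x"
      unfolding y using dG s by (auto simp: sgn_mult)
    moreover have "ln \<bar>exponentiate G x\<bar> = lift_degree G * sgn x * ?u"
      unfolding y using dG s by (auto simp: abs_mult)
    moreover have "lift_degree G * sgn x * (lift_degree G * sgn x * ?u) = ?u" using dG s by auto
    ultimately have "exponentiate F (exponentiate G x)
        = lift_degree F * (lift_degree G * sgn x) * exp (lift_degree F * (lift_degree G * sgn x) * F ?u)"
      unfolding exponentiate_def[of F "exponentiate G x"] by (simp only: if_False)
    then show ?thesis using False
      by (simp add: exponentiate_def[of "F \<circ> G"] lift_degree_comp[OF assms] mult.assoc)
  qed (simp add: exponentiate_def)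
qed

lemma exponentiate_id: "exponentiate id = id"
proof
  show "exponentiate id x = id x" for x
    by (cases x "0 :: real" rule: linorder_cases) (simp_all add: exponentiate_def lift_degree_def)
qed

lemma exp_diff_le:
  fixes a b c :: real
  assumes "exp a \<le> c" "exp b \<le> c"
  shows "\<bar>exp a - exp b\<bar> \<le> c * \<bar>a - b\<bar>"
proof -
  have *: "exp x - exp y \<le> c * \<bar>x - y\<bar>" if "exp x \<le> c" for x y :: real
  proof (cases "y \<le> x")
    case True
    have "exp x - exp y = exp x * (1 - exp (y - x))" by (simp add: exp_diff algebra_simps)
    also have "\<dots> \<le> exp x * (x - y)" 
      using exp_ge_add_one_self[of "y - x"] by (intro mult_left_mono) (linarith, simp)
    also have "\<dots> \<le> c * (x - y)" using that True by (intro mult_right_mono) auto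
    finally show ?thesis using True by simp
  next
    case False
    then have "exp x - exp y \<le> 0" by simp
    also have "0 \<le> c * \<bar>x - y\<bar>" using that exp_ge_zero[of x] by (intro mult_nonneg_nonneg) linarith+
    finally show ?thesis .
  qed
  show ?thesis
    using *[OF assms(1), of b] *[OF assms(2), of a] by (simp add: abs_le_iff abs_minus_commute)
qed

text \<open>Where \<open>\<bar>x\<bar>\<close> and \<open>\<bar>y\<bar>\<close> differ by a factor of at most \<open>2\<close>, the Lipschitz constant of \<open>F\<close> controls
  the quotient; elsewhere \<open>\<bar>exponentiate F x\<bar> \<le> exp D * \<bar>x\<bar>\<close> suffices.\<close>

lemma exponentiate_lipschitz:
  assumes "equivariant F" and L: "\<And>s t. \<bar>F s - F t\<bar> \<le> L * \<bar>s - t\<bar>"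
  obtains K where "K \<ge> 1" "\<And>x y. \<bar>exponentiate F x - exponentiate F y\<bar> \<le> K * \<bar>x - y\<bar>"
proof -
  obtain D where D: "\<And>t. \<bar>F t - lift_degree F * t\<bar> \<le> D"
    by (rule equivariant_near_linear[OF assms]) (rule that)
  have "0 \<le> L" using L[of 0 1] by simp
  have "0 \<le> D" using D[of 0] by linarith
  have d: "lift_degree F = 1 \<or> lift_degree F = - 1" using assms(1) by (simp add: equivariant_def)
  let ?E = "exponentiate F"
  define u where "u x = lift_degree F * sgn x * F (sgn x * ln \<bar>x\<bar>)" for x
  have E: "?E x = lift_degree F * sgn x * exp (u x)" if "x \<noteq> 0" for x
    using that by (simp add: exponentiate_def u_def)
  have u: "exp (u x) \<le> exp D * \<bar>x\<bar>" if "x \<noteq> 0" for x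
  proof -
    have s: "sgn x = 1 \<or> sgn x = - 1" using that by (simp add: sgn_if)
    have "u x \<le> D + ln \<bar>x\<bar>"
      using D[of "sgn x * ln \<bar>x\<bar>"] d s unfolding u_def by (auto simp: abs_le_iff)
    then have "exp (u x) \<le> exp (D + ln \<bar>x\<bar>)" by simp
    then show ?thesis using that by (simp add: exp_add)
  qed
  have size: "\<bar>?E x\<bar> \<le> exp D * \<bar>x\<bar>" for x
  proof (cases "x = 0")
    case False
    then show ?thesis using u[OF False] d by (auto simp: E abs_mult sgn_if)
  qed (simp add: exponentiate_def)
  let ?K = "exp D * (3 + 2 * L)"
  have e1: "1 \<le> exp D" using \<open>0 \<le> D\<close> by simp
  have K: "exp D * 3 \<le> ?K" "exp D * (2 * L) \<le> ?K" using \<open>0 \<le> L\<close> by (simp_all add: distrib_left)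
  have far: "\<bar>?E x - ?E y\<bar> \<le> ?K * \<bar>x - y\<bar>" if "\<bar>x\<bar> + \<bar>y\<bar> \<le> 3 * \<bar>x - y\<bar>" for x y
  proof -
    have "\<bar>?E x - ?E y\<bar> \<le> exp D * (\<bar>x\<bar> + \<bar>y\<bar>)"
      using size[of x] size[of y] by (simp add: distrib_left)
    also have "\<dots> \<le> exp D * (3 * \<bar>x - y\<bar>)" using that by simp
    also have "\<dots> = (exp D * 3) * \<bar>x - y\<bar>" by simp
    also have "\<dots> \<le> ?K * \<bar>x - y\<bar>" using K(1) by (rule mult_right_mono) simp
    finally show ?thesis .
  qed
  have le: "\<bar>?E x - ?E y\<bar> \<le> ?K * \<bar>x - y\<bar>" if xy: "\<bar>x\<bar> \<le> \<bar>y\<bar>" for x y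
  proof (cases "x \<noteq> 0 \<and> sgn x = sgn y \<and> \<bar>y\<bar> \<le> 2 * \<bar>x\<bar>")
    case True
    then have "x \<noteq> 0" and s: "sgn y = sgn x" and two: "\<bar>y\<bar> \<le> 2 * \<bar>x\<bar>" by auto
    then have x: "x \<noteq> 0" "y \<noteq> 0" by (auto simp: sgn_if split: if_splits)
    have s1: "sgn x = 1 \<or> sgn x = - 1" using x by (simp add: sgn_if)
    have dist: "\<bar>x - y\<bar> = \<bar>y\<bar> - \<bar>x\<bar>" using s xy by (auto simp: sgn_if split: if_splits)
    have "exp (u x) \<le> exp D * \<bar>y\<bar>"
      using u[OF x(1)] xy by (meson exp_ge_zero mult_left_mono order_trans)
    then have "\<bar>exp (u x) - exp (u y)\<bar> \<le> exp D * \<bar>y\<bar> * \<bar>u x - u y\<bar>"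
      using u[OF x(2)] by (rule exp_diff_le)
    moreover have "\<bar>?E x - ?E y\<bar> = \<bar>exp (u x) - exp (u y)\<bar>"
      using d s1 s by (auto simp: E x)
    moreover have "\<bar>u x - u y\<bar> \<le> L * ((\<bar>y\<bar> - \<bar>x\<bar>) / \<bar>x\<bar>)"
    proof -
      have "\<bar>u x - u y\<bar> = \<bar>F (sgn x * ln \<bar>x\<bar>) - F (sgn x * ln \<bar>y\<bar>)\<bar>"
        using d s1 s by (auto simp: u_def)
      also have "\<dots> \<le> L * \<bar>sgn x * ln \<bar>x\<bar> - sgn x * ln \<bar>y\<bar>\<bar>" by (rule L)
      also have "\<bar>sgn x * ln \<bar>x\<bar> - sgn x * ln \<bar>y\<bar>\<bar> = ln (\<bar>y\<bar> / \<bar>x\<bar>)"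
        using s1 x xy by (auto simp: ln_div)
      also have "L * ln (\<bar>y\<bar> / \<bar>x\<bar>) \<le> L * (\<bar>y\<bar> / \<bar>x\<bar> - 1)"
        using x \<open>0 \<le> L\<close> by (intro mult_left_mono ln_le_minus_one) auto
      also have "\<bar>y\<bar> / \<bar>x\<bar> - 1 = (\<bar>y\<bar> - \<bar>x\<bar>) / \<bar>x\<bar>" using x by (simp add: field_simps)
      finally show ?thesis .
    qed
    ultimately have "\<bar>?E x - ?E y\<bar> \<le> exp D * \<bar>y\<bar> * (L * ((\<bar>y\<bar> - \<bar>x\<bar>) / \<bar>x\<bar>))"
      by (smt (verit) mult_left_mono exp_ge_zero mult_nonneg_nonneg abs_ge_zero)
    also have "\<dots> = (exp D * L * (\<bar>y\<bar> - \<bar>x\<bar>)) * (\<bar>y\<bar> / \<bar>x\<bar>)" by simp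
    also have "\<dots> \<le> (exp D * L * (\<bar>y\<bar> - \<bar>x\<bar>)) * 2"
      using two x xy \<open>0 \<le> L\<close> by (intro mult_left_mono mult_nonneg_nonneg) (auto simp: divide_le_eq)
    also have "\<dots> = exp D * (2 * L) * \<bar>x - y\<bar>" by (simp add: dist)
    also have "\<dots> \<le> ?K * \<bar>x - y\<bar>" using K(2) by (rule mult_right_mono) simp
    finally show ?thesis .
  next
    case False
    then have "\<bar>x\<bar> + \<bar>y\<bar> \<le> 3 * \<bar>x - y\<bar>" using xy by (auto simp: sgn_if split: if_splits)
    then show ?thesis by (rule far)
  qed
  have "\<bar>?E x - ?E y\<bar> \<le> ?K * \<bar>x - y\<bar>" for x y
    using le[of x y] le[of y x] by (cases "\<bar>x\<bar> \<le> \<bar>y\<bar>") (simp_all add: abs_minus_commute)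
  moreover have "1 \<le> ?K" using K(1) e1 by linarith
  ultimately show ?thesis using that by blast
qed

text \<open>If \<open>F\<close> moves \<open>t\<close>, then it moves \<open>t + n\<close> by the same amount, and exponentiation multiplies the
  displacement by \<open>exp n\<close>. A decreasing \<open>F\<close> exchanges the half-lines, so it has unbounded displacement
  as well.\<close>

lemma embeds_in_QI_if_equivariant:
  assumes "group (comp_group \<Gamma>)"
    and bij: "\<And>F. F \<in> \<Gamma> \<Longrightarrow> bij F" and equiv: "\<And>F. F \<in> \<Gamma> \<Longrightarrow> equivariant F"
    and inv: "\<And>F. F \<in> \<Gamma> \<Longrightarrow> finv F \<in> \<Gamma>"
    and lip: "\<And>F. F \<in> \<Gamma> \<Longrightarrow> \<exists>L. \<forall>s t. \<bar>F s - F t\<bar> \<le> L * \<bar>s - t\<bar>"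
  shows "embeds_in (comp_group \<Gamma>) (QI :: (real \<Rightarrow> real) set monoid)"
proof (rule embeds_in_QI_by_representatives[where \<phi> = exponentiate])
  have qi: "quasi_isometry (exponentiate F)" if F: "F \<in> \<Gamma>" for F
  proof -
    obtain K where K: "K \<ge> 1" "\<And>x y. \<bar>exponentiate F x - exponentiate F y\<bar> \<le> K * \<bar>x - y\<bar>"
      using exponentiate_lipschitz[OF equiv[OF F]] lip[OF F] by metis
    obtain M where M: "\<And>x y. \<bar>exponentiate (finv F) x - exponentiate (finv F) y\<bar> \<le> M * \<bar>x - y\<bar>"
      using exponentiate_lipschitz[OF equiv[OF inv[OF F]]] lip[OF inv[OF F]] by metis
    have "F \<circ> finv F = id" "finv F \<circ> F = id"
      using bij[OF F] by (simp_all add: bij_is_surj bij_is_inj flip: surj_iff inj_iff)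
    then have c: "exponentiate F (exponentiate (finv F) x) = x" "exponentiate (finv F) (exponentiate F x) = x" for x
      using exponentiate_comp[OF equiv[OF F] equiv[OF inv[OF F]]]
        exponentiate_comp[OF equiv[OF inv[OF F]] equiv[OF F]] exponentiate_id
      by (metis comp_apply id_apply)+
    have "bilipschitz (max K M) (exponentiate F)"
      unfolding bilipschitz_def
    proof (intro conjI allI)
      show "1 \<le> max K M" using K(1) by simp
      show "surj (exponentiate F)" using c(1) by (rule surjI)
      show "dist (exponentiate F x) (exponentiate F y) \<le> max K M * dist x y" for x y
        unfolding dist_real_def by (rule order_trans[OF K(2) mult_right_mono]) auto
      show "dist x y \<le> max K M * dist (exponentiate F x) (exponentiate F y)" for x y
        using M[of "exponentiate F x" "exponentiate F y"] unfolding c dist_real_def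
        by (rule order_trans[OF _ mult_right_mono]) auto
    qed
    then show ?thesis by (rule bilipschitz_quasi_isometry)
  qed
  then show "quasi_isometry (exponentiate F)" if "F \<in> carrier (comp_group \<Gamma>)" for F
    using that by (simp add: comp_group_def)
  show "(exponentiate (F \<otimes>\<^bsub>comp_group \<Gamma>\<^esub> G), exponentiate F \<circ> exponentiate G) \<in> qi_rel"
    if "F \<in> carrier (comp_group \<Gamma>)" "G \<in> carrier (comp_group \<Gamma>)" for F G
  proof -
    have FG: "F \<in> \<Gamma>" "G \<in> \<Gamma>" using that by (simp_all add: comp_group_def)
    then have "exponentiate (F \<otimes>\<^bsub>comp_group \<Gamma>\<^esub> G) = exponentiate F \<circ> exponentiate G"
      by (simp add: comp_group_def exponentiate_comp equiv)
    then show ?thesis using FG qi by (auto simp: qi_rel_def quasi_isometry_comp intro: exI[of _ 0])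
  qed
  show "F = \<one>\<^bsub>comp_group \<Gamma>\<^esub>" if F: "F \<in> carrier (comp_group \<Gamma>)" "(exponentiate F, id) \<in> qi_rel" for F
  proof -
    have eq: "equivariant F" using F(1) equiv by (simp add: comp_group_def)
    obtain M where M: "\<bar>exponentiate F x - x\<bar> \<le> M" for x
      using F(2) by (auto simp: qi_rel_def dist_real_def)
    have d: "lift_degree F = 1"
    proof (rule ccontr)
      assume "lift_degree F \<noteq> 1"
      then have d: "lift_degree F = - 1" using eq by (auto simp: equivariant_def)
      have "exponentiate F (\<bar>M\<bar> + 1) < 0" by (simp add: exponentiate_def d)
      then show False using M[of "\<bar>M\<bar> + 1"] by linarith
    qed
    have "F t = t" for t
    proof (rule ccontr)
      assume "F t \<noteq> t"
      let ?c = "\<bar>exp (F t) - exp t\<bar>"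
      have c: "?c > 0" using \<open>F t \<noteq> t\<close> by simp
      have "exp (real n) * ?c \<le> M" for n
      proof -
        have "F (t + real n) = F t + real n" using equivariant_shift[OF eq, of t "int n"] d by simp
        then have "exponentiate F (exp (t + real n)) = exp (F t + real n)"
          by (simp add: exponentiate_def d)
        then have "\<bar>exp (F t + real n) - exp (t + real n)\<bar> \<le> M" using M by metis
        moreover have "exp (F t + real n) - exp (t + real n) = exp (real n) * (exp (F t) - exp t)"
          by (simp add: exp_add algebra_simps)
        ultimately show ?thesis by (simp add: abs_mult)
      qed
      moreover obtain n :: nat where "M / ?c < real n" using reals_Archimedean2 by blast
      moreover have "real n \<le> exp (real n)" using exp_ge_add_one_self[of "real n"] by linarith
      ultimately have "M / ?c < exp (real n)" "exp (real n) * ?c \<le> M" by (auto intro: less_le_trans)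
      then show False using c by (simp add: divide_less_eq)
    qed
    then show ?thesis by (auto simp: comp_group_def)
  qed
qed fact


section \<open>Lifts of circle homeomorphisms\<close>

lemma circle_proj_eq_iff: "circle_proj s = circle_proj t \<longleftrightarrow> s - t \<in> \<int>"
proof -
  have "circle_proj s = circle_proj t \<longleftrightarrow> (\<exists>n::int. s = t + of_int n)"
  proof -
    have "2 * of_real pi * \<i> * of_real s = 2 * of_real pi * \<i> * of_real t + of_int (2 * n) * pi * \<i>
        \<longleftrightarrow> s = t + of_int n" for n :: int
    proof -
      have "2 * of_real pi * \<i> * of_real t + of_int (2 * n) * pi * \<i>
          = 2 * of_real pi * \<i> * of_real (t + of_int n)" by (simp add: algebra_simps)
      then show ?thesis by (simp only: mult_cancel_left of_real_eq_iff) simp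
    qed
    then show ?thesis by (simp add: circle_proj_def exp_eq)
  qed
  also have "\<dots> \<longleftrightarrow> s - t \<in> \<int>" by (auto simp: Ints_def algebra_simps)
  finally show ?thesis .
qed

lemma circle_proj_in_circle: "circle_proj t \<in> circle"
  by (simp add: circle_proj_def)

lemma circle_proj_plus_int: "circle_proj (t + of_int n) = circle_proj t"
  by (simp add: circle_proj_eq_iff)

lemma continuous_on_integer_valued:
  fixes h :: "real \<Rightarrow> real"
  assumes "continuous_on UNIV h" "\<And>t. h t \<in> \<int>"
  obtains n :: int where "\<And>t. h t = of_int n"
proof -
  have "h constant_on UNIV"
  proof (rule continuous_discrete_range_constant)
    show "\<exists>e>0. \<forall>y. y \<in> UNIV \<and> h y \<noteq> h x \<longrightarrow> e \<le> norm (h y - h x)" for x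
    proof (intro exI[of _ 1] conjI allI impI)
      fix y assume "y \<in> UNIV \<and> h y \<noteq> h x"
      then show "1 \<le> norm (h y - h x)"
        using Ints_nonzero_abs_ge1[of "h y - h x"] assms(2) by (simp add: Ints_diff)
    qed simp
  qed (use assms in auto)
  then obtain c where c: "\<And>t. h t = c" by (auto simp: constant_on_def)
  moreover obtain n where "c = of_int n" using assms(2)[of 0] c by (auto elim: Ints_cases)
  ultimately show ?thesis using that by blast
qed

lemma real_homeo_bij:
  assumes "real_homeo F"
  shows "bij F"
proof -
  obtain G where "homeomorphism UNIV UNIV F G" using assms by (auto simp: real_homeo_def)
  then have "G \<circ> F = id" "F \<circ> G = id" by (auto simp: homeomorphism_def)
  then show ?thesis by (rule o_bij)
qed

lemma real_homeo_continuous: "real_homeo F \<Longrightarrow> continuous_on UNIV F"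
  by (auto simp: real_homeo_def homeomorphism_def)

lemma real_homeo_id: "real_homeo id"
  unfolding real_homeo_def using homeomorphism_ident by (auto simp: id_def)

lemma real_homeo_comp: "real_homeo F \<Longrightarrow> real_homeo G \<Longrightarrow> real_homeo (F \<circ> G)"
  unfolding real_homeo_def using homeomorphism_compose by blast

lemma real_homeo_inv:
  assumes "real_homeo F"
  shows "real_homeo (finv F)"
proof -
  obtain G where G: "homeomorphism UNIV UNIV F G" using assms by (auto simp: real_homeo_def)
  then have "finv F = G" by (intro inv_unique_comp) (auto simp: homeomorphism_def)
  then show ?thesis using homeomorphism_symD[OF G] by (auto simp: real_homeo_def)
qed

lemma is_lift_homeo: "is_lift F f \<Longrightarrow> real_homeo F"
  by (simp add: is_lift_def)

lemma is_lift_apply: "is_lift F f \<Longrightarrow> circle_proj (F t) = f (circle_proj t)"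
  by (simp add: is_lift_def fun_eq_iff)

lemma is_lift_comp: "is_lift F f \<Longrightarrow> is_lift G g \<Longrightarrow> is_lift (F \<circ> G) (f \<circ> g)"
  by (simp add: is_lift_def real_homeo_comp fun_eq_iff)

lemma is_lift_inv:
  assumes "is_lift F f" "homeomorphism circle circle f g"
  shows "is_lift (finv F) g"
  unfolding is_lift_def
proof (intro conjI real_homeo_inv[OF is_lift_homeo[OF assms(1)]] ext)
  fix t
  have b: "bij F" using assms(1) is_lift_homeo real_homeo_bij by blast
  have "f (circle_proj (finv F t)) = circle_proj t"
    using is_lift_apply[OF assms(1), of "finv F t"] b by (simp add: bij_is_surj surj_f_inv_f)
  then have "g (circle_proj t) = g (f (circle_proj (finv F t)))" by simp
  also have "\<dots> = circle_proj (finv F t)"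
    using assms(2) circle_proj_in_circle by (auto simp: homeomorphism_def)
  finally show "(circle_proj \<circ> finv F) t = (g \<circ> circle_proj) t" by simp
qed

lemma is_lift_shift:
  assumes "is_lift F f"
  obtains d :: int where "\<And>t. F (t + 1) = F t + of_int d"
proof -
  have "continuous_on UNIV F" using assms is_lift_homeo real_homeo_continuous by blast
  moreover from this have "continuous_on UNIV (\<lambda>t. F (t + 1))"
    by (rule continuous_on_compose2) (auto intro!: continuous_intros)
  ultimately have "continuous_on UNIV (\<lambda>t. F (t + 1) - F t)" by (intro continuous_on_diff)
  moreover have "F (t + 1) - F t \<in> \<int>" for t
    using is_lift_apply[OF assms] circle_proj_plus_int[of t 1] circle_proj_eq_iff by (metis of_int_1)
  ultimately obtain d :: int where "\<And>t. F (t + 1) - F t = of_int d"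
    using continuous_on_integer_valued by blast
  then show ?thesis using that by (metis add.commute diff_add_cancel)
qed

text \<open>The shifts of a lift and of its inverse are integers whose product is \<open>1\<close>.\<close>

lemma is_lift_equivariant:
  assumes F: "is_lift F f" and "homeomorphism circle circle f g"
  shows "equivariant F"
proof -
  have b: "bij F" using F is_lift_homeo real_homeo_bij by blast
  obtain d :: int where d: "\<And>t. F (t + 1) = F t + of_int d" by (rule is_lift_shift[OF F]) (rule that)
  obtain e :: int where e: "\<And>t. finv F (t + 1) = finv F t + of_int e"
    by (rule is_lift_shift[OF is_lift_inv[OF assms]]) (rule that)
  have "finv F (F 0 + of_int d) = finv F (F 0) + of_int e * of_int d" 
    by (rule shift_iterate) (rule e)
  moreover have "finv F (F 0 + of_int d) = 1" using d[of 0] b by (metis add_0 bij_is_inj inv_f_f)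
  moreover have "finv F (F 0) = 0" using b by (simp add: bij_is_inj)
  ultimately have "real_of_int (e * d) = 1" by simp
  then have "e * d = 1" by (simp only: of_int_eq_1_iff)
  then have "d = 1 \<or> d = - 1" by (metis pos_zmult_eq_1_iff_lemma zmult_eq_1_iff mult.commute)
  moreover have "lift_degree F = of_int d" using d[of 0] by (simp add: lift_degree_def)
  ultimately show ?thesis using d by (auto simp: equivariant_def)
qed

lemma equivariant_lipschitz:
  assumes "equivariant F" and L: "L-lipschitz_on {0..1} F"
  shows "\<bar>F s - F t\<bar> \<le> L * \<bar>s - t\<bar>"
proof -
  have unit: "L-lipschitz_on {of_int n..of_int n + 1} F" for n :: int
  proof (rule lipschitz_onI)
    fix x y :: real assume "x \<in> {of_int n..of_int n + 1}" "y \<in> {real_of_int n..of_int n + 1}"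
    then have "dist (F (x - of_int n)) (F (y - of_int n)) \<le> L * dist (x - of_int n) (y - of_int n)"
      by (intro lipschitz_onD[OF L]) auto
    moreover have "F (z - of_int n) = F z - lift_degree F * of_int n" for z
      using equivariant_shift[OF assms(1), of z "- n"] by simp
    ultimately show "dist (F x) (F y) \<le> L * dist x y" by (simp add: dist_real_def)
  qed (rule lipschitz_on_nonneg[OF L])
  have le: "\<bar>F s - F t\<bar> \<le> L * \<bar>s - t\<bar>" if "s \<le> t" for s t
  proof -
    have "L-lipschitz_on {s..t} F"
    proof (rule lipschitz_on_closed_Union[where I = "{\<lfloor>s\<rfloor>..\<lfloor>t\<rfloor>}" and U = "\<lambda>n. {of_int n..of_int n + 1}"])
      show "{s..t} \<subseteq> (\<Union>n\<in>{\<lfloor>s\<rfloor>..\<lfloor>t\<rfloor>}. {of_int n..of_int n + 1})"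
      proof
        fix x assume "x \<in> {s..t}"
        then show "x \<in> (\<Union>n\<in>{\<lfloor>s\<rfloor>..\<lfloor>t\<rfloor>}. {of_int n..of_int n + 1})"
          by (intro UN_I[of "\<lfloor>x\<rfloor>"]) (auto simp: floor_mono intro: less_imp_le)
      qed
    qed (auto simp: unit lipschitz_on_nonneg[OF L])
    then show ?thesis using lipschitz_onD[of L "{s..t}" F s t] that by (simp add: dist_real_def)
  qed
  show ?thesis using le[of s t] le[of t s] by (cases "s \<le> t") (simp_all add: abs_minus_commute)
qed

text \<open>The closure under composition may be checked for maps that have lifts, which is what makes the
  chain rule on the line available for it.\<close>

lemma embeds_in_QI_lifts:
  assumes id: "id \<in> \<Gamma>"
    and inv: "\<And>f. f \<in> \<Gamma> \<Longrightarrow> \<exists>g\<in>\<Gamma>. homeomorphism circle circle f g"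
    and comp: "\<And>f g F G. f \<in> \<Gamma> \<Longrightarrow> g \<in> \<Gamma> \<Longrightarrow> is_lift F f \<Longrightarrow> is_lift G g \<Longrightarrow> f \<circ> g \<in> \<Gamma>"
    and lip: "\<And>f F. f \<in> \<Gamma> \<Longrightarrow> is_lift F f \<Longrightarrow> \<exists>L. L-lipschitz_on {0..1} F"
  shows "embeds_in (comp_group (lifts \<Gamma>)) (QI :: (real \<Rightarrow> real) set monoid)"
proof (rule embeds_in_QI_if_equivariant)
  show bij: "bij F" if "F \<in> lifts \<Gamma>" for F
    using that is_lift_homeo real_homeo_bij by (auto simp: lifts_def)
  show inv': "finv F \<in> lifts \<Gamma>" if "F \<in> lifts \<Gamma>" for F
    using that inv is_lift_inv unfolding lifts_def by blast
  show equiv: "equivariant F" if "F \<in> lifts \<Gamma>" for F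
    using that inv is_lift_equivariant unfolding lifts_def by blast
  show "\<exists>L. \<forall>s t. \<bar>F s - F t\<bar> \<le> L * \<bar>s - t\<bar>" if F: "F \<in> lifts \<Gamma>" for F
    using lip F equivariant_lipschitz[OF equiv[OF F]] unfolding lifts_def by blast
  show "group (comp_group (lifts \<Gamma>))"
  proof (rule comp_group_groupI[OF _ _ inv' bij])
    show "id \<in> lifts \<Gamma>" using id real_homeo_id 
      by (auto simp: lifts_def is_lift_def intro!: bexI[of _ id])
    show "F \<circ> G \<in> lifts \<Gamma>" if "F \<in> lifts \<Gamma>" "G \<in> lifts \<Gamma>" for F G
      using that comp is_lift_comp unfolding lifts_def by blast
  qed
qed


section \<open>Smooth circle diffeomorphisms\<close>

text \<open>To prove smoothness, it is enough to find a set of curves that is closed under taking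
  derivatives.\<close>

lemma smooth_curve_coinduct:
  assumes "\<gamma> \<in> A"
    and step: "\<And>\<gamma>. \<gamma> \<in> A \<Longrightarrow> \<exists>\<delta>\<in>A. \<forall>t. (\<gamma> has_vector_derivative \<delta> t) (at t)"
  shows "smooth_curve \<gamma>"
proof -
  obtain d where d: "\<And>\<gamma>. \<gamma> \<in> A \<Longrightarrow> d \<gamma> \<in> A \<and> (\<forall>t. (\<gamma> has_vector_derivative d \<gamma> t) (at t))"
    using step by metis
  have "(d ^^ n) \<gamma> \<in> A" for n by (induction n) (use assms(1) d in auto)
  then show ?thesis
    unfolding smooth_curve_def using d by (intro exI[of _ "\<lambda>n. (d ^^ n) \<gamma>"]) auto
qed

lemma smooth_curve_derivative:
  assumes "smooth_curve \<gamma>"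
  obtains \<delta> where "smooth_curve \<delta>" "\<And>t. (\<gamma> has_vector_derivative \<delta> t) (at t)"
proof -
  obtain D where D: "D 0 = \<gamma>" "\<And>n t. (D n has_vector_derivative D (Suc n) t) (at t)"
    using assms unfolding smooth_curve_def by blast
  have "smooth_curve (D 1)"
    unfolding smooth_curve_def using D(2) by (intro exI[of _ "\<lambda>n. D (Suc n)"]) auto
  with D show ?thesis using that by (metis One_nat_def)
qed

lemma smooth_curve_continuous: "smooth_curve \<gamma> \<Longrightarrow> continuous_on S \<gamma>"
  by (meson smooth_curve_derivative continuous_at_imp_continuous_on has_vector_derivative_continuous)

lemma smooth_curve_const: "smooth_curve (\<lambda>_. c)"
proof (rule smooth_curve_coinduct[where A = "range (\<lambda>c _. c)"])
  show "\<exists>\<delta>\<in>range (\<lambda>c _. c). \<forall>t. (\<gamma> has_vector_derivative \<delta> t) (at t)"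
    if "\<gamma> \<in> range (\<lambda>c _. c)" for \<gamma> :: "real \<Rightarrow> complex"
    using that by (auto intro!: bexI[of _ "\<lambda>_. 0"] derivative_eq_intros)
qed simp

lemma smooth_curve_cnj:
  assumes "smooth_curve \<gamma>"
  shows "smooth_curve (\<lambda>t. cnj (\<gamma> t))"
proof (rule smooth_curve_coinduct[where A = "{\<lambda>t. cnj (\<delta> t) | \<delta>. smooth_curve \<delta>}"])
  show "\<exists>\<delta>\<in>{\<lambda>t. cnj (\<delta> t) | \<delta>. smooth_curve \<delta>}. \<forall>t. (\<gamma> has_vector_derivative \<delta> t) (at t)"
    if "\<gamma> \<in> {\<lambda>t. cnj (\<delta> t) | \<delta>. smooth_curve \<delta>}" for \<gamma>
  proof -
    obtain \<delta> where \<delta>: "\<gamma> = (\<lambda>t. cnj (\<delta> t))" "smooth_curve \<delta>" using \<open>\<gamma> \<in> _\<close> by blast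
    obtain \<epsilon> where "smooth_curve \<epsilon>" "\<And>t. (\<delta> has_vector_derivative \<epsilon> t) (at t)"
      by (rule smooth_curve_derivative[OF \<delta>(2)]) (rule that)
    then show ?thesis
      unfolding \<delta>(1) by (auto intro!: bexI[of _ "\<lambda>t. cnj (\<epsilon> t)"] has_vector_derivative_cnj)
  qed
qed (use assms in blast)

lemma circle_proj_has_vector_derivative:
  "(circle_proj has_vector_derivative (2 * of_real pi * \<i>) * circle_proj t) (at t)"
proof -
  have "((\<lambda>t. exp (2 * of_real pi * \<i> * of_real t)) has_vector_derivative
      2 * of_real pi * \<i> * exp (2 * of_real pi * \<i> * of_real t)) (at t)"
    by (rule has_vector_derivative_real_field) (auto intro!: derivative_eq_intros)
  then show ?thesis by (simp add: circle_proj_def[abs_def])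
qed

lemma smooth_curve_circle_proj: "smooth_curve circle_proj"
proof -
  have "((\<lambda>t. c * circle_proj t) has_vector_derivative c * (2 * of_real pi * \<i>) * circle_proj t) (at t)"
    for c t
    using has_vector_derivative_mult_right[OF circle_proj_has_vector_derivative, of c t]
    by (simp add: mult.assoc)
  then show ?thesis
    by (intro smooth_curve_coinduct[where A = "range (\<lambda>c t. c * circle_proj t)"])
      (auto intro: range_eqI[of _ _ 1])
qed

text \<open>The algebra generated by the curves \<open>a \<circ> G\<close> and \<open>b\<close>, for smooth \<open>a\<close> and \<open>b\<close>, is closed under
  derivatives as soon as it contains the derivative of \<open>G\<close>. This replaces the formula for the higher
  derivatives of a composition.\<close>

inductive_set curve_algebra :: "(real \<Rightarrow> real) \<Rightarrow> (real \<Rightarrow> complex) set" for G where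
  smooth: "smooth_curve b \<Longrightarrow> b \<in> curve_algebra G"
| comp: "smooth_curve a \<Longrightarrow> a \<circ> G \<in> curve_algebra G"
| add: "u \<in> curve_algebra G \<Longrightarrow> v \<in> curve_algebra G \<Longrightarrow> (\<lambda>t. u t + v t) \<in> curve_algebra G"
| mult: "u \<in> curve_algebra G \<Longrightarrow> v \<in> curve_algebra G \<Longrightarrow> (\<lambda>t. u t * v t) \<in> curve_algebra G"

lemma curve_algebra_smooth:
  assumes G: "\<And>t. (G has_real_derivative G' t) (at t)"
    and G': "(\<lambda>t. of_real (G' t)) \<in> curve_algebra G" and "u \<in> curve_algebra G"
  shows "smooth_curve u"
proof (rule smooth_curve_coinduct[OF assms(3)])
  fix u assume "u \<in> curve_algebra G"
  then show "\<exists>v\<in>curve_algebra G. \<forall>t. (u has_vector_derivative v t) (at t)"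
  proof induction
    case (smooth b)
    then show ?case by (meson smooth_curve_derivative curve_algebra.smooth)
  next
    case (comp a)
    obtain \<delta> where \<delta>: "smooth_curve \<delta>" "\<And>t. (a has_vector_derivative \<delta> t) (at t)"
      by (rule smooth_curve_derivative[OF comp]) (rule that)
    have "((a \<circ> G) has_vector_derivative of_real (G' t) * (\<delta> \<circ> G) t) (at t)" for t
      using vector_diff_chain_at[OF G[of t, unfolded has_real_derivative_iff_has_vector_derivative] \<delta>(2)]
      by (simp add: scaleR_conv_of_real)
    then show ?case
      using curve_algebra.mult[OF G' curve_algebra.comp[OF \<delta>(1)]]
      by (intro bexI[of _ "\<lambda>t. of_real (G' t) * (\<delta> \<circ> G) t"] allI)
  next
    case (add u v)
    then obtain u' v' where "u' \<in> curve_algebra G" "v' \<in> curve_algebra G"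
      "\<And>t. (u has_vector_derivative u' t) (at t)" "\<And>t. (v has_vector_derivative v' t) (at t)" by blast
    then show ?case
      by (intro bexI[of _ "\<lambda>t. u' t + v' t"] allI has_vector_derivative_add curve_algebra.add)
  next
    case (mult u v)
    then obtain u' v' where "u' \<in> curve_algebra G" "v' \<in> curve_algebra G"
      "\<And>t. (u has_vector_derivative u' t) (at t)" "\<And>t. (v has_vector_derivative v' t) (at t)" by blast
    then show ?case
      using mult.hyps
      by (intro bexI[of _ "\<lambda>t. u t * v' t + u' t * v t"] allI has_vector_derivative_mult
          curve_algebra.add curve_algebra.mult)
  qed
qed

text \<open>For \<open>s\<close> near \<open>t\<close>, a continuous lift of \<open>\<gamma>\<close> is \<open>G s = G t + Im (Ln (\<gamma> s / \<gamma> t)) / (2 \<pi>)\<close>.\<close>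

lemma lift_has_derivative:
  assumes cont: "continuous_on UNIV G" and lift: "\<And>s. circle_proj (G s) = \<gamma> s"
    and deriv: "(\<gamma> has_vector_derivative \<delta>) (at t)"
  shows "(G has_real_derivative Im (\<delta> / \<gamma> t) / (2 * pi)) (at t)"
    and "\<delta> = of_real (Im (\<delta> / \<gamma> t) / (2 * pi)) * (2 * of_real pi * \<i> * \<gamma> t)"
proof -
  have nz: "\<gamma> s \<noteq> 0" for s using lift[of s] by (auto simp: circle_proj_def)
  have d1: "((\<lambda>s. \<gamma> s / \<gamma> t) has_vector_derivative \<delta> / \<gamma> t) (at t)"
    using deriv by (rule has_vector_derivative_divide)
  have "((\<lambda>z. Ln z) has_field_derivative inverse (\<gamma> t / \<gamma> t)) (at (\<gamma> t / \<gamma> t))"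
    using nz by (intro has_field_derivative_Ln) simp
  from field_vector_diff_chain_at[OF d1 this]
  have "((\<lambda>s. Ln (\<gamma> s / \<gamma> t)) has_vector_derivative \<delta> / \<gamma> t) (at t)"
    using nz by (simp add: comp_def)
  then have "((\<lambda>s. Im (Ln (\<gamma> s / \<gamma> t))) has_real_derivative Im (\<delta> / \<gamma> t)) (at t)"
    unfolding has_real_derivative_iff_has_vector_derivative
    by (rule bounded_linear.has_vector_derivative[OF bounded_linear_Im])
  from DERIV_add[OF DERIV_const DERIV_cdivide[OF this]] have "((\<lambda>s. G t + Im (Ln (\<gamma> s / \<gamma> t)) / (2 * pi)) has_real_derivative
      Im (\<delta> / \<gamma> t) / (2 * pi)) (at t)"
    by simp
  moreover have "open {s. \<bar>G s - G t\<bar> < 1 / 2}"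
    using cont by (intro open_Collect_less continuous_intros)
  moreover have "t \<in> {s. \<bar>G s - G t\<bar> < 1 / 2}" by simp
  moreover have "G t + Im (Ln (\<gamma> s / \<gamma> t)) / (2 * pi) = G s" if "s \<in> {s. \<bar>G s - G t\<bar> < 1 / 2}" for s
  proof -
    have "\<gamma> s / \<gamma> t = exp (2 * of_real pi * \<i> * of_real (G s - G t))"
      by (simp add: circle_proj_def exp_diff algebra_simps flip: lift)
    moreover have "\<bar>2 * pi * (G s - G t)\<bar> < pi" using that by (simp add: abs_mult)
    ultimately have "Ln (\<gamma> s / \<gamma> t) = 2 * of_real pi * \<i> * of_real (G s - G t)"
      by (simp add: Ln_exp abs_less_iff)
    then show ?thesis by simp
  qed
  ultimately show G: "(G has_real_derivative Im (\<delta> / \<gamma> t) / (2 * pi)) (at t)"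
    by (rule has_field_derivative_transform_within_open) simp_all
  have "((circle_proj \<circ> G) has_vector_derivative
      (Im (\<delta> / \<gamma> t) / (2 * pi)) *\<^sub>R (2 * of_real pi * \<i> * circle_proj (G t))) (at t)"
    using G circle_proj_has_vector_derivative
    unfolding has_real_derivative_iff_has_vector_derivative by (rule vector_diff_chain_at)
  moreover have "circle_proj \<circ> G = \<gamma>" using lift by auto
  ultimately have "\<delta> = (Im (\<delta> / \<gamma> t) / (2 * pi)) *\<^sub>R (2 * of_real pi * \<i> * circle_proj (G t))"
    using vector_derivative_unique_at[OF deriv] by metis
  then show "\<delta> = of_real (Im (\<delta> / \<gamma> t) / (2 * pi)) * (2 * of_real pi * \<i> * \<gamma> t)"
    unfolding scaleR_conv_of_real lift .
qed

text \<open>The derivative of \<open>G\<close> is \<open>\<gamma>' cnj \<gamma> / (2 \<pi> \<i>)\<close>, as \<open>\<bar>\<gamma>\<bar> = 1\<close>. This is a product of smooth curves.\<close>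

lemma smooth_curve_comp_lift:
  assumes cont: "continuous_on UNIV G" and lift: "\<And>s. circle_proj (G s) = \<gamma> s"
    and "smooth_curve \<gamma>" "smooth_curve a"
  shows "smooth_curve (a \<circ> G)"
proof -
  obtain \<delta> where \<delta>: "smooth_curve \<delta>" "\<And>t. (\<gamma> has_vector_derivative \<delta> t) (at t)"
    by (rule smooth_curve_derivative[OF assms(3)]) (rule that)
  define G' where "G' t = Im (\<delta> t / \<gamma> t) / (2 * pi)" for t
  have G: "(G has_real_derivative G' t) (at t)" for t
    unfolding G'_def by (rule lift_has_derivative(1)[OF cont lift \<delta>(2)])
  have "of_real (G' t) = 1 / (2 * of_real pi * \<i>) * (\<delta> t * cnj (\<gamma> t))" for t
  proof -
    have "norm (\<gamma> t) = 1" using lift[of t] circle_proj_in_circle[of "G t"] by simp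
    then have "\<gamma> t * cnj (\<gamma> t) = 1" by (simp add: complex_norm_square[symmetric])
    moreover have "\<delta> t = of_real (G' t) * (2 * of_real pi * \<i> * \<gamma> t)"
      unfolding G'_def by (rule lift_has_derivative(2)[OF cont lift \<delta>(2)])
    ultimately have "\<delta> t * cnj (\<gamma> t) = of_real (G' t) * (2 * of_real pi * \<i>)"
      by (simp add: mult.assoc)
    then show ?thesis by simp
  qed
  then have "(\<lambda>t. of_real (G' t)) \<in> curve_algebra G"
    using curve_algebra.mult[OF curve_algebra.smooth[OF smooth_curve_const[of "1 / (2 * of_real pi * \<i>)"]]
        curve_algebra.mult[OF curve_algebra.smooth[OF \<delta>(1)] curve_algebra.smooth[OF smooth_curve_cnj[OF assms(3)]]]]
    by presburger
  then show ?thesis using curve_algebra_smooth[OF G] curve_algebra.comp assms(4) by blast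
qed

lemma Diff_circle_lipschitz:
  assumes "f \<in> Diff_circle" "is_lift F f"
  shows "\<exists>L. L-lipschitz_on {0..1} F"
proof -
  let ?\<gamma> = "f \<circ> circle_proj"
  have \<gamma>: "smooth_curve ?\<gamma>" using assms(1) by (auto simp: Diff_circle_def)
  obtain \<delta> where \<delta>: "smooth_curve \<delta>" "\<And>t. (?\<gamma> has_vector_derivative \<delta> t) (at t)"
    by (rule smooth_curve_derivative[OF \<gamma>]) (rule that)
  have cont: "continuous_on UNIV F" using assms(2) is_lift_homeo real_homeo_continuous by blast
  define F' where "F' t = Im (\<delta> t / ?\<gamma> t) / (2 * pi)" for t
  have F: "(F has_real_derivative F' t) (at t)" for t
    unfolding F'_def
    by (rule lift_has_derivative(1)[OF cont _ \<delta>(2)]) (simp add: is_lift_apply[OF assms(2)])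
  have "?\<gamma> t \<noteq> 0" for t
    using is_lift_apply[OF assms(2), of t] by (auto simp: circle_proj_def)
  then have "continuous_on {0..1} F'"
    unfolding F'_def by (intro continuous_intros smooth_curve_continuous \<gamma> \<delta>(1)) auto
  then have "bounded (F' ` {0..1})" by (intro compact_imp_bounded compact_continuous_image) auto
  then obtain B where B: "\<And>t. t \<in> {0..1} \<Longrightarrow> \<bar>F' t\<bar> \<le> B"
    unfolding bounded_iff by (metis imageI real_norm_def)
  have "B-lipschitz_on {0..1} F"
  proof (rule bounded_derivative_imp_lipschitz)
    show "(F has_derivative (\<lambda>h. F' t * h)) (at t within {0..1})" for t
      using F[of t] by (simp add: has_field_derivative_def has_derivative_at_withinI)
    show "onorm (\<lambda>h. F' t * h) \<le> B" if "t \<in> {0..1}" for t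
      using B[OF that] by (intro onorm_le) (simp add: abs_mult mult_right_mono)
    show "0 \<le> B" using B[of 0] by simp
  qed simp
  then show ?thesis by blast
qed

lemma embeds_in_QI_Diff: "embeds_in (comp_group (lifts Diff_circle)) (QI :: (real \<Rightarrow> real) set monoid)"
proof (rule embeds_in_QI_lifts[OF _ _ _ Diff_circle_lipschitz])
  show "id \<in> Diff_circle"
    unfolding Diff_circle_def mem_Collect_eq
    by (intro exI[of _ id]) (simp add: smooth_curve_circle_proj homeomorphism_ident[folded id_def])
  show "\<exists>g\<in>Diff_circle. homeomorphism circle circle f g" if "f \<in> Diff_circle" for f
    using that homeomorphism_symD unfolding Diff_circle_def by blast
  show "f \<circ> g \<in> Diff_circle"
    if fg: "f \<in> Diff_circle" "g \<in> Diff_circle" "is_lift F f" "is_lift G g" for f g F G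
  proof -
    obtain f' where f': "homeomorphism circle circle f f'" "smooth_curve (f \<circ> circle_proj)"
      "smooth_curve (f' \<circ> circle_proj)" using fg by (auto simp: Diff_circle_def)
    obtain g' where g': "homeomorphism circle circle g g'" "smooth_curve (g \<circ> circle_proj)"
      "smooth_curve (g' \<circ> circle_proj)" using fg by (auto simp: Diff_circle_def)
    have smooth: "smooth_curve ((a \<circ> b) \<circ> circle_proj)"
      if "smooth_curve (a \<circ> circle_proj)" "smooth_curve (b \<circ> circle_proj)" "is_lift H b" for a b H
    proof -
      have "smooth_curve ((a \<circ> circle_proj) \<circ> H)"
        using real_homeo_continuous is_lift_homeo is_lift_apply that
        by (intro smooth_curve_comp_lift[where \<gamma> = "b \<circ> circle_proj"]) auto
      moreover have "(a \<circ> circle_proj) \<circ> H = (a \<circ> b) \<circ> circle_proj"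
        using is_lift_apply[OF that(3)] by auto
      ultimately show ?thesis by simp
    qed
    have "homeomorphism circle circle (f \<circ> g) (g' \<circ> f')"
      using g'(1) f'(1) by (rule homeomorphism_compose)
    moreover have "smooth_curve ((f \<circ> g) \<circ> circle_proj)"
      using f'(2) g'(2) fg(4) by (rule smooth)
    moreover have "smooth_curve ((g' \<circ> f') \<circ> circle_proj)"
      using g'(3) f'(3) is_lift_inv[OF fg(3) f'(1)] by (rule smooth)
    ultimately show ?thesis unfolding Diff_circle_def by blast
  qed
qed


section \<open>Piecewise-linear homeomorphisms\<close>

text \<open>Piecewise linearity is a local property: linearity on a one-sided neighbourhood of every
  point, on both sides. In this form it passes to compositions and inverses.\<close>

definition side_linear :: "(real \<Rightarrow> real) \<Rightarrow> real \<Rightarrow> real \<Rightarrow> bool" where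
  "side_linear f t \<sigma> \<longleftrightarrow> (\<exists>\<epsilon>>0. \<exists>m. \<forall>h\<in>{0..\<epsilon>}. f (t + \<sigma> * h) = f t + m * h)"

definition locally_linear :: "(real \<Rightarrow> real) \<Rightarrow> bool" where
  "locally_linear f \<longleftrightarrow> (\<forall>t. side_linear f t 1 \<and> side_linear f t (- 1))"

lemma side_linear_lipschitz:
  assumes "\<bar>\<sigma>\<bar> = 1" "\<forall>h\<in>{0..\<epsilon>}. f (t + \<sigma> * h) = f t + m * h"
  shows "\<bar>m\<bar>-lipschitz_on ((\<lambda>h. t + \<sigma> * h) ` {0..\<epsilon>}) f"
proof (rule lipschitz_onI)
  fix x y assume "x \<in> (\<lambda>h. t + \<sigma> * h) ` {0..\<epsilon>}" "y \<in> (\<lambda>h. t + \<sigma> * h) ` {0..\<epsilon>}"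
  then obtain h k where hk: "h \<in> {0..\<epsilon>}" "x = t + \<sigma> * h" "k \<in> {0..\<epsilon>}" "y = t + \<sigma> * k" by blast
  have "f x = f t + m * h" "f y = f t + m * k" using hk assms(2) by auto
  then have "x - y = \<sigma> * (h - k)" "f x - f y = m * (h - k)" using hk by (simp_all add: right_diff_distrib)
  then show "dist (f x) (f y) \<le> \<bar>m\<bar> * dist x y" using assms(1) by (simp add: dist_real_def abs_mult)
qed simp

lemma locally_linear_imp_locally_lipschitz:
  assumes "locally_linear f"
  obtains \<epsilon> L where "\<epsilon> > 0" "L-lipschitz_on {t - \<epsilon>..t + \<epsilon>} f"
proof -
  obtain \<epsilon> m where r: "\<epsilon> > 0" "\<forall>h\<in>{0..\<epsilon>}. f (t + 1 * h) = f t + m * h"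
    using assms unfolding locally_linear_def side_linear_def by blast
  obtain \<delta> k where l: "\<delta> > 0" "\<forall>h\<in>{0..\<delta>}. f (t + (- 1) * h) = f t + k * h"
    using assms unfolding locally_linear_def side_linear_def by blast
  let ?e = "min \<epsilon> \<delta>"
  have "\<bar>m\<bar>-lipschitz_on {t..t + ?e} f"
    by (rule lipschitz_on_subset[OF side_linear_lipschitz[OF _ r(2)]])
      (auto intro!: image_eqI[of _ _ "x - t" for x])
  moreover have "\<bar>k\<bar>-lipschitz_on {t - ?e..t} f"
    by (rule lipschitz_on_subset[OF side_linear_lipschitz[OF _ l(2)]])
      (auto intro!: image_eqI[of _ _ "t - x" for x])
  ultimately have "(max \<bar>k\<bar> \<bar>m\<bar>)-lipschitz_on {t - ?e..t + ?e} f"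
    using lipschitz_on_concat_max[of "\<bar>k\<bar>" "t - ?e" t f "\<bar>m\<bar>" "t + ?e" f] by simp
  then show ?thesis using that[of ?e] r(1) l(1) by simp
qed

lemma locally_linear_lipschitz_on:
  assumes "locally_linear f"
  obtains L where "L-lipschitz_on {u..v} f"
proof -
  have "\<exists>\<epsilon> L. \<epsilon> > 0 \<and> L-lipschitz_on {t - \<epsilon>..t + \<epsilon>} f" for t
    using locally_linear_imp_locally_lipschitz[OF assms] by metis
  then obtain \<epsilon> where "\<And>t. \<epsilon> t > 0 \<and> (\<exists>L. L-lipschitz_on {t - \<epsilon> t..t + \<epsilon> t} f)" by metis
  then obtain L where e: "\<And>t. \<epsilon> t > 0" "\<And>t. (L t)-lipschitz_on {t - \<epsilon> t..t + \<epsilon> t} f" by metis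
  obtain T where T: "finite T" "{u..v} \<subseteq> (\<Union>t\<in>T. {t - \<epsilon> t<..<t + \<epsilon> t})"
  proof (rule compactE_image[of "{u..v}" "{u..v}" "\<lambda>t. {t - \<epsilon> t<..<t + \<epsilon> t}"])
    show "{u..v} \<subseteq> (\<Union>t\<in>{u..v}. {t - \<epsilon> t<..<t + \<epsilon> t})" using e(1) by force
  qed auto
  have nonneg: "L t \<ge> 0" for t using e(2) lipschitz_on_nonneg by blast
  have "(\<Sum>t\<in>T. L t)-lipschitz_on {u..v} f"
  proof (rule lipschitz_on_closed_Union[of T _ "\<lambda>t. {t - \<epsilon> t..t + \<epsilon> t}"])
    show "(\<Sum>t\<in>T. L t)-lipschitz_on {t - \<epsilon> t..t + \<epsilon> t} f" if "t \<in> T" for t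
      using e(2) by (rule lipschitz_on_le) (use that T(1) nonneg in \<open>auto intro: member_le_sum\<close>)
    show "{u..v} \<subseteq> (\<Union>t\<in>T. {t - \<epsilon> t..t + \<epsilon> t})"
      using T(2) by (rule order_trans) (rule UN_mono, simp, auto)
  qed (use T(1) nonneg in \<open>auto intro: sum_nonneg\<close>)
  then show ?thesis using that by blast
qed

lemma locally_linear_continuous:
  assumes "locally_linear f"
  shows "continuous_on UNIV f"
proof -
  have "isCont f t" for t
  proof -
    obtain \<epsilon> L where "\<epsilon> > 0" "L-lipschitz_on {t - \<epsilon>..t + \<epsilon>} f"
      by (rule locally_linear_imp_locally_lipschitz[OF assms]) (rule that)
    then show ?thesis
      using continuous_on_interior[OF lipschitz_on_continuous_on, of L "{t - \<epsilon>..t + \<epsilon>}" f t] by simp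
  qed
  then show ?thesis by (simp add: continuous_at_imp_continuous_on)
qed

text \<open>Close to \<open>t\<close> there are no breakpoints other than possibly \<open>t\<close> itself, so \<open>f\<close> is affine on an open
  interval on each side of \<open>t\<close>; by continuity the affine function has the value \<open>f t\<close> at \<open>t\<close>.\<close>

lemma piecewise_linear_imp_side_linear:
  assumes "piecewise_linear f" and \<sigma>: "\<sigma> = 1 \<or> \<sigma> = - 1"
  shows "side_linear f t \<sigma>"
proof -
  obtain B where cont: "continuous_on UNIV f" and fin: "\<And>a b. finite (B \<inter> {a..b})"
    and lin: "\<And>a b. B \<inter> {a<..<b} = {} \<Longrightarrow> \<exists>m c. \<forall>x\<in>{a<..<b}. f x = m * x + c"
    using assms(1) unfolding piecewise_linear_def by blast
  obtain \<delta> where \<delta>: "\<delta> > 0" "\<And>x. x \<in> B \<inter> {t - 1..t + 1} \<Longrightarrow> x \<noteq> t \<Longrightarrow> \<delta> \<le> dist t x"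
    using finite_set_avoid[OF fin] by blast
  define e where "e = min \<delta> 1"
  have e: "e > 0" using \<delta>(1) by (simp add: e_def)
  have avoid: "x \<notin> B" if "x \<noteq> t" "\<bar>x - t\<bar> < e" for x
    using \<delta>(2)[of x] that by (auto simp: e_def dist_real_def abs_less_iff abs_minus_commute)
  define a where "a = min t (t + \<sigma> * e)"
  define b where "b = max t (t + \<sigma> * e)"
  have "B \<inter> {a<..<b} = {}"
    using avoid \<sigma> e by (fastforce simp: a_def b_def abs_less_iff)
  then obtain m c where mc: "\<And>x. x \<in> {a<..<b} \<Longrightarrow> f x = m * x + c" using lin by blast
  have open_side: "f (t + \<sigma> * h) = m * (t + \<sigma> * h) + c" if "0 < h" "h < e" for h
    using \<sigma> that e by (intro mc) (auto simp: a_def b_def)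
  have "f t = m * t + c"
  proof (rule tendsto_unique)
    show "((\<lambda>h. f (t + \<sigma> * h)) \<longlongrightarrow> f t) (at_right 0)"
    proof -
      have "isCont (\<lambda>h. f (t + \<sigma> * h)) 0"
        using cont by (intro isCont_o2[where f = "\<lambda>h. t + \<sigma> * h" and g = f] continuous_intros)
          (simp add: continuous_on_eq_continuous_at)
      then have "((\<lambda>h. f (t + \<sigma> * h)) \<longlongrightarrow> f t) (at 0)" by (simp add: isCont_def)
      then show ?thesis by (rule tendsto_within_subset) simp
    qed
    have "((\<lambda>h. m * (t + \<sigma> * h) + c) \<longlongrightarrow> m * (t + \<sigma> * 0) + c) (at_right 0)"
      by (intro tendsto_intros)
    moreover have "\<forall>\<^sub>F h in at_right 0. m * (t + \<sigma> * h) + c = f (t + \<sigma> * h)"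
      unfolding eventually_at_right_field using open_side e by metis
    ultimately show "((\<lambda>h. f (t + \<sigma> * h)) \<longlongrightarrow> m * t + c) (at_right 0)"
      by (simp add: tendsto_cong)
  qed simp
  then have "f (t + \<sigma> * h) = f t + (m * \<sigma>) * h" if "h \<in> {0..e / 2}" for h
    using open_side[of h] that e by (cases "h = 0") (auto simp: algebra_simps)
  then show ?thesis unfolding side_linear_def using e by (intro exI[of _ "e / 2"]) auto
qed

definition linear_near :: "(real \<Rightarrow> real) \<Rightarrow> real \<Rightarrow> bool" where
  "linear_near f t \<longleftrightarrow> (\<exists>\<epsilon>>0. \<exists>m. \<forall>x. \<bar>x - t\<bar> < \<epsilon> \<longrightarrow> f x = f t + m * (x - t))"

text \<open>The derivative of a function that is linear near every point of an interval is locally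
  constant, hence constant.\<close>

lemma linear_near_interval:
  assumes "\<And>t. t \<in> {a<..<b} \<Longrightarrow> linear_near f t"
  shows "\<exists>m c. \<forall>x\<in>{a<..<b}. f x = m * x + c"
proof -
  let ?S = "{a<..<b}"
  have near: "\<exists>\<epsilon>>0. \<exists>m. \<forall>y. \<bar>y - t\<bar> < \<epsilon> \<longrightarrow> (f has_real_derivative m) (at y)" if t: "t \<in> ?S" for t
  proof -
    obtain \<epsilon> m where e: "\<epsilon> > 0" "\<And>x. \<bar>x - t\<bar> < \<epsilon> \<Longrightarrow> f x = f t + m * (x - t)"
      using assms[OF t] unfolding linear_near_def by blast
    have "(f has_real_derivative m) (at y)" if "\<bar>y - t\<bar> < \<epsilon>" for y
    proof (rule has_field_derivative_transform_within_open[where S = "ball t \<epsilon>"])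
      show "((\<lambda>x. f t + m * (x - t)) has_real_derivative m) (at y)"
        by (auto intro!: derivative_eq_intros)
      show "f t + m * (x - t) = f x" if "x \<in> ball t \<epsilon>" for x
        using that by (intro e(2)[symmetric]) (simp add: dist_real_def abs_minus_commute)
    qed (use that in \<open>simp_all add: dist_real_def abs_minus_commute\<close>)
    then show ?thesis using e(1) by blast
  qed
  have "deriv f constant_on ?S"
  proof (rule has_field_derivative_0_imp_constant_on)
    fix t assume "t \<in> ?S"
    then obtain \<epsilon> m where e: "\<epsilon> > 0" "\<And>y. \<bar>y - t\<bar> < \<epsilon> \<Longrightarrow> (f has_real_derivative m) (at y)"
      using near by blast
    show "(deriv f has_real_derivative 0) (at t)"
    proof (rule has_field_derivative_transform_within_open[where S = "ball t \<epsilon>" and f = "\<lambda>_. m"])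
      show "m = deriv f y" if "y \<in> ball t \<epsilon>" for y
        using that e(2)[of y] by (simp add: DERIV_imp_deriv dist_real_def abs_minus_commute)
    qed (use e(1) in auto)
  qed auto
  then obtain m where m: "\<And>x. x \<in> ?S \<Longrightarrow> deriv f x = m" by (auto simp: constant_on_def)
  have "(\<lambda>x. f x - m * x) constant_on ?S"
  proof (rule has_field_derivative_0_imp_constant_on)
    fix t assume t: "t \<in> ?S"
    then obtain k where "(f has_real_derivative k) (at t)" using near by (metis abs_zero diff_self)
    then have "(f has_real_derivative m) (at t)" using m[OF t] by (simp add: DERIV_imp_deriv)
    then show "((\<lambda>x. f x - m * x) has_real_derivative 0) (at t)"
      by (auto intro!: derivative_eq_intros)
  qed auto
  then obtain c where "\<And>x. x \<in> ?S \<Longrightarrow> f x - m * x = c" by (auto simp: constant_on_def)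
  then show ?thesis by (intro exI[of _ m] exI[of _ c]) (auto simp: algebra_simps)
qed

text \<open>For a locally linear function, the points near which it is not linear form a discrete closed set,
  and this is the set of breakpoints.\<close>

lemma piecewise_linear_iff_locally_linear: "piecewise_linear f \<longleftrightarrow> locally_linear f"
proof
  show "locally_linear f" if "piecewise_linear f"
    using that piecewise_linear_imp_side_linear by (simp add: locally_linear_def)
next
  assume f: "locally_linear f"
  define B where "B = {t. \<not> linear_near f t}"
  have isolated: "\<exists>\<epsilon>>0. \<forall>x. x \<noteq> t \<and> \<bar>x - t\<bar> < \<epsilon> \<longrightarrow> x \<notin> B" for t
  proof -
    have side: "\<exists>\<epsilon>>0. \<forall>h. 0 < h \<and> h < \<epsilon> \<longrightarrow> linear_near f (t + \<sigma> * h)"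
      if \<sigma>: "\<sigma> = 1 \<or> \<sigma> = - 1" for \<sigma>
    proof -
      obtain \<epsilon> m where e: "\<epsilon> > 0" "\<And>h. h \<in> {0..\<epsilon>} \<Longrightarrow> f (t + \<sigma> * h) = f t + m * h"
        using f \<sigma> unfolding locally_linear_def side_linear_def by metis
      have "linear_near f (t + \<sigma> * h)" if h: "0 < h" "h < \<epsilon>" for h
      proof -
        have "f x = f (t + \<sigma> * h) + m * \<sigma> * (x - (t + \<sigma> * h))"
          if x: "\<bar>x - (t + \<sigma> * h)\<bar> < min h (\<epsilon> - h)" for x
        proof -
          have "\<sigma> * (x - t) \<in> {0..\<epsilon>}" using x \<sigma> by (auto simp: abs_less_iff)
          from e(2)[OF this] have "f x = f t + m * (\<sigma> * (x - t))" using \<sigma> by auto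
          moreover have "f (t + \<sigma> * h) = f t + m * h" using h by (intro e(2)) auto
          ultimately show ?thesis using \<sigma> by (auto simp: algebra_simps)
        qed
        moreover have "min h (\<epsilon> - h) > 0" using h by simp
        ultimately show ?thesis unfolding linear_near_def by blast
      qed
      then show ?thesis using e(1) by blast
    qed
    obtain \<epsilon> where e: "\<epsilon> > 0" "\<And>h. 0 < h \<Longrightarrow> h < \<epsilon> \<Longrightarrow> linear_near f (t + 1 * h)" using side[of 1] by blast
    obtain \<delta> where d: "\<delta> > 0" "\<And>h. 0 < h \<Longrightarrow> h < \<delta> \<Longrightarrow> linear_near f (t + (- 1) * h)" using side[of "- 1"] by blast
    have "x \<notin> B" if "x \<noteq> t" "\<bar>x - t\<bar> < min \<epsilon> \<delta>" for x
      using e(2)[of "x - t"] d(2)[of "t - x"] that by (cases "x > t") (auto simp: B_def)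
    then show ?thesis using e(1) d(1) by (intro exI[of _ "min \<epsilon> \<delta>"]) auto
  qed
  have "finite (B \<inter> {a..b})" for a b
  proof -
    have "\<not> t islimpt B" for t
      using isolated[of t] unfolding islimpt_approachable by (metis dist_real_def)
    then have "finite ({a..b} \<inter> B)" by (intro finite_not_islimpt_in_compact) auto
    then show ?thesis by (simp add: Int_commute)
  qed
  moreover have "\<exists>m c. \<forall>x\<in>{a<..<b}. f x = m * x + c" if "B \<inter> {a<..<b} = {}" for a b
    using that by (intro linear_near_interval) (auto simp: B_def)
  ultimately show "piecewise_linear f"
    unfolding piecewise_linear_def using locally_linear_continuous[OF f] by blast
qed

lemma piecewise_linear_translation: "piecewise_linear (\<lambda>t. t + c)"
proof -
  have "side_linear (\<lambda>t. t + c) t \<sigma>" for t \<sigma>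
    unfolding side_linear_def by (intro exI[of _ 1] exI[of _ \<sigma>] conjI) auto
  then show ?thesis by (simp add: piecewise_linear_iff_locally_linear locally_linear_def)
qed

lemma piecewise_linear_id: "piecewise_linear id"
  using piecewise_linear_translation[of 0] by (simp add: id_def)

text \<open>The sign \<open>\<tau>\<close> of the slope of \<open>g\<close> decides on which side of \<open>g t\<close> the map \<open>f\<close> is applied.\<close>

lemma side_linear_comp:
  assumes f: "locally_linear f" and "side_linear g t \<sigma>"
  shows "side_linear (f \<circ> g) t \<sigma>"
proof -
  obtain \<epsilon> m where e: "\<epsilon> > 0" "\<And>h. h \<in> {0..\<epsilon>} \<Longrightarrow> g (t + \<sigma> * h) = g t + m * h"
    using assms(2) unfolding side_linear_def by blast
  define \<tau> where "\<tau> = (if m \<ge> 0 then 1 else - 1 :: real)"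
  have "side_linear f (g t) \<tau>" using f by (simp add: locally_linear_def \<tau>_def)
  then obtain \<delta> k where d: "\<delta> > 0" "\<And>h. h \<in> {0..\<delta>} \<Longrightarrow> f (g t + \<tau> * h) = f (g t) + k * h"
    unfolding side_linear_def by blast
  \<comment> \<open>the summand \<open>1\<close> allows for a slope \<open>m = 0\<close>\<close>
  let ?e = "min \<epsilon> (\<delta> / (\<bar>m\<bar> + 1))"
  have "(f \<circ> g) (t + \<sigma> * h) = (f \<circ> g) t + k * \<bar>m\<bar> * h" if h: "h \<in> {0..?e}" for h
  proof -
    have "h \<le> \<delta> / (\<bar>m\<bar> + 1)" using h by simp
    then have "h * (\<bar>m\<bar> + 1) \<le> \<delta>" by (simp add: pos_le_divide_eq)
    then have "\<bar>m\<bar> * h \<in> {0..\<delta>}" using h by (simp add: algebra_simps)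
    from d(2)[OF this] have "f (g t + m * h) = f (g t) + k * (\<bar>m\<bar> * h)"
      by (cases "m \<ge> 0") (simp_all add: \<tau>_def)
    then show ?thesis using e(2)[of h] h by simp
  qed
  moreover have "?e > 0" using e(1) d(1) by simp
  ultimately show ?thesis unfolding side_linear_def by blast
qed

lemma piecewise_linear_comp:
  "piecewise_linear f \<Longrightarrow> piecewise_linear g \<Longrightarrow> piecewise_linear (f \<circ> g)"
  unfolding piecewise_linear_iff_locally_linear
  using side_linear_comp by (simp add: locally_linear_def[of g] locally_linear_def[of "f \<circ> g"])

text \<open>The one-sided slopes of an injective piecewise-linear function at a point are nonzero, and have opposite signs
  if both are taken in the outward direction. So the inverse function is linear on both sides.\<close>

lemma piecewise_linear_inv:
  assumes f: "piecewise_linear f" and b: "bij f"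
  shows "piecewise_linear (finv f)"
  unfolding piecewise_linear_iff_locally_linear locally_linear_def
proof
  fix s
  define t where "t = finv f s"
  have ft: "f t = s" using b by (simp add: t_def bij_is_surj surj_f_inv_f)
  have inj: "x = y" if "f x = f y" for x y using that b by (meson bij_is_inj injD)
  have lin: "locally_linear f" using f by (simp add: piecewise_linear_iff_locally_linear)
  obtain \<epsilon> m where r: "\<epsilon> > 0" "\<And>h. h \<in> {0..\<epsilon>} \<Longrightarrow> f (t + 1 * h) = f t + m * h"
    using lin unfolding locally_linear_def side_linear_def by metis
  obtain \<delta> k where l: "\<delta> > 0" "\<And>h. h \<in> {0..\<delta>} \<Longrightarrow> f (t + (- 1) * h) = f t + k * h"
    using lin unfolding locally_linear_def side_linear_def by metis
  have m: "m \<noteq> 0" using inj[of "t + 1 * \<epsilon>" t] r(2)[of \<epsilon>] r(1) by auto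
  have k: "k \<noteq> 0" using inj[of "t + (- 1) * \<delta>" t] l(2)[of \<delta>] l(1) by auto
  have opposite: "m * k < 0"
  proof (rule ccontr)
    assume "\<not> m * k < 0"
    then have "m / k > 0" "k / m > 0" using m k by (auto simp: zero_less_divide_iff mult_less_0_iff)
    \<comment> \<open>a step to the right that has the same effect as a step to the left\<close>
    define h where "h = min \<delta> (\<epsilon> * (m / k))"
    have "\<epsilon> * (m / k) > 0" using r(1) \<open>m / k > 0\<close> by (rule mult_pos_pos)
    then have h: "h > 0" "h \<le> \<delta>" using l(1) by (simp_all add: h_def)
    have "h * (k / m) \<le> \<epsilon> * (m / k) * (k / m)"
      using \<open>k / m > 0\<close> by (intro mult_right_mono) (auto simp: h_def)
    also have "\<epsilon> * (m / k) * (k / m) = \<epsilon>" using m k by simp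
    finally have "h * (k / m) \<le> \<epsilon>" .
    moreover have pos: "h * (k / m) > 0" using h(1) \<open>k / m > 0\<close> by (rule mult_pos_pos)
    ultimately have "f (t + 1 * (h * (k / m))) = f t + m * (h * (k / m))" by (intro r(2)) simp
    also have "m * (h * (k / m)) = k * h" using m by simp
    also have "f t + k * h = f (t + (- 1) * h)" using l(2)[of h] h by simp
    finally have "t + 1 * (h * (k / m)) = t + (- 1) * h" by (rule inj)
    then have "h * (k / m) = - h" by simp
    then show False using pos h(1) by linarith
  qed
  have inv_side: "side_linear (finv f) s \<rho>"
    if \<rho>: "\<rho> = 1 \<or> \<rho> = - 1" and n: "n * \<rho> > 0" and e: "e > 0"
      "\<And>h. h \<in> {0..e} \<Longrightarrow> f (t + \<sigma> * h) = f t + n * h" for \<rho> \<sigma> n e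
  proof -
    have n0: "\<bar>n\<bar> > 0" using n by auto
    have n\<rho>: "n = \<rho> * \<bar>n\<bar>" using n \<rho> by auto
    have "finv f (s + \<rho> * h) = finv f s + (\<sigma> / \<bar>n\<bar>) * h" if h: "h \<in> {0..e * \<bar>n\<bar>}" for h
    proof -
      have "h / \<bar>n\<bar> \<in> {0..e}" using h by (simp add: pos_divide_le_eq[OF n0])
      from e(2)[OF this] have "f (t + \<sigma> * (h / \<bar>n\<bar>)) = s + n * (h / \<bar>n\<bar>)" by (simp add: ft)
      also have "n * (h / \<bar>n\<bar>) = \<rho> * h" by (subst n\<rho>) (use n0 in simp)
      finally have "finv f (s + \<rho> * h) = t + \<sigma> * (h / \<bar>n\<bar>)"
        using b by (metis bij_is_inj inv_f_f)
      then show ?thesis by (simp add: t_def)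
    qed
    moreover have "e * \<bar>n\<bar> > 0" using e(1) n0 by (rule mult_pos_pos)
    ultimately show ?thesis unfolding side_linear_def by blast
  qed
  show "side_linear (finv f) s 1 \<and> side_linear (finv f) s (- 1)"
  proof (cases "m > 0")
    case True
    then have "k < 0" using opposite by (simp add: mult_less_0_iff)
    then show ?thesis using inv_side[of 1 m \<epsilon> 1] inv_side[of "- 1" k \<delta> "- 1"] True r l by auto
  next
    case False
    then have "m < 0" "k > 0" using m opposite by (auto simp: mult_less_0_iff)
    then show ?thesis using inv_side[of "- 1" m \<epsilon> 1] inv_side[of 1 k \<delta> "- 1"] r l by auto
  qed
qed

text \<open>\<^const>\<open>PL_circle\<close> speaks of all lifts of a map. A lift \<open>H\<close> of \<open>f \<circ> g\<close> is \<open>(H \<circ> G\<^sup>-\<^sup>1) \<circ> G\<close> for any lift \<open>G\<close>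
  of \<open>g\<close>, and \<open>H \<circ> G\<^sup>-\<^sup>1\<close> is a lift of \<open>f\<close>.\<close>

lemma embeds_in_QI_PL: "embeds_in (comp_group (lifts PL_circle)) (QI :: (real \<Rightarrow> real) set monoid)"
proof (rule embeds_in_QI_lifts)
  show "id \<in> PL_circle"
  proof -
    have "piecewise_linear F" if F: "is_lift F id" for F
    proof -
      have "continuous_on UNIV F" using F is_lift_homeo real_homeo_continuous by blast
      then have "continuous_on UNIV (\<lambda>t. F t - t)" by (intro continuous_intros)
      moreover have "F t - t \<in> \<int>" for t
        using is_lift_apply[OF F, of t] by (simp add: circle_proj_eq_iff)
      ultimately obtain n :: int where "\<And>t. F t - t = of_int n"
        using continuous_on_integer_valued by blast
      then have "F = (\<lambda>t. t + of_int n)" by (auto simp: algebra_simps fun_eq_iff)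
      then show ?thesis by (simp add: piecewise_linear_translation)
    qed
    moreover have "homeomorphism circle circle id id" by (rule homeomorphism_ident[folded id_def])
    ultimately show ?thesis unfolding PL_circle_def by blast
  qed
  show "\<exists>g\<in>PL_circle. homeomorphism circle circle f g" if f: "f \<in> PL_circle" for f
  proof -
    obtain g where g: "homeomorphism circle circle f g" using f by (auto simp: PL_circle_def)
    have "piecewise_linear G" if G: "is_lift G g" for G
    proof -
      have "is_lift (finv G) f" using G homeomorphism_symD[OF g] by (rule is_lift_inv)
      then have "piecewise_linear (finv G)" "bij (finv G)"
        using f is_lift_homeo real_homeo_bij by (auto simp: PL_circle_def)
      then have "piecewise_linear (finv (finv G))" by (rule piecewise_linear_inv)
      then show ?thesis using G is_lift_homeo real_homeo_bij by (simp add: inv_inv_eq)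
    qed
    then have "g \<in> PL_circle" using homeomorphism_symD[OF g] by (auto simp: PL_circle_def)
    then show ?thesis using g by blast
  qed
  show "f \<circ> g \<in> PL_circle"
    if f: "f \<in> PL_circle" and g: "g \<in> PL_circle" and G: "is_lift G g" for f g F G
  proof -
    obtain f' g' where f': "homeomorphism circle circle f f'" and g': "homeomorphism circle circle g g'"
      using f g by (auto simp: PL_circle_def)
    have "piecewise_linear H" if H: "is_lift H (f \<circ> g)" for H
    proof -
      have b: "bij G" using G is_lift_homeo real_homeo_bij by blast
      have "circle_proj (H (finv G t)) = f (circle_proj t)" for t
        using is_lift_apply[OF H] is_lift_apply[OF G, of "finv G t"] b
        by (simp add: bij_is_surj surj_f_inv_f)
      then have "is_lift (H \<circ> finv G) f"
        using H G by (auto simp: is_lift_def intro!: real_homeo_comp real_homeo_inv)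
      then have "piecewise_linear (H \<circ> finv G)" "piecewise_linear G"
        using f g G by (auto simp: PL_circle_def)
      then have "piecewise_linear (H \<circ> finv G \<circ> G)" by (rule piecewise_linear_comp)
      then show ?thesis using b by (simp add: comp_assoc bij_is_inj)
    qed
    then show ?thesis using homeomorphism_compose[OF g' f'] by (auto simp: PL_circle_def)
  qed
  show "\<exists>L. L-lipschitz_on {0..1} F" if "f \<in> PL_circle" "is_lift F f" for f F
  proof -
    have "locally_linear F"
      using that by (simp add: PL_circle_def piecewise_linear_iff_locally_linear)
    then show ?thesis by (metis locally_linear_lipschitz_on)
  qed
qed


section \<open>Gluing maps with disjoint supports\<close>

text \<open>The maps \<open>F n\<close> are to have disjoint supports, so that at most one of them moves \<open>x\<close>, and the
  choice finds it; at a point that is fixed by all of them any choice gives \<open>x\<close>.\<close>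

definition glue :: "(nat \<Rightarrow> 'a \<Rightarrow> 'a) \<Rightarrow> 'a \<Rightarrow> 'a" where
  "glue F x = F (SOME n. F n x \<noteq> x) x"

text \<open>\<open>block n\<close> is the interval from \<open>2 * 4 ^ n\<close> to \<open>4 ^ Suc n\<close>. The blocks are disjoint and of unbounded length; a glued map acts inside each block
  separately, so that countably many actions are put into one quasi-isometry.\<close>

definition block :: "nat \<Rightarrow> real set" where
  "block n = {x. \<bar>x - 3 * 4 ^ n\<bar> < 4 ^ n}"

lemma block_disjoint:
  assumes "x \<in> block m" "x \<in> block n"
  shows "m = n"
proof -
  have "False" if "x \<in> block m" "x \<in> block n" "m < n" for m n
  proof -
    have "(4::real) * 4 ^ m \<le> 4 ^ n"
      using power_increasing[of "Suc m" n "4::real"] that(3) by simp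
    then show False using that(1,2) unfolding block_def by (simp add: abs_less_iff)
  qed
  then show ?thesis using assms by (metis linorder_neqE_nat)
qed

definition blockwise :: "(nat \<Rightarrow> real \<Rightarrow> real) \<Rightarrow> bool" where
  "blockwise F \<longleftrightarrow> (\<forall>n x. F n x \<noteq> x \<longrightarrow> x \<in> block n)"

lemma blockwise_fixed: "blockwise F \<Longrightarrow> x \<in> block n \<Longrightarrow> m \<noteq> n \<Longrightarrow> F m x = x"
  using block_disjoint unfolding blockwise_def by blast

lemma blockwise_fixed_outside: "blockwise F \<Longrightarrow> x \<notin> block n \<Longrightarrow> F n x = x"
  unfolding blockwise_def by blast

lemma glue_eq:
  assumes "\<And>m. m \<noteq> n \<Longrightarrow> F m x = x"
  shows "glue F x = F n x"
proof (cases "\<exists>m. F m x \<noteq> x")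
  case True
  then have "F (SOME m. F m x \<noteq> x) x \<noteq> x" by (rule someI_ex)
  then have "(SOME m. F m x \<noteq> x) = n" using assms by blast
  then show ?thesis by (simp add: glue_def)
next
  case False
  then show ?thesis by (simp add: glue_def)
qed

lemma glue_block: "blockwise F \<Longrightarrow> x \<in> block n \<Longrightarrow> glue F x = F n x"
  by (rule glue_eq) (rule blockwise_fixed)

lemma glue_outside: "blockwise F \<Longrightarrow> (\<And>n. x \<notin> block n) \<Longrightarrow> glue F x = x"
  by (metis blockwise_fixed_outside glue_def)

lemma blockwise_invariant:
  assumes "blockwise F" "inj (F n)"
  shows "F n x \<in> block n \<longleftrightarrow> x \<in> block n"
  using assms blockwise_fixed_outside by (metis injD)

text \<open>Any two points lie in at most two blocks, so \<open>glue F\<close> agrees on them with a composition of at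
  most two of the maps \<open>F n\<close>. This is where the square comes from.\<close>

lemma bilipschitz_glue:
  assumes "blockwise F" and F: "\<And>n. bilipschitz L (F n)"
  shows "bilipschitz (L\<^sup>2) (glue F)"
proof -
  have L: "L \<ge> 1" using F bilipschitzD(1) by blast
  have inj: "inj (F n)" for n using F bilipschitzD(2) bij_is_inj by blast
  have two: "\<exists>g. bilipschitz (L\<^sup>2) g \<and> glue F x = g x \<and> glue F y = g y" for x y
  proof -
    obtain m where m: "\<And>k. k \<noteq> m \<Longrightarrow> F k x = x"
      using blockwise_fixed[OF assms(1)] blockwise_fixed_outside[OF assms(1)] by metis
    obtain n where n: "\<And>k. k \<noteq> n \<Longrightarrow> F k y = y"
      using blockwise_fixed[OF assms(1)] blockwise_fixed_outside[OF assms(1)] by metis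
    show ?thesis
    proof (cases "m = n")
      case True
      have "bilipschitz (L\<^sup>2) (F m)" using L by (intro bilipschitz_mono[OF F]) (simp add: self_le_power)
      then show ?thesis using True m n glue_eq[of m F x] glue_eq[of n F y] by blast
    next
      case False
      have "bilipschitz (L\<^sup>2) (F m \<circ> F n)"
        using bilipschitz_comp[OF F F] by (simp add: power2_eq_square)
      moreover have "glue F x = (F m \<circ> F n) x" using False m by (simp add: glue_eq[of m F x])
      moreover have "glue F y = (F m \<circ> F n) y"
      proof -
        have "F m (F n y) = F n y"
        proof (cases "y \<in> block n")
          case True
          then show ?thesis
            using blockwise_fixed[OF assms(1) _ False] blockwise_invariant[OF assms(1) inj] by blast
        next
          case F: False
          then show ?thesis using n False blockwise_fixed_outside[OF assms(1) F] by auto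
        qed
        then show ?thesis using n by (simp add: glue_eq[of n F y])
      qed
      ultimately show ?thesis by blast
    qed
  qed
  have "surj (glue F)"
  proof (rule surj_if_solvable)
    fix y
    show "\<exists>x. glue F x = y"
    proof (cases "\<exists>n. y \<in> block n")
      case True
      then obtain n where n: "y \<in> block n" by blast
      obtain x where x: "F n x = y" using F unfolding bilipschitz_def by (metis surjD)
      with n have "x \<in> block n" using blockwise_invariant[OF assms(1) inj] by blast
      then show ?thesis using glue_block[OF assms(1)] x by blast
    next
      case False
      then show ?thesis using glue_outside[OF assms(1)] by blast
    qed
  qed
  moreover have "1 \<le> L\<^sup>2" using L by (simp add: one_le_power)
  ultimately show ?thesis using two unfolding bilipschitz_def by metis
qed

lemma blockwise_comp:
  assumes "blockwise F" "blockwise G" "\<And>n. inj (G n)"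
  shows "blockwise (\<lambda>n. F n \<circ> G n)"
  using assms unfolding blockwise_def comp_def by metis

lemma glue_comp:
  assumes F: "blockwise F" and G: "blockwise G" "\<And>n. inj (G n)"
  shows "glue (\<lambda>n. F n \<circ> G n) = glue F \<circ> glue G"
proof
  fix x
  show "glue (\<lambda>n. F n \<circ> G n) x = (glue F \<circ> glue G) x"
  proof (cases "\<exists>n. x \<in> block n")
    case True
    then obtain n where n: "x \<in> block n" by blast
    then have "G n x \<in> block n" using blockwise_invariant[OF G] by blast
    then show ?thesis using n by (simp add: glue_block blockwise_comp assms)
  next
    case False
    then show ?thesis by (simp add: glue_outside blockwise_comp assms)
  qed
qed

text \<open>Both maps preserve the blocks, so they can differ only inside the first \<open>N\<close> blocks, and there at
  most by the length of a block.\<close>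

lemma glue_eventually_equal:
  assumes F: "blockwise F" "\<And>n. inj (F n)" and G: "blockwise G" "\<And>n. inj (G n)"
    and eq: "\<And>n. n \<ge> N \<Longrightarrow> F n = G n"
  shows "dist (glue F x) (glue G x) \<le> 2 * 4 ^ N"
proof (cases "\<exists>n. x \<in> block n")
  case True
  then obtain n where n: "x \<in> block n" by blast
  show ?thesis
  proof (cases "n \<ge> N")
    case True
    then show ?thesis using n eq by (simp add: glue_block F G)
  next
    case False
    then have "(4::real) ^ n \<le> 4 ^ N" by simp
    moreover have "F n x \<in> block n" "G n x \<in> block n"
      using n blockwise_invariant F G by blast+
    ultimately show ?thesis
      using n unfolding glue_block[OF F(1) n] glue_block[OF G(1) n] block_def dist_real_def mem_Collect_eq
      by linarith
  qed
next
  case False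
  then show ?thesis by (simp add: glue_outside F G)
qed

definition rescale :: "real \<Rightarrow> nat \<Rightarrow> (real \<Rightarrow> real) \<Rightarrow> real \<Rightarrow> real" where
  "rescale s n f x = 3 * 4 ^ n + s * f ((x - 3 * 4 ^ n) / s)"

lemma rescale_at: "s \<noteq> 0 \<Longrightarrow> rescale s n f (3 * 4 ^ n + s * y) = 3 * 4 ^ n + s * f y"
  by (simp add: rescale_def)

lemma rescale_comp: "s \<noteq> 0 \<Longrightarrow> rescale s n (f \<circ> g) = rescale s n f \<circ> rescale s n g"
  by (auto simp: rescale_def)

lemma rescale_moves:
  assumes "s > 0" "\<And>y. f y \<noteq> y \<Longrightarrow> \<bar>s * y\<bar> < 4 ^ n" "rescale s n f x \<noteq> x"
  shows "x \<in> block n"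
proof -
  let ?y = "(x - 3 * 4 ^ n) / s"
  have "f ?y \<noteq> ?y" using assms(1,3) by (auto simp: rescale_def)
  from assms(2)[OF this] show ?thesis using assms(1) by (simp add: block_def)
qed

lemma bilipschitz_rescale:
  assumes s: "s > 0" and f: "bilipschitz L f"
  shows "bilipschitz L (rescale s n f)"
proof -
  let ?a = "\<lambda>x. (x - 3 * 4 ^ n) / s"
  have 1: "dist (rescale s n f x) (rescale s n f y) = s * dist (f (?a x)) (f (?a y))" for x y
    using s by (simp add: rescale_def dist_real_def abs_mult flip: right_diff_distrib)
  have 2: "dist x y = s * dist (?a x) (?a y)" for x y
    using s by (simp add: dist_real_def abs_mult flip: diff_divide_distrib)
  have "dist (rescale s n f x) (rescale s n f y) \<le> L * dist x y \<and>
        dist x y \<le> L * dist (rescale s n f x) (rescale s n f y)" for x y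
    unfolding 1 2[of x y] using bilipschitzD(3,4)[OF f, of "?a x" "?a y"] s
    by (simp add: mult.left_commute)
  moreover have "surj (rescale s n f)"
  proof (rule surj_if_solvable)
    fix v
    obtain y where "f y = (v - 3 * 4 ^ n) / s" using f unfolding bilipschitz_def by (metis surjD)
    then have "rescale s n f (3 * 4 ^ n + s * y) = v" using s by (simp add: rescale_at)
    then show "\<exists>x. rescale s n f x = v" by blast
  qed
  ultimately show ?thesis using bilipschitzD(1)[OF f] by (simp add: bilipschitz_def)
qed


section \<open>Compactly supported bi-Lipschitz homeomorphisms\<close>

definition BL_compact :: "(real \<Rightarrow> real) set" where
  "BL_compact = {f. (\<exists>L. bilipschitz L f) \<and> (\<exists>R. \<forall>x. f x \<noteq> x \<longrightarrow> \<bar>x\<bar> < R)}"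

lemma BL_compact_bij: "f \<in> BL_compact \<Longrightarrow> bij f"
  using bilipschitzD(2) by (auto simp: BL_compact_def)

lemma BL_compact_id: "id \<in> BL_compact"
  using bilipschitz_id by (auto simp: BL_compact_def)

lemma BL_compact_comp:
  assumes "f \<in> BL_compact" "g \<in> BL_compact"
  shows "f \<circ> g \<in> BL_compact"
proof -
  obtain R S where R: "\<And>x. f x \<noteq> x \<Longrightarrow> \<bar>x\<bar> < R" and S: "\<And>x. g x \<noteq> x \<Longrightarrow> \<bar>x\<bar> < S"
    using assms unfolding BL_compact_def by blast
  have "\<bar>x\<bar> < max R S" if "(f \<circ> g) x \<noteq> x" for x
    using R[of x] S[of x] that by (cases "g x = x") auto
  moreover have "\<exists>L. bilipschitz L (f \<circ> g)"
    using assms bilipschitz_comp unfolding BL_compact_def by blast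
  ultimately show ?thesis unfolding BL_compact_def by blast
qed

lemma BL_compact_inv:
  assumes "f \<in> BL_compact"
  shows "finv f \<in> BL_compact"
proof -
  obtain R where R: "\<And>x. f x \<noteq> x \<Longrightarrow> \<bar>x\<bar> < R"
    using assms unfolding BL_compact_def by blast
  have "\<bar>x\<bar> < R" if "finv f x \<noteq> x" for x
    using R[of x] that BL_compact_bij[OF assms] by (metis bij_inv_eq_iff)
  moreover have "\<exists>L. bilipschitz L (finv f)"
    using assms bilipschitz_inv unfolding BL_compact_def by blast
  ultimately show ?thesis unfolding BL_compact_def by blast
qed

lemma group_BL_compact: "group (comp_group BL_compact)"
  by (intro comp_group_groupI BL_compact_id BL_compact_comp BL_compact_inv BL_compact_bij)

text \<open>A copy of \<open>f\<close> in every block that can hold it, on scales growing without bound so that a single moved point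
  is moved by larger and larger distances; the radii \<open>2 ^ n\<close> in the coordinate of the copy also
  grow, so that only finitely many blocks are too small for the support of \<open>f\<close>.\<close>

definition copies :: "(real \<Rightarrow> real) \<Rightarrow> nat \<Rightarrow> real \<Rightarrow> real" where
  "copies f n = (if \<forall>y. f y \<noteq> y \<longrightarrow> \<bar>y\<bar> < 2 ^ n then rescale (2 ^ n) n f else id)"

lemma blockwise_copies: "blockwise (copies f)"
proof -
  have "x \<in> block n" if "copies f n x \<noteq> x" for n x
  proof -
    have supp: "\<forall>y. f y \<noteq> y \<longrightarrow> \<bar>y\<bar> < 2 ^ n"
      using that by (auto simp: copies_def split: if_splits)
    then have "\<bar>2 ^ n * y\<bar> < 4 ^ n" if "f y \<noteq> y" for y
      using that by (simp add: abs_mult flip: power_mult_distrib)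
        (metis mult_less_cancel_left_pos num_double numeral_times_numeral power_mult_distrib zero_less_numeral zero_less_power)
    then show ?thesis
      using that supp rescale_moves[of "2 ^ n" f n x] by (simp add: copies_def)
  qed
  then show ?thesis by (simp add: blockwise_def)
qed

lemma bilipschitz_copies: "bilipschitz L f \<Longrightarrow> bilipschitz L (copies f n)"
  using bilipschitzD(1) by (auto simp: copies_def intro: bilipschitz_rescale bilipschitz_id)

lemma inj_copies: "f \<in> BL_compact \<Longrightarrow> inj (copies f n)"
  unfolding BL_compact_def using bilipschitz_copies bilipschitzD(2) bij_is_inj by blast

lemma copies_eventually:
  assumes "f \<in> BL_compact"
  obtains N where "\<And>n. n \<ge> N \<Longrightarrow> copies f n = rescale (2 ^ n) n f"
proof -
  obtain R where R: "\<And>x. f x \<noteq> x \<Longrightarrow> \<bar>x\<bar> < R"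
    using assms unfolding BL_compact_def by blast
  obtain N where N: "R < 2 ^ N" using real_arch_pow[of 2 R] by auto
  have "copies f n = rescale (2 ^ n) n f" if "n \<ge> N" for n
  proof -
    have "(2::real) ^ N \<le> 2 ^ n" using that by simp
    then have "\<forall>y. f y \<noteq> y \<longrightarrow> \<bar>y\<bar> < 2 ^ n" using R N by (meson less_trans less_le_trans)
    then show ?thesis by (simp add: copies_def)
  qed
  then show ?thesis using that by blast
qed

text \<open>The copies of \<open>f \<circ> g\<close> are the compositions of the copies of \<open>f\<close> and of \<open>g\<close> in all but finitely
  many blocks, which is why the representation is multiplicative up to bounded error.\<close>

lemma embeds_in_QI_if_BL_compact:
  assumes \<Gamma>: "\<Gamma> \<subseteq> BL_compact" and "group (comp_group \<Gamma>)"
  shows "embeds_in (comp_group \<Gamma>) (QI :: (real \<Rightarrow> real) set monoid)"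
proof (rule embeds_in_QI_by_representatives[where \<phi> = "\<lambda>f. glue (copies f)"])
  have qi: "quasi_isometry (glue (copies f))" if "f \<in> BL_compact" for f
    using that blockwise_copies bilipschitz_copies bilipschitz_glue bilipschitz_quasi_isometry
    unfolding BL_compact_def by blast
  then show "quasi_isometry (glue (copies f))" if "f \<in> carrier (comp_group \<Gamma>)" for f
    using that \<Gamma> by (auto simp: comp_group_def)
  show "(glue (copies (f \<otimes>\<^bsub>comp_group \<Gamma>\<^esub> g)), glue (copies f) \<circ> glue (copies g)) \<in> qi_rel"
    if "f \<in> carrier (comp_group \<Gamma>)" "g \<in> carrier (comp_group \<Gamma>)" for f g
  proof -
    have f: "f \<in> BL_compact" and g: "g \<in> BL_compact"
      using that \<Gamma> by (auto simp: comp_group_def)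
    have fg: "f \<circ> g \<in> BL_compact" using f g by (rule BL_compact_comp)
    obtain N1 where N1: "\<And>n. n \<ge> N1 \<Longrightarrow> copies f n = rescale (2 ^ n) n f"
      by (rule copies_eventually[OF f]) (rule that)
    obtain N2 where N2: "\<And>n. n \<ge> N2 \<Longrightarrow> copies g n = rescale (2 ^ n) n g"
      by (rule copies_eventually[OF g]) (rule that)
    obtain N3 where N3: "\<And>n. n \<ge> N3 \<Longrightarrow> copies (f \<circ> g) n = rescale (2 ^ n) n (f \<circ> g)"
      by (rule copies_eventually[OF fg]) (rule that)
    let ?N = "max N1 (max N2 N3)"
    have "dist (glue (copies (f \<circ> g)) x) (glue (\<lambda>n. copies f n \<circ> copies g n) x) \<le> 2 * 4 ^ ?N" for x
    proof (rule glue_eventually_equal)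
      show "copies (f \<circ> g) n = copies f n \<circ> copies g n" if "?N \<le> n" for n
        using that by (simp add: N1 N2 N3 rescale_comp)
      show "inj (copies f n \<circ> copies g n)" for n
        by (intro inj_compose inj_copies f g)
    qed (intro blockwise_comp blockwise_copies inj_copies f g fg)+
    then show ?thesis
      using qi f g fg unfolding qi_rel_def
      by (auto simp: comp_group_def glue_comp blockwise_copies inj_copies intro!: quasi_isometry_comp)
  qed
  show "f = \<one>\<^bsub>comp_group \<Gamma>\<^esub>" 
    if "f \<in> carrier (comp_group \<Gamma>)" and near: "(glue (copies f), id) \<in> qi_rel" for f
  proof (rule ccontr)
    assume "f \<noteq> \<one>\<^bsub>comp_group \<Gamma>\<^esub>"
    then obtain y where y: "f y \<noteq> y" by (force simp: comp_group_def)
    have f: "f \<in> BL_compact" using that \<Gamma> by (auto simp: comp_group_def)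
    obtain N where N: "\<And>n. n \<ge> N \<Longrightarrow> copies f n = rescale (2 ^ n) n f"
      by (rule copies_eventually[OF f]) (rule that)
    obtain M where M: "\<And>x. dist (glue (copies f) x) x \<le> M"
      using near by (auto simp: qi_rel_def)
    have "2 ^ n * \<bar>f y - y\<bar> \<le> M" if "n \<ge> N" for n
    proof -
      let ?x = "3 * 4 ^ n + 2 ^ n * y"
      have v: "copies f n ?x = 3 * 4 ^ n + 2 ^ n * f y" using N[OF that] by (simp add: rescale_at)
      with y have "copies f n ?x \<noteq> ?x" by simp
      then have "?x \<in> block n" using blockwise_copies unfolding blockwise_def by blast
      then have "glue (copies f) ?x = 3 * 4 ^ n + 2 ^ n * f y"
        using v by (simp add: glue_block blockwise_copies)
      then show ?thesis
        using M[of ?x] by (simp add: dist_real_def abs_mult flip: right_diff_distrib)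
    qed
    moreover obtain n where "M / \<bar>f y - y\<bar> < 2 ^ n" using real_arch_pow[of 2] by auto
    moreover have "(2::real) ^ n \<le> 2 ^ max n N" by (rule power_increasing) auto
    ultimately have "M / \<bar>f y - y\<bar> < 2 ^ max n N" "2 ^ max n N * \<bar>f y - y\<bar> \<le> M"
      by (meson less_le_trans max.cobounded2)+
    then show False using y by (simp add: divide_less_eq)
  qed
qed fact


text \<open>With \<open>c x\<close> the nearest point to \<open>x\<close> in \<open>[-R, R]\<close>, we have \<open>f x = f (c x) + (x - c x)\<close>.\<close>

lemma compactly_supported_lipschitz:
  fixes f :: "real \<Rightarrow> real"
  assumes R: "\<And>x. f x \<noteq> x \<Longrightarrow> \<bar>x\<bar> < R" "0 \<le> R" and L: "L-lipschitz_on {- R..R} f"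
  shows "\<bar>f x - f y\<bar> \<le> (L + 1) * \<bar>x - y\<bar>"
proof -
  define c where "c x = max (- R) (min x R)" for x
  have c: "c x \<in> {- R..R}" "\<bar>c x - c y\<bar> \<le> \<bar>x - y\<bar>" "\<bar>(x - c x) - (y - c y)\<bar> \<le> \<bar>x - y\<bar>" for x y
    using R(2) by (auto simp: c_def)
  have f: "f x = f (c x) + (x - c x)" for x
  proof (cases "\<bar>x\<bar> < R")
    case True
    then show ?thesis by (simp add: c_def abs_less_iff)
  next
    case False
    moreover have "\<not> \<bar>c x\<bar> < R" using False R(2) by (auto simp: c_def)
    ultimately have "f x = x" "f (c x) = c x" using R(1) by blast+
    then show ?thesis by simp
  qed
  have "\<bar>f (c x) - f (c y)\<bar> \<le> L * \<bar>c x - c y\<bar>"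
    using lipschitz_onD[OF L c(1) c(1)] by (simp add: dist_real_def)
  also have "\<dots> \<le> L * \<bar>x - y\<bar>" using c(2) lipschitz_on_nonneg[OF L] by (rule mult_left_mono)
  finally show ?thesis using c(3)[of x y] f[of x] f[of y] by (simp add: distrib_right)
qed

lemma PL_kappa_inv:
  assumes "f \<in> PL_kappa"
  shows "finv f \<in> PL_kappa"
proof -
  have f: "real_homeo f" "piecewise_linear f" "compact (closure {x. f x \<noteq> x})" "bij f"
    using assms real_homeo_bij by (auto simp: PL_kappa_def)
  have "{x. finv f x \<noteq> x} = {x. f x \<noteq> x}" using f(4) by (metis bij_inv_eq_iff)
  then show ?thesis using f by (simp add: PL_kappa_def real_homeo_inv piecewise_linear_inv)
qed

lemma group_PL_kappa: "group (comp_group PL_kappa)"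
proof (rule comp_group_groupI[OF _ _ PL_kappa_inv])
  show "id \<in> PL_kappa" by (simp add: PL_kappa_def real_homeo_id piecewise_linear_id)
  show "f \<circ> g \<in> PL_kappa" if "f \<in> PL_kappa" "g \<in> PL_kappa" for f g
  proof -
    have "{x. (f \<circ> g) x \<noteq> x} \<subseteq> {x. f x \<noteq> x} \<union> {x. g x \<noteq> x}" by auto
    moreover have "bounded ({x. f x \<noteq> x} \<union> {x. g x \<noteq> x})"
      using that by (auto simp: PL_kappa_def)
    ultimately have "bounded {x. (f \<circ> g) x \<noteq> x}" using bounded_subset by blast
    then show ?thesis
      using that by (simp add: PL_kappa_def real_homeo_comp piecewise_linear_comp)
  qed
qed (use real_homeo_bij in \<open>auto simp: PL_kappa_def\<close>)

lemma PL_kappa_BL_compact: "PL_kappa \<subseteq> BL_compact"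
proof
  have support: "\<exists>R\<ge>0. \<forall>x. f x \<noteq> x \<longrightarrow> \<bar>x\<bar> < R" if "f \<in> PL_kappa" for f
  proof -
    have "bounded {x. f x \<noteq> x}" using that by (simp add: PL_kappa_def)
    then obtain R where "R > 0" "\<And>x. f x \<noteq> x \<Longrightarrow> \<bar>x\<bar> < R" by (auto simp: bounded_pos_less)
    then show ?thesis by (intro exI[of _ R]) auto
  qed
  have lip: "\<exists>L\<ge>1. \<forall>x y. \<bar>f x - f y\<bar> \<le> L * \<bar>x - y\<bar>" if f: "f \<in> PL_kappa" for f
  proof -
    obtain R where R: "R \<ge> 0" "\<And>x. f x \<noteq> x \<Longrightarrow> \<bar>x\<bar> < R" using support[OF f] by blast
    have "locally_linear f" using f by (simp add: PL_kappa_def piecewise_linear_iff_locally_linear)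
    then obtain L where L: "L-lipschitz_on {- R..R} f" by (rule locally_linear_lipschitz_on)
    have "\<forall>x y. \<bar>f x - f y\<bar> \<le> (L + 1) * \<bar>x - y\<bar>"
      using compactly_supported_lipschitz[OF R(2) R(1) L] by blast
    then show ?thesis using lipschitz_on_nonneg[OF L] by (intro exI[of _ "L + 1"]) auto
  qed
  fix f assume f: "f \<in> PL_kappa"
  then have b: "bij f" by (simp add: PL_kappa_def real_homeo_bij)
  obtain L where L: "L \<ge> 1" "\<And>x y. \<bar>f x - f y\<bar> \<le> L * \<bar>x - y\<bar>" using lip[OF f] by blast
  obtain M where M: "M \<ge> 1" "\<And>x y. \<bar>finv f x - finv f y\<bar> \<le> M * \<bar>x - y\<bar>"
    using lip[OF PL_kappa_inv[OF f]] by blast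
  have "bilipschitz (max L M) f"
    unfolding bilipschitz_def
  proof (intro conjI allI)
    show "1 \<le> max L M" using L(1) by simp
    show "surj f" using b by (rule bij_is_surj)
    show "dist (f x) (f y) \<le> max L M * dist x y" for x y
      unfolding dist_real_def by (rule order_trans[OF L(2) mult_right_mono]) auto
    show "dist x y \<le> max L M * dist (f x) (f y)" for x y
      using M(2)[of "f x" "f y"] unfolding dist_real_def inv_f_f[OF bij_is_inj[OF b]]
      by (rule order_trans[OF _ mult_right_mono]) auto
  qed
  then show "f \<in> BL_compact" using support[OF f] by (auto simp: BL_compact_def)
qed


section \<open>Homomorphisms from free groups\<close>

definition word_value :: "('b, 'c) monoid_scheme \<Rightarrow> ('a \<Rightarrow> 'b) \<Rightarrow> 'a fg_word \<Rightarrow> 'b" where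
  "word_value K a w = foldr (\<lambda>(x, b) y. (if b then a x else inv\<^bsub>K\<^esub> (a x)) \<otimes>\<^bsub>K\<^esub> y) w \<one>\<^bsub>K\<^esub>"

lemma word_value_Nil [simp]: "word_value K a [] = \<one>\<^bsub>K\<^esub>"
  by (simp add: word_value_def)

lemma word_value_Cons [simp]:
  "word_value K a ((x, b) # w) = (if b then a x else inv\<^bsub>K\<^esub> (a x)) \<otimes>\<^bsub>K\<^esub> word_value K a w"
  by (simp add: word_value_def)

lemma (in group) word_value_closed:
  "(\<And>x. x \<in> S \<Longrightarrow> a x \<in> carrier G) \<Longrightarrow> w \<in> lists (S \<times> UNIV) \<Longrightarrow> word_value G a w \<in> carrier G"
  by (induction w) auto

lemma (in group) word_value_append:
  assumes "\<And>x. x \<in> S \<Longrightarrow> a x \<in> carrier G" "u \<in> lists (S \<times> UNIV)" "v \<in> lists (S \<times> UNIV)"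
  shows "word_value G a (u @ v) = word_value G a u \<otimes> word_value G a v"
  using assms(2)
proof (induction u)
  case Nil
  then show ?case using word_value_closed[OF assms(1) assms(3)] by simp
next
  case (Cons p u)
  then show ?case
    using assms word_value_closed[of S a] by (cases p) (auto simp: m_assoc)
qed

lemma (in group) word_value_free_rel:
  assumes a: "\<And>x. x \<in> S \<Longrightarrow> a x \<in> carrier G" and "(v, w) \<in> free_rel S"
  shows "word_value G a v = word_value G a w"
  using assms(2)
proof (induction rule: free_rel.induct)
  case (cancel u v x b)
  have "word_value G a ([(x, b), (x, \<not> b)] @ v) = word_value G a v"
    using a[OF cancel(3)] word_value_closed[OF a cancel(2)]
    by (cases b) (simp_all flip: m_assoc)
  then show ?case
    using cancel by (simp add: word_value_append[OF a] del: append_Cons append_Nil)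
qed auto

lemma free_group_class_Cons:
  assumes "x \<in> S" "w \<in> lists (S \<times> UNIV)"
  shows "free_rel S `` {(x, b) # w}
    = (if b then free_gen S x else inv\<^bsub>free_group S\<^esub> free_gen S x) \<otimes>\<^bsub>free_group S\<^esub> free_rel S `` {w}"
proof -
  interpret group "free_group S" by (rule group_free_group)
  have one: "\<one>\<^bsub>free_group S\<^esub> = free_rel S `` {[]}" by (simp add: free_group_def)
  have l: "[(x, c)] \<in> lists (S \<times> UNIV)" for c :: bool using assms by simp
  have cl: "free_rel S `` {[(x, c)]} \<in> carrier (free_group S)" for c
    using l by (auto simp: free_group_def intro!: quotientI)
  have "free_rel S `` {[(x, False)]} \<otimes>\<^bsub>free_group S\<^esub> free_gen S x = \<one>\<^bsub>free_group S\<^esub>"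
    unfolding free_gen_def free_mult_class[OF l l] one
    using free_rel.cancel[of "[]" S "[]" x False] assms(1)
    by (intro equiv_class_eq[OF equiv_free_rel]) simp
  then have "inv\<^bsub>free_group S\<^esub> free_gen S x = free_rel S `` {[(x, False)]}"
    using cl by (intro inv_equality) (auto simp: free_gen_def)
  then show ?thesis
    using free_mult_class[OF l assms(2), of b] by (cases b) (auto simp: free_gen_def)
qed

lemma free_group_classE:
  assumes "A \<in> carrier (free_group S)"
  obtains w where "w \<in> lists (S \<times> UNIV)" "A = free_rel S `` {w}"
  using assms by (auto simp: free_group_def elim!: quotientE)

lemma (in group) free_group_hom_exists:
  assumes a: "\<And>x. x \<in> S \<Longrightarrow> a x \<in> carrier G"
  obtains h where "h \<in> hom (free_group S) G"
    "\<And>w. w \<in> lists (S \<times> UNIV) \<Longrightarrow> h (free_rel S `` {w}) = word_value G a w"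
proof -
  define h where "h A = word_value G a (SOME w. w \<in> A)" for A
  have h: "h (free_rel S `` {w}) = word_value G a w" if w: "w \<in> lists (S \<times> UNIV)" for w
  proof -
    have "w \<in> free_rel S `` {w}" using free_rel.refl[OF w] by simp
    then have "(SOME v. v \<in> free_rel S `` {w}) \<in> free_rel S `` {w}" by (rule someI)
    then show ?thesis using word_value_free_rel[of S a, OF a] unfolding h_def Image_singleton_iff by metis
  qed
  have "h \<in> hom (free_group S) G"
  proof (rule homI)
    show "h A \<in> carrier G" if "A \<in> carrier (free_group S)" for A
      using that h word_value_closed[of S a, OF a] by (metis free_group_classE)
    show "h (A \<otimes>\<^bsub>free_group S\<^esub> B) = h A \<otimes> h B"
      if AB: "A \<in> carrier (free_group S)" "B \<in> carrier (free_group S)" for A B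
    proof -
      obtain u v where "u \<in> lists (S \<times> UNIV)" "A = free_rel S `` {u}"
          "v \<in> lists (S \<times> UNIV)" "B = free_rel S `` {v}"
        using AB by (metis free_group_classE)
      moreover from this have "u @ v \<in> lists (S \<times> UNIV)" by auto
      ultimately show ?thesis
        by (simp only: free_mult_class h word_value_append[OF a])
    qed
  qed
  with h show ?thesis using that by blast
qed


section \<open>Thompson's group\<close>

text \<open>The consequences of the relations of \<open>F\<close> are needed twice: in \<open>F\<close> itself, and in the group of
  homeomorphisms that it acts by.\<close>

locale thompson_generators = group Q for Q (structure) +
  fixes g :: "nat \<Rightarrow> 'a"
  assumes g_closed [simp]: "g i \<in> carrier Q"
    and g_rel: "i < j \<Longrightarrow> g i \<otimes> g j = g (j + 1) \<otimes> g i"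
begin

definition pos :: "nat list \<Rightarrow> 'a" where
  "pos P = foldr (\<lambda>i y. g i \<otimes> y) P \<one>"

lemma pos_Nil [simp]: "pos [] = \<one>"
  by (simp add: pos_def)

lemma pos_Cons [simp]: "pos (i # P) = g i \<otimes> pos P"
  by (simp add: pos_def)

lemma pos_closed [simp]: "pos P \<in> carrier Q"
  by (induction P) auto

lemma pos_append: "pos (P @ R) = pos P \<otimes> pos R"
  by (induction P) (auto simp: m_assoc)

text \<open>The relations \<open>g i \<otimes> g j = g (j + 1) \<otimes> g i\<close> for \<open>i < j\<close> push a small index to the right.\<close>

lemma pos_insert:
  "sorted_wrt (\<ge>) P \<Longrightarrow> \<exists>R. sorted_wrt (\<ge>) R \<and> (\<forall>k\<in>set R. k \<le> i \<or> (\<exists>j\<in>set P. k \<le> j + 1))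
    \<and> g i \<otimes> pos P = pos R"
proof (induction P)
  case Nil
  then show ?case by (intro exI[of _ "[i]"]) simp
next
  case (Cons j P)
  show ?case
  proof (cases "i < j")
    case True
    from Cons obtain R where R: "sorted_wrt (\<ge>) R" "g i \<otimes> pos P = pos R"
      "\<forall>k\<in>set R. k \<le> i \<or> (\<exists>j\<in>set P. k \<le> j + 1)" by auto
    have "g i \<otimes> pos (j # P) = g (j + 1) \<otimes> (g i \<otimes> pos P)"
      using g_rel[OF True] by (simp flip: m_assoc)
    then have "g i \<otimes> pos (j # P) = pos ((j + 1) # R)" using R(2) by simp
    moreover have "\<forall>k\<in>set R. k \<le> j + 1" using R(3) True Cons.prems by fastforce
    ultimately show ?thesis
      using R True by (intro exI[of _ "(j + 1) # R"]) auto
  next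
    case False
    then show ?thesis using Cons.prems by (intro exI[of _ "i # j # P"]) auto
  qed
qed

lemma pos_sorted: "\<exists>R. sorted_wrt (\<ge>) R \<and> pos P = pos R"
proof (induction P)
  case Nil
  then show ?case by (intro exI[of _ "[]"]) simp
next
  case (Cons i P)
  then show ?case using pos_insert[of _ i] by (metis pos_Cons)
qed

text \<open>A generator moves past the inverse of a generator, at the cost of changing one index.\<close>

lemma g_inv_g:
  obtains "i = p"
  | k where "g i \<otimes> inv (g p) = inv (g p) \<otimes> g k"
  | k where "g i \<otimes> inv (g p) = inv (g k) \<otimes> g i"
proof (cases i p rule: linorder_cases)
  case less
  have "g (p + 1) \<otimes> (g i \<otimes> inv (g p)) = (g i \<otimes> g p) \<otimes> inv (g p)"
    using g_rel[OF less] by (simp add: m_assoc)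
  also have "\<dots> = g i" by (simp add: m_assoc)
  finally have "g i \<otimes> inv (g p) = inv (g (p + 1)) \<otimes> g i"
    using inv_solve_left by (metis g_closed inv_closed m_closed)
  then show ?thesis using that by blast
next
  case equal
  then show ?thesis using that by blast
next
  case greater
  have "g p \<otimes> (g i \<otimes> inv (g p)) = (g p \<otimes> g i) \<otimes> inv (g p)"
    by (simp add: m_assoc)
  also have "\<dots> = g (i + 1)" unfolding g_rel[OF greater] by (simp add: m_assoc)
  finally have "g i \<otimes> inv (g p) = inv (g p) \<otimes> g (i + 1)"
    using inv_solve_left by (metis g_closed inv_closed m_closed)
  then show ?thesis using that by blast
qed

lemma g_inv_pos: "\<exists>R I. g i \<otimes> inv (pos P) = inv (pos R) \<otimes> pos I"
proof (induction P arbitrary: i rule: rev_induct)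
  case Nil
  then show ?case by (intro exI[of _ "[]"] exI[of _ "[i]"]) simp
next
  case (snoc p P)
  have e: "g i \<otimes> inv (pos (P @ [p])) = (g i \<otimes> inv (g p)) \<otimes> inv (pos P)"
    by (simp add: pos_append inv_mult_group m_assoc)
  have q: "inv (g k) \<otimes> (inv (pos R) \<otimes> pos I) = inv (pos (R @ [k])) \<otimes> pos I" for k R I
    by (simp add: pos_append inv_mult_group m_assoc)
  consider "i = p" | k where "g i \<otimes> inv (g p) = inv (g p) \<otimes> g k"
    | k where "g i \<otimes> inv (g p) = inv (g k) \<otimes> g i"
    by (rule g_inv_g)
  then show ?case
  proof cases
    case 1
    then show ?thesis unfolding e by (intro exI[of _ P] exI[of _ "[]"]) simp
  next
    case (2 k)
    then show ?thesis unfolding e using snoc[of k] q[of p] by (metis g_closed inv_closed m_assoc pos_closed)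
  next
    case (3 k)
    then show ?thesis unfolding e using snoc[of i] q[of k] by (metis g_closed inv_closed m_assoc pos_closed)
  qed
qed

text \<open>Hence the elements \<open>inv (pos P) \<otimes> pos R\<close> are all the elements that the \<open>g i\<close> generate, and
  \<open>P\<close> and \<open>R\<close> can be taken nonincreasing.\<close>

lemma fraction_form:
  "\<exists>P R. sorted_wrt (\<ge>) P \<and> sorted_wrt (\<ge>) R \<and> word_value Q g w = inv (pos P) \<otimes> pos R"
proof -
  have "\<exists>P R. word_value Q g w = inv (pos P) \<otimes> pos R"
  proof (induction w)
    case Nil
    then show ?case by (intro exI[of _ "[]"]) simp
  next
    case (Cons a w)
    obtain i b where a: "a = (i, b)" by (cases a)
    obtain P R where w: "word_value Q g w = inv (pos P) \<otimes> pos R" using Cons by blast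
    show ?case
    proof (cases b)
      case True
      obtain P' I where "g i \<otimes> inv (pos P) = inv (pos P') \<otimes> pos I" using g_inv_pos by blast
      then have "word_value Q g (a # w) = inv (pos P') \<otimes> pos (I @ R)"
        using True by (simp add: a w pos_append flip: m_assoc)
      then show ?thesis by blast
    next
      case False
      have "word_value Q g (a # w) = inv (pos (P @ [i])) \<otimes> pos R"
        using False by (simp add: a w pos_append inv_mult_group m_assoc)
      then show ?thesis by blast
    qed
  qed
  then show ?thesis using pos_sorted by metis
qed

end

text \<open>A faithful action of \<open>F\<close> on \<open>[0, 1]\<close> arises as follows. The map \<open>shrink c\<close> is supported on \<open>[0, c]\<close> and halves
  \<open>[0, c/2]\<close>, so that \<open>shrink (2\<^sup>-\<^sup>i)\<close> conjugates \<open>shrink (2\<^sup>-\<^sup>j)\<close> to \<open>shrink (2\<^sup>-\<^sup>j\<^sup>-\<^sup>1)\<close> for \<open>i < j\<close>.\<close>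

definition shrink :: "real \<Rightarrow> real \<Rightarrow> real" where
  "shrink c u = min u (max (u / 2) (3 * u / 2 - c / 2))"

lemma shrink_le: "shrink c u \<le> u"
  by (simp add: shrink_def)

lemma shrink_fixed: "c \<le> u \<Longrightarrow> shrink c u = u"
  by (simp add: shrink_def min_def max_def)

lemma shrink_less: "0 < u \<Longrightarrow> u < c \<Longrightarrow> shrink c u < u"
  by (simp add: shrink_def min_def max_def)

lemma shrink_relation:
  assumes "0 < c" "c \<le> b / 2"
  shows "shrink b (shrink c u) = shrink (c / 2) (shrink b u)"
proof -
  have half: "shrink b x = min x (x / 2)" if "x \<le> b / 2" for x
    using that by (simp add: shrink_def min_def max_def)
  consider "b / 2 \<le> u" | "0 \<le> u" "u < b / 2" | "u < 0" by linarith
  then show ?thesis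
  proof cases
    case 1
    have "c / 2 \<le> shrink b u" using 1 assms by (simp add: shrink_def min_def max_def)
    then show ?thesis using 1 assms by (simp add: shrink_fixed)
  next
    case 2
    have "shrink c u \<le> b / 2" using shrink_le[of c u] 2 by linarith
    moreover have "0 \<le> shrink c u" using 2 by (simp add: shrink_def)
    ultimately have l: "shrink b (shrink c u) = shrink c u / 2"
      using half[of "shrink c u"] by simp
    have r: "shrink b u = u / 2" using 2 half[of u] by simp
    show ?thesis unfolding l r by (simp add: shrink_def min_def max_def)
  next
    case 3
    have "shrink d u = u" if "0 < d" for d using 3 that by (simp add: shrink_def min_def max_def)
    then show ?thesis using assms by simp
  qed
qed

lemma shrink_BL_compact:
  assumes "c > 0"
  shows "shrink c \<in> BL_compact"
proof -
  have "bilipschitz 2 (shrink c)"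
    by (rule bilipschitz_from_slopes) (auto simp: shrink_def min_def max_def)
  moreover have "\<bar>x\<bar> < c" if "shrink c x \<noteq> x" for x
    using that assms by (auto simp: shrink_def min_def max_def split: if_splits)
  ultimately show ?thesis unfolding BL_compact_def by blast
qed

definition thompson_map :: "nat \<Rightarrow> real \<Rightarrow> real" where
  "thompson_map i u = shrink ((1 / 2) ^ i) u"

lemma thompson_map_BL_compact: "thompson_map i \<in> BL_compact"
  using shrink_BL_compact[of "(1 / 2) ^ i"] by (simp add: thompson_map_def[abs_def])

interpretation thompson_maps: thompson_generators "comp_group BL_compact" thompson_map
proof -
  interpret group "comp_group BL_compact" by (rule group_BL_compact)
  show "thompson_generators (comp_group BL_compact) thompson_map"
  proof
    show "thompson_map i \<in> carrier (comp_group BL_compact)" for i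
      by (simp add: comp_group_def thompson_map_BL_compact)
    show "thompson_map i \<otimes>\<^bsub>comp_group BL_compact\<^esub> thompson_map j
        = thompson_map (j + 1) \<otimes>\<^bsub>comp_group BL_compact\<^esub> thompson_map i" if "i < j" for i j
    proof -
      have "(1 / 2 :: real) ^ j \<le> (1 / 2) ^ Suc i" using that by (intro power_decreasing) auto
      then have "shrink ((1 / 2) ^ i) (shrink ((1 / 2) ^ j) u)
          = shrink ((1 / 2) ^ (j + 1)) (shrink ((1 / 2) ^ i) u)" for u
        using shrink_relation[of "(1 / 2) ^ j" "(1 / 2) ^ i" u] by simp
      then show ?thesis by (auto simp: comp_group_def thompson_map_def)
    qed
  qed
qed

definition thompson_pos :: "nat list \<Rightarrow> real \<Rightarrow> real" where
  "thompson_pos P = thompson_maps.pos P"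

lemma thompson_pos_simps:
  "thompson_pos [] = id" "thompson_pos (i # P) = thompson_map i \<circ> thompson_pos P"
  "thompson_pos (P @ [i]) = thompson_pos P \<circ> thompson_map i"
  by (simp_all add: thompson_pos_def thompson_maps.pos_append) (simp_all add: comp_group_def)

lemma thompson_pos_le: "thompson_pos P u \<le> u"
proof (induction P)
  case (Cons i P)
  then show ?case
    using shrink_le[of "(1 / 2) ^ i" "thompson_pos P u"]
    by (simp add: thompson_pos_simps thompson_map_def)
qed (simp add: thompson_pos_simps)

lemma thompson_pos_fixed:
  "\<forall>i\<in>set P. m \<le> i \<Longrightarrow> (1 / 2) ^ m \<le> u \<Longrightarrow> thompson_pos P u = u"
proof (induction P)
  case (Cons i P)
  have "(1 / 2 :: real) ^ i \<le> (1 / 2) ^ m" using Cons.prems by (intro power_decreasing) auto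
  then have "thompson_map i u = u"
    unfolding thompson_map_def using Cons.prems(2) by (intro shrink_fixed) linarith
  then show ?case using Cons by (simp add: thompson_pos_simps)
qed (simp add: thompson_pos_simps)

text \<open>None of the maps moves a point to the right, so a point that one of them moves cannot come back.\<close>

lemma thompson_pos_moves:
  assumes "0 < u" "u < (1 / 2) ^ m"
  shows "thompson_pos (P @ [m]) u < u"
  using thompson_pos_le[of P "thompson_map m u"] shrink_less[OF assms]
  by (simp add: thompson_pos_simps thompson_map_def)

text \<open>The support of a nonincreasing product of the maps ends exactly at \<open>2\<^sup>-\<^sup>m\<close>, where \<open>m\<close> is its
  last index. So the last index can be read off from the map, and cancelled.\<close>

lemma thompson_pos_inj:
  "sorted_wrt (\<ge>) P \<Longrightarrow> sorted_wrt (\<ge>) R \<Longrightarrow> thompson_pos P = thompson_pos R \<Longrightarrow> P = R"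
proof (induction P arbitrary: R rule: rev_induct)
  case Nil
  show ?case
  proof (cases R rule: rev_cases)
    case (snoc R' m)
    then show ?thesis
      using fun_cong[OF Nil.prems(3), of "(1 / 2) ^ m / 2"] thompson_pos_moves[of "(1 / 2) ^ m / 2" m R']
      by (simp add: thompson_pos_simps(1))
  qed simp
next
  case (snoc m P)
  show ?case
  proof (cases R rule: rev_cases)
    case Nil
    then show ?thesis
      using fun_cong[OF snoc.prems(3), of "(1 / 2) ^ m / 2"] thompson_pos_moves[of "(1 / 2) ^ m / 2" m P]
      by (simp add: thompson_pos_simps(1))
  next
    case R: (snoc R' n)
    have le: "m \<le> n" if eq: "thompson_pos (P @ [m]) = thompson_pos (R @ [n])"
        and sorted: "sorted_wrt (\<ge>) (P @ [m])" for P R m n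
    proof (rule ccontr)
      assume "\<not> m \<le> n"
      then have "(1 / 2 :: real) ^ m < (1 / 2) ^ n" by (intro power_strict_decreasing) auto
      then have "thompson_pos (R @ [n]) ((1 / 2) ^ m) < (1 / 2) ^ m"
        by (intro thompson_pos_moves) auto
      moreover have "thompson_pos (P @ [m]) ((1 / 2) ^ m) = (1 / 2) ^ m"
        using sorted by (intro thompson_pos_fixed[of _ m]) (auto simp: sorted_wrt_append)
      ultimately show False using eq by simp
    qed
    have mn: "m = n"
      using le[of P m R' n] le[of R' n P m] snoc.prems R by simp
    have "surj (thompson_map m)"
      using BL_compact_bij thompson_map_BL_compact by (simp add: bij_is_surj)
    then have "thompson_pos P = thompson_pos R'"
      using snoc.prems(3) surj_fun_eq[of "thompson_map m" UNIV "thompson_pos P" "thompson_pos R'"]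
      unfolding R mn thompson_pos_simps by (simp add: fun_eq_iff)
    then show ?thesis
      using snoc.IH[of R'] snoc.prems R mn by (simp add: sorted_wrt_append)
  qed
qed


text \<open>The maps satisfy the relations of \<open>F\<close>; an element \<open>inv (pos P) \<otimes> pos R\<close> of \<open>F\<close> acting trivially
  has \<open>P\<close> and \<open>R\<close> with the same map, hence \<open>P = R\<close>, and is trivial.\<close>

lemma embeds_in_Thompson_F: "embeds_in Thompson_F (comp_group BL_compact)"
proof -
  let ?K = "comp_group BL_compact"
  define Fr where "Fr = free_group (UNIV :: nat set)"
  define N where "N = normal_closure Fr thompson_relators"
  define x :: "nat \<Rightarrow> nat fg_word set" where "x = free_gen UNIV"
  have TF: "Thompson_F = Fr Mod N"
    by (simp add: Thompson_F_def presented_group_def Fr_def N_def)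
  interpret Fr: group Fr unfolding Fr_def by (rule group_free_group)
  interpret TF: group "Fr Mod N" using group_Thompson_F by (simp add: TF)
  have rels: "thompson_relators
      = {x i \<otimes>\<^bsub>Fr\<^esub> x j \<otimes>\<^bsub>Fr\<^esub> inv\<^bsub>Fr\<^esub> (x i) \<otimes>\<^bsub>Fr\<^esub> inv\<^bsub>Fr\<^esub> (x (j + 1)) | i j. i < j}"
    by (simp add: thompson_relators_def Fr_def x_def Let_def)
  have x: "x i \<in> carrier Fr" for i
    by (auto simp: x_def Fr_def free_group_def free_gen_def intro!: quotientI)
  have "thompson_relators \<subseteq> carrier Fr" unfolding rels using x by auto
  then have N: "N \<lhd> Fr" unfolding N_def by (intro normal_normal_closure Fr.group_axioms)
  have rel_N: "thompson_relators \<subseteq> N" by (auto simp: N_def normal_closure_def)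
  obtain h where h: "h \<in> hom Fr ?K"
      "\<And>w. w \<in> lists (UNIV \<times> UNIV) \<Longrightarrow> h (free_rel UNIV `` {w}) = word_value ?K thompson_map w"
    using thompson_maps.free_group_hom_exists[of UNIV thompson_map] thompson_maps.g_closed
    unfolding Fr_def by blast
  interpret h: group_hom Fr ?K h
    using h(1) by (simp add: group_hom_def group_hom_axioms_def thompson_maps.group_axioms Fr.group_axioms)
  have hx: "h (x i) = thompson_map i" for i
    using h(2)[of "[(i, True)]"] by (simp add: x_def free_gen_def)
  have "thompson_relators \<subseteq> kernel Fr ?K h"
  proof
    fix r assume "r \<in> thompson_relators"
    then obtain i j where r: "r = x i \<otimes>\<^bsub>Fr\<^esub> x j \<otimes>\<^bsub>Fr\<^esub> inv\<^bsub>Fr\<^esub> (x i) \<otimes>\<^bsub>Fr\<^esub> inv\<^bsub>Fr\<^esub> (x (j + 1))"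
        and "i < j"
      unfolding rels by blast
    have "h r = thompson_map i \<otimes>\<^bsub>?K\<^esub> thompson_map j \<otimes>\<^bsub>?K\<^esub> inv\<^bsub>?K\<^esub> (thompson_map i)
        \<otimes>\<^bsub>?K\<^esub> inv\<^bsub>?K\<^esub> (thompson_map (j + 1))"
      by (simp add: r x hx)
    also have "\<dots> = \<one>\<^bsub>?K\<^esub>"
      unfolding thompson_maps.g_rel[OF \<open>i < j\<close>] by (simp add: thompson_maps.m_assoc)
    finally show "r \<in> kernel Fr ?K h" by (simp add: kernel_def r x)
  qed
  then have ker: "N \<subseteq> kernel Fr ?K h"
    using h.normal_kernel unfolding N_def normal_closure_def by blast
  obtain k where k: "k \<in> hom (Fr Mod N) ?K" "\<And>y. y \<in> carrier Fr \<Longrightarrow> k (N #>\<^bsub>Fr\<^esub> y) = h y"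
    by (rule h.FactGroup_universal_kernel[OF N ker]) (rule that)
  interpret k: group_hom "Fr Mod N" ?K k
    using k(1) by (simp add: group_hom_def group_hom_axioms_def thompson_maps.group_axioms TF.group_axioms)
  interpret \<pi>: group_hom Fr "Fr Mod N" "\<lambda>y. N #>\<^bsub>Fr\<^esub> y"
    using normal.r_coset_hom_Mod[OF N]
    by (simp add: group_hom_def group_hom_axioms_def TF.group_axioms Fr.group_axioms)
  define g where "g i = N #>\<^bsub>Fr\<^esub> x i" for i
  interpret g: thompson_generators "Fr Mod N" g
  proof
    show g_closed: "g i \<in> carrier (Fr Mod N)" for i
      unfolding g_def by (rule \<pi>.hom_closed[OF x])
    show "g i \<otimes>\<^bsub>Fr Mod N\<^esub> g j = g (j + 1) \<otimes>\<^bsub>Fr Mod N\<^esub> g i" if "i < j" for i j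
    proof -
      let ?r = "x i \<otimes>\<^bsub>Fr\<^esub> x j \<otimes>\<^bsub>Fr\<^esub> inv\<^bsub>Fr\<^esub> (x i) \<otimes>\<^bsub>Fr\<^esub> inv\<^bsub>Fr\<^esub> (x (j + 1))"
      have "?r \<in> N" using rel_N that unfolding rels by blast
      then have "N #>\<^bsub>Fr\<^esub> ?r = \<one>\<^bsub>Fr Mod N\<^esub>"
        using normal_imp_subgroup[OF N] by (simp add: Fr.coset_join2 FactGroup_def x)
      then have "g i \<otimes>\<^bsub>Fr Mod N\<^esub> g j \<otimes>\<^bsub>Fr Mod N\<^esub> inv\<^bsub>Fr Mod N\<^esub> (g i) \<otimes>\<^bsub>Fr Mod N\<^esub> inv\<^bsub>Fr Mod N\<^esub> (g (j + 1))
          = \<one>\<^bsub>Fr Mod N\<^esub>"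
        by (simp only: \<pi>.hom_mult \<pi>.hom_inv x g_def Fr.m_closed Fr.inv_closed)
      then have "inv\<^bsub>Fr Mod N\<^esub> (inv\<^bsub>Fr Mod N\<^esub> (g (j + 1)))
          = g i \<otimes>\<^bsub>Fr Mod N\<^esub> g j \<otimes>\<^bsub>Fr Mod N\<^esub> inv\<^bsub>Fr Mod N\<^esub> (g i)"
        by (rule TF.inv_equality) (intro TF.m_closed TF.inv_closed g_closed)+
      then have "g (j + 1) \<otimes>\<^bsub>Fr Mod N\<^esub> g i
          = g i \<otimes>\<^bsub>Fr Mod N\<^esub> g j \<otimes>\<^bsub>Fr Mod N\<^esub> inv\<^bsub>Fr Mod N\<^esub> (g i) \<otimes>\<^bsub>Fr Mod N\<^esub> g i"
        using g_closed by (simp del: mult_FactGroup one_FactGroup)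
      then show ?thesis using g_closed by (simp add: TF.m_assoc del: mult_FactGroup one_FactGroup)
    qed
  qed
  have kg: "k (g i) = thompson_map i" for i
    by (simp add: g_def k(2) x hx)
  have kpos: "k (g.pos P) = thompson_pos P" for P
    by (induction P) (simp_all add: kg thompson_pos_def del: mult_FactGroup one_FactGroup)
  show ?thesis unfolding TF
  proof (rule embeds_in_by_hom[OF TF.group_axioms thompson_maps.group_axioms k(1)])
    fix A assume A: "A \<in> carrier (Fr Mod N)" "k A = \<one>\<^bsub>?K\<^esub>"
    obtain w where w: "A = N #>\<^bsub>Fr\<^esub> (free_rel UNIV `` {w})"
      using A(1) unfolding FactGroup_def RCOSETS_def Fr_def by (auto elim!: free_group_classE)
    have in_Fr: "free_rel UNIV `` {w} \<in> carrier Fr" for w :: "nat fg_word"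
      by (auto simp: Fr_def free_group_def intro!: quotientI)
    have "N #>\<^bsub>Fr\<^esub> (free_rel UNIV `` {w}) = word_value (Fr Mod N) g w" for w
    proof (induction w)
      case Nil
      have "\<one>\<^bsub>Fr\<^esub> = free_rel UNIV `` {[]}" by (simp add: Fr_def free_group_def)
      then show ?case using \<pi>.hom_one by simp
    next
      case (Cons a w)
      obtain i b where a: "a = (i, b)" by (cases a)
      show ?case
        unfolding a using free_group_class_Cons[of i UNIV w b] Cons x in_Fr[of w]
        by (simp add: g_def x_def flip: Fr_def)
    qed
    then obtain P R where PR: "sorted_wrt (\<ge>) P" "sorted_wrt (\<ge>) R"
        "A = inv\<^bsub>Fr Mod N\<^esub> (g.pos P) \<otimes>\<^bsub>Fr Mod N\<^esub> g.pos R"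
      using g.fraction_form w by metis
    have "inv\<^bsub>?K\<^esub> (thompson_pos P) \<otimes>\<^bsub>?K\<^esub> thompson_pos R = \<one>\<^bsub>?K\<^esub>"
      using A(2) unfolding PR(3)
      by (simp only: k.hom_mult k.hom_inv kpos g.pos_closed TF.inv_closed)
    then have "inv\<^bsub>?K\<^esub> (thompson_pos R) = inv\<^bsub>?K\<^esub> (thompson_pos P)"
      by (rule thompson_maps.inv_equality) (simp_all add: thompson_pos_def)
    moreover have "inv\<^bsub>?K\<^esub> (inv\<^bsub>?K\<^esub> (thompson_pos P)) = thompson_pos P" for P
      by (rule thompson_maps.inv_inv) (simp add: thompson_pos_def)
    ultimately have "thompson_pos R = thompson_pos P" by metis
    then have "R = P" using thompson_pos_inj PR by blast
    then show "A = \<one>\<^bsub>Fr Mod N\<^esub>" using PR(3) g.pos_closed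
      by (simp del: mult_FactGroup one_FactGroup)
  qed
qed


section \<open>Free groups of rank at most the continuum\<close>

definition reduced_word :: "'a fg_word \<Rightarrow> bool" where
  "reduced_word w \<longleftrightarrow> (\<forall>k. Suc k < length w \<longrightarrow> fst (w ! k) = fst (w ! Suc k) \<longrightarrow> snd (w ! k) = snd (w ! Suc k))"

lemma exists_reduced:
  "w \<in> lists (S \<times> UNIV) \<Longrightarrow> \<exists>v. reduced_word v \<and> (w, v) \<in> free_rel S"
proof (induction w rule: length_induct)
  case (1 w)
  show ?case
  proof (cases "reduced_word w")
    case True
    then show ?thesis using free_rel.refl 1 by blast
  next
    case False
    then obtain k where k: "Suc k < length w" "fst (w ! k) = fst (w ! Suc k)" "snd (w ! k) \<noteq> snd (w ! Suc k)"
      unfolding reduced_word_def by blast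
    let ?u = "take k w" and ?v = "drop (Suc (Suc k)) w"
    obtain x b where xb: "w ! k = (x, b)" by (cases "w ! k")
    with k have xb': "w ! Suc k = (x, \<not> b)" by (cases "w ! Suc k") auto
    have w: "w = ?u @ [(x, b), (x, \<not> b)] @ ?v"
      using id_take_nth_drop[of k w] Cons_nth_drop_Suc[OF k(1)] k(1) xb xb' by simp
    have uv: "?u \<in> lists (S \<times> UNIV)" "?v \<in> lists (S \<times> UNIV)"
      using 1(2) by (auto simp: in_lists_conv_set dest: in_set_takeD in_set_dropD)
    have "w ! k \<in> S \<times> UNIV" using 1(2) k(1) by (metis Suc_lessD in_lists_conv_set nth_mem)
    then have "x \<in> S" by (simp add: xb)
    then have "(w, ?u @ ?v) \<in> free_rel S" using free_rel.cancel[OF uv] w by metis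
    moreover have "?u @ ?v \<in> lists (S \<times> UNIV)" "length (?u @ ?v) < length w" using uv k(1) by auto
    ultimately show ?thesis using 1(1) by (meson free_rel.trans)
  qed
qed

text \<open>Prescribed values on a finite set extend to an increasing map with slopes in \<open>[1/3, 3]\<close>, by
  the one-sided analogue of McShane's extension of Lipschitz functions: \<open>max_increment s\<close> is the
  largest increment that these slopes allow over a step \<open>s\<close>, which may be negative.\<close>

definition max_increment :: "real \<Rightarrow> real" where
  "max_increment s = max (3 * s) (s / 3)"

lemma max_increment_slopes:
  assumes "s \<le> t"
  shows "t - s \<le> 3 * (max_increment t - max_increment s)" "max_increment t - max_increment s \<le> 3 * (t - s)"
  using assms by (auto simp: max_increment_def max_def field_simps)

definition interpolate :: "(real \<times> real) set \<Rightarrow> real \<Rightarrow> real" where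
  "interpolate P t = Min ((\<lambda>(a, b). b + max_increment (t - a)) ` P)"

lemma interpolate_slopes:
  assumes "finite P" "P \<noteq> {}" "x \<le> y"
  shows "y - x \<le> 3 * (interpolate P y - interpolate P x)"
    and "interpolate P y - interpolate P x \<le> 3 * (y - x)"
proof -
  define f where "f t p = snd p + max_increment (t - fst p)" for t p
  have int: "interpolate P t = Min (f t ` P)" for t
    by (simp add: interpolate_def f_def[abs_def] case_prod_beta')
  have f: "y - x \<le> 3 * (f y p - f x p)" "f y p - f x p \<le> 3 * (y - x)" for p
    using max_increment_slopes[of "x - fst p" "y - fst p"] assms(3) by (simp_all add: f_def)
  have in_img: "interpolate P t \<in> f t ` P" for t
    unfolding int using assms by (intro Min_in) auto
  have le: "interpolate P t \<le> f t p" if "p \<in> P" for t p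
    unfolding int using assms that by (intro Min_le) auto
  obtain p where p: "p \<in> P" "interpolate P y = f y p" using in_img[of y] by blast
  then show "y - x \<le> 3 * (interpolate P y - interpolate P x)" using f(1)[of p] le[OF p(1), of x] by argo
  obtain q where q: "q \<in> P" "interpolate P x = f x q" using in_img[of x] by blast
  then show "interpolate P y - interpolate P x \<le> 3 * (y - x)" using f(2)[of q] le[OF q(1), of y] by argo
qed

lemma interpolate_value:
  assumes "finite P" "(a, b) \<in> P"
    and "\<And>c d. (c, d) \<in> P \<Longrightarrow> b - d \<le> max_increment (a - c)"
  shows "interpolate P a = b"
  unfolding interpolate_def
proof (rule Min_eqI)
  show "b \<in> (\<lambda>(c, d). d + max_increment (a - c)) ` P"
    using assms(2) by (force simp: max_increment_def)
  show "b \<le> y" if "y \<in> (\<lambda>(c, d). d + max_increment (a - c)) ` P" for y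
    using that assms(3) by fastforce
qed (use assms in simp)

text \<open>The letters of a reduced word \<open>w\<close> of length \<open>l\<close>, applied from right to left, are to push \<open>l\<close>
  to \<open>l - 1\<close>, then to \<open>l - 2\<close>, and so on down to \<open>0\<close>. \<open>moves w x\<close> is what this requires of the
  letter \<open>x\<close>, as pairs of a point and its image, together with the fixed points that bound
  its support; a letter \<open>(x, False)\<close> acts by the inverse of \<open>x\<close>, so it requires \<open>x\<close> to move up.\<close>

definition moves :: "'a fg_word \<Rightarrow> 'a \<Rightarrow> (real \<times> real) set" where
  "moves w x = {(- 1, - 1), (real (length w) + 1, real (length w) + 1)}
     \<union> (\<lambda>k. (real k + 1, real k)) ` {k. k < length w \<and> w ! k = (x, True)}
     \<union> (\<lambda>k. (real k, real k + 1)) ` {k. k < length w \<and> w ! k = (x, False)}"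

lemma finite_moves: "finite (moves w x)"
  by (simp add: moves_def)

text \<open>Two opposite moves of the same letter could conflict only at neighbouring positions, which
  is excluded in a reduced word.\<close>

lemma moves_compatible:
  assumes "reduced_word w" "(a, b) \<in> moves w x" "(c, d) \<in> moves w x"
  shows "b - d \<le> max_increment (a - c)"
proof -
  have far: "real m + 1 - real k \<le> max_increment (real m - (real k + 1))"
    if "k < length w" "w ! k = (x, True)" "m < length w" "w ! m = (x, False)" for k m
  proof -
    have "m \<noteq> k" using that by auto
    moreover have "m \<noteq> Suc k" using assms(1) that unfolding reduced_word_def by fastforce
    moreover have "k \<noteq> Suc m" using assms(1) that unfolding reduced_word_def by fastforce
    ultimately have "real m \<ge> real k + 2 \<or> real k \<ge> real m + 2" by linarith
    then show ?thesis by (auto simp: max_increment_def le_max_iff_disj)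
  qed
  show ?thesis
    using assms(2,3) unfolding moves_def
    by (auto simp: far) (auto simp: max_increment_def le_max_iff_disj)
qed

text \<open>Outside the end points of \<open>moves w x\<close> the identity takes over.\<close>

definition letter_map :: "'a fg_word \<Rightarrow> 'a \<Rightarrow> real \<Rightarrow> real" where
  "letter_map w x t = (let u = max (- 1) (min t (real (length w) + 1))
     in interpolate (moves w x) u + (t - u))"

lemma bilipschitz_letter_map: "bilipschitz 3 (letter_map w x)"
proof (rule bilipschitz_from_slopes)
  fix s t :: real assume "s \<le> t"
  let ?c = "\<lambda>t :: real. max (- 1) (min t (real (length w) + 1))"
  have c: "?c s \<le> ?c t" "?c t - ?c s \<le> t - s" using \<open>s \<le> t\<close> by auto
  have "moves w x \<noteq> {}" by (simp add: moves_def)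
  from interpolate_slopes[OF finite_moves this c(1)] c(2)
  show "t - s \<le> 3 * (letter_map w x t - letter_map w x s)"
    and "letter_map w x t - letter_map w x s \<le> 3 * (t - s)"
    unfolding letter_map_def Let_def by (argo, argo)
qed simp

lemma letter_map_at:
  assumes "reduced_word w" "(a, b) \<in> moves w x"
  shows "letter_map w x a = b"
proof -
  have "interpolate (moves w x) a = b"
    using assms by (intro interpolate_value finite_moves moves_compatible)
  moreover have "max (- 1) (min a (real (length w) + 1)) = a"
    using assms(2) by (auto simp: moves_def)
  ultimately show ?thesis by (simp add: letter_map_def Let_def)
qed

lemma letter_map_support:
  assumes "reduced_word w" "letter_map w x t \<noteq> t"
  shows "\<bar>t\<bar> < real (length w) + 2"
proof (rule ccontr)
  assume "\<not> ?thesis"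
  then consider "t \<le> - 1" | "t \<ge> real (length w) + 1" by linarith
  then show False
  proof cases
    case 1
    then have "letter_map w x t = letter_map w x (- 1) + (t + 1)" by (simp add: letter_map_def Let_def)
    also have "letter_map w x (- 1) = - 1" by (rule letter_map_at[OF assms(1)]) (simp add: moves_def)
    finally show False using assms(2) by simp
  next
    case 2
    then have "letter_map w x t = letter_map w x (real (length w) + 1) + (t - (real (length w) + 1))"
      by (simp add: letter_map_def Let_def)
    also have "letter_map w x (real (length w) + 1) = real (length w) + 1"
      by (rule letter_map_at[OF assms(1)]) (simp add: moves_def)
    finally show False using assms(2) by simp
  qed
qed

text \<open>The blocks are enumerated by pairs \<open>(N, w)\<close> of a resolution \<open>N\<close> and a word \<open>w\<close> in integers. In
  this block a real number \<open>r\<close> acts as the letter \<open>\<lfloor>N r\<rfloor>\<close> does on the path of \<open>w\<close>. Finitely many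
  reals are distinguished by all sufficiently fine resolutions, so countably many blocks suffice to
  detect every reduced word in real numbers.\<close>

text \<open>On this scale the interval \<open>[-1, l + 1]\<close> fits into \<open>block n\<close>, and the path from \<open>l\<close> to \<open>0\<close> still has
  length at least \<open>4 ^ n / 3\<close>.\<close>

definition word_scale :: "nat \<Rightarrow> 'a fg_word \<Rightarrow> real" where
  "word_scale n w = 4 ^ n / (real (length w) + 2)"

definition letter_block :: "real \<Rightarrow> nat \<Rightarrow> real \<Rightarrow> real" where
  "letter_block r n = (case from_nat n of (N :: nat, w :: int fg_word) \<Rightarrow>
     if reduced_word w then rescale (word_scale n w) n (letter_map w \<lfloor>real N * r\<rfloor>) else id)"

definition real_generator :: "real \<Rightarrow> real \<Rightarrow> real" where
  "real_generator r = glue (letter_block r)"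

lemma word_scale_pos: "word_scale n w > 0"
  by (simp add: word_scale_def)

lemma word_scale_less:
  assumes "\<bar>t\<bar> < real (length w) + 2"
  shows "\<bar>word_scale n w * t\<bar> < 4 ^ n"
proof -
  have "word_scale n w * \<bar>t\<bar> < word_scale n w * (real (length w) + 2)"
    using assms word_scale_pos by (rule mult_strict_left_mono)
  then show ?thesis using word_scale_pos[of n w] by (simp add: word_scale_def abs_mult)
qed

lemma blockwise_letter_block: "blockwise (letter_block r)"
proof -
  have "x \<in> block n" if "letter_block r n x \<noteq> x" for n x
  proof -
    obtain N :: nat and w :: "int fg_word" where e: "from_nat n = (N, w)"
      by (cases "from_nat n :: nat \<times> int fg_word")
    have w: "reduced_word w" and "rescale (word_scale n w) n (letter_map w \<lfloor>real N * r\<rfloor>) x \<noteq> x"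
      using that by (auto simp: letter_block_def e split: if_splits)
    then show ?thesis
      using rescale_moves[OF word_scale_pos word_scale_less] letter_map_support[OF w] by metis
  qed
  then show ?thesis by (simp add: blockwise_def)
qed

lemma bilipschitz_real_generator: "bilipschitz 9 (real_generator r)"
proof -
  have "bilipschitz 3 (letter_block r n)" for n
    by (cases "from_nat n :: nat \<times> int fg_word")
      (auto simp: letter_block_def intro!: bilipschitz_rescale bilipschitz_letter_map bilipschitz_id word_scale_pos)
  from bilipschitz_glue[OF blockwise_letter_block this] show ?thesis by (simp add: real_generator_def)
qed

lemma real_generator_at:
  fixes w :: "int fg_word"
  assumes "n = to_nat (N, w)" "reduced_word w" "(a, b) \<in> moves w \<lfloor>real N * r\<rfloor>" "\<bar>a\<bar> < real (length w) + 2"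
  shows "real_generator r (3 * 4 ^ n + word_scale n w * a) = 3 * 4 ^ n + word_scale n w * b"
proof -
  have "3 * 4 ^ n + word_scale n w * a \<in> block n"
    using word_scale_less[OF assms(4), of n] by (simp add: block_def)
  then have "real_generator r (3 * 4 ^ n + word_scale n w * a)
      = letter_block r n (3 * 4 ^ n + word_scale n w * a)"
    unfolding real_generator_def by (rule glue_block[OF blockwise_letter_block])
  also have "\<dots> = 3 * 4 ^ n + word_scale n w * b"
    using assms(1,2) rescale_at[of "word_scale n w" n "letter_map w \<lfloor>real N * r\<rfloor>" a] word_scale_pos[of n w]
    by (simp add: letter_block_def letter_map_at[OF assms(2,3)])
  finally show ?thesis .
qed

lemma eventually_floor_neq:
  assumes "x \<noteq> (y :: real)"
  shows "\<forall>\<^sub>F N in sequentially. \<lfloor>real N * x\<rfloor> \<noteq> \<lfloor>real N * y\<rfloor>"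
proof -
  obtain N0 :: nat where N0: "1 < real N0 * \<bar>x - y\<bar>"
    using ex_less_of_nat_mult[of "\<bar>x - y\<bar>" 1] assms by auto
  have "\<lfloor>real N * x\<rfloor> \<noteq> \<lfloor>real N * y\<rfloor>" if "N \<ge> N0" for N
  proof
    assume "\<lfloor>real N * x\<rfloor> = \<lfloor>real N * y\<rfloor>"
    then have "\<bar>real N * x - real N * y\<bar> < 1" by linarith
    then have "real N * \<bar>x - y\<bar> < 1" by (simp add: abs_mult flip: right_diff_distrib)
    moreover have "real N0 * \<bar>x - y\<bar> \<le> real N * \<bar>x - y\<bar>" using that by (intro mult_right_mono) auto
    ultimately show False using N0 by linarith
  qed
  then show ?thesis unfolding eventually_sequentially by blast
qed

definition integer_word :: "('a \<Rightarrow> real) \<Rightarrow> nat \<Rightarrow> 'a fg_word \<Rightarrow> int fg_word" where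
  "integer_word e N w = map (\<lambda>(x, b). (\<lfloor>real N * e x\<rfloor>, b)) w"

lemma eventually_reduced_integer_word:
  assumes "inj_on e S" "w \<in> lists (S \<times> UNIV)" "reduced_word w"
  shows "\<forall>\<^sub>F N in sequentially. reduced_word (integer_word e N w)"
proof -
  let ?D = "{k. Suc k < length w \<and> fst (w ! k) \<noteq> fst (w ! Suc k)}"
  have S: "fst (w ! k) \<in> S" if "k < length w" for k
    using assms(2) that by (metis in_lists_conv_set mem_Times_iff nth_mem)
  have "finite ?D" by (rule finite_subset[of _ "{..<length w}"]) auto
  then have "\<forall>\<^sub>F N in sequentially. \<forall>k\<in>?D.
      \<lfloor>real N * e (fst (w ! k))\<rfloor> \<noteq> \<lfloor>real N * e (fst (w ! Suc k))\<rfloor>"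
    using S assms(1) by (intro eventually_ball_finite ballI eventually_floor_neq) (auto simp: inj_on_eq_iff)
  then show ?thesis
  proof (rule eventually_mono)
    fix N assume N: "\<forall>k\<in>?D. \<lfloor>real N * e (fst (w ! k))\<rfloor> \<noteq> \<lfloor>real N * e (fst (w ! Suc k))\<rfloor>"
    show "reduced_word (integer_word e N w)"
      unfolding reduced_word_def
    proof (intro allI impI)
      fix k assume k: "Suc k < length (integer_word e N w)"
        "fst (integer_word e N w ! k) = fst (integer_word e N w ! Suc k)"
      then have "k \<notin> ?D" using N by (auto simp: integer_word_def case_prod_beta)
      then show "snd (integer_word e N w ! k) = snd (integer_word e N w ! Suc k)"
        using k(1) assms(3) by (auto simp: integer_word_def case_prod_beta reduced_word_def)
    qed
  qed
qed

abbreviation BL :: "(real \<Rightarrow> real) set" where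
  "BL \<equiv> {f. \<exists>L. bilipschitz L f}"

lemma group_BL: "group (comp_group BL)"
  using bilipschitz_id bilipschitz_comp bilipschitz_inv bilipschitzD(2)
  by (intro comp_group_groupI) blast+

lemma inv_BL:
  assumes "f \<in> BL"
  shows "inv\<^bsub>comp_group BL\<^esub> f = finv f"
proof (rule group.inv_equality[OF group_BL])
  have "bij f" using assms bilipschitzD(2) by blast
  then show "finv f \<otimes>\<^bsub>comp_group BL\<^esub> f = \<one>\<^bsub>comp_group BL\<^esub>"
    by (simp add: comp_group_def bij_is_inj)
qed (use assms bilipschitz_inv in \<open>auto simp: comp_group_def\<close>)

lemma word_value_real_generators:
  assumes red: "reduced_word (integer_word e N w)" and n: "n = to_nat (N, integer_word e N w)"
    and "k \<le> length w"
  shows "word_value (comp_group BL) (real_generator \<circ> e) (drop k w)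
      (3 * 4 ^ n + word_scale n w * length w) = 3 * 4 ^ n + word_scale n w * k"
  using assms(3)
proof (induction rule: inc_induct)
  case base
  then show ?case by (simp add: comp_group_def)
next
  case (step k)
  obtain x b where xb: "w ! k = (x, b)" by (cases "w ! k")
  define v where "v = integer_word e N w"
  have v: "length v = length w" "v ! k = (\<lfloor>real N * e x\<rfloor>, b)"
    using step.hyps xb by (simp_all add: v_def integer_word_def)
  have sc: "word_scale n v = word_scale n w" by (simp add: word_scale_def v)
  let ?p = "\<lambda>k. 3 * 4 ^ n + word_scale n w * real k"
  let ?g = "real_generator (e x)"
  have bij: "bij ?g" using bilipschitz_real_generator bilipschitzD(2) by blast
  have "(if b then ?g else finv ?g) (?p (Suc k)) = ?p k"
  proof (cases b)
    case True
    then have "(real k + 1, real k) \<in> moves v \<lfloor>real N * e x\<rfloor>"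
      using v step.hyps by (auto simp: moves_def)
    from real_generator_at[OF n[folded v_def] red[folded v_def] this] True step.hyps
    show ?thesis by (simp add: sc v add.commute)
  next
    case False
    then have "(real k, real k + 1) \<in> moves v \<lfloor>real N * e x\<rfloor>"
      using v step.hyps by (auto simp: moves_def)
    from real_generator_at[OF n[folded v_def] red[folded v_def] this] step.hyps
    have "?g (?p k) = ?p (Suc k)" by (simp add: sc v add.commute)
    then have "finv ?g (?p (Suc k)) = ?p k" by (rule inv_f_eq[OF bij_is_inj[OF bij]])
    then show ?thesis using False by (simp only: if_False)
  qed
  moreover have "drop k w = (x, b) # drop (Suc k) w"
    using Cons_nth_drop_Suc[of k w] step.hyps xb by simp
  moreover have "inv\<^bsub>comp_group BL\<^esub> ?g = finv ?g"
    using bilipschitz_real_generator by (intro inv_BL) blast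
  ultimately show ?case using step.IH by (cases b) (simp_all add: comp_group_def)
qed

text \<open>A reduced word \<open>w \<noteq> []\<close> in the generators moves a point by at least \<open>4 ^ n / 3\<close> for each
  \<open>n = to_nat (N, integer_word e N w)\<close> with \<open>N\<close> large, and these \<open>n\<close> are unbounded, because they are
  distinct.\<close>

lemma embeds_in_QI_free_group:
  fixes S :: "'a set" and e :: "'a \<Rightarrow> real"
  assumes e: "inj_on e S"
  shows "embeds_in (free_group S) (QI :: (real \<Rightarrow> real) set monoid)"
proof -
  have gen: "(real_generator \<circ> e) x \<in> carrier (comp_group BL)" for x
    using bilipschitz_real_generator by (auto simp: comp_group_def)
  obtain h where h: "h \<in> hom (free_group S) (comp_group BL)"
      "\<And>w. w \<in> lists (S \<times> UNIV) \<Longrightarrow>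
        h (free_rel S `` {w}) = word_value (comp_group BL) (real_generator \<circ> e) w"
    using group.free_group_hom_exists[OF group_BL, of S "real_generator \<circ> e"] gen by blast
  show ?thesis
  proof (rule embeds_in_QI_by_representatives[where \<phi> = h, OF group_free_group])
    show qi: "quasi_isometry (h A)" if "A \<in> carrier (free_group S)" for A
    proof -
      have "h A \<in> BL" using h(1) that by (auto simp: hom_def comp_group_def)
      then show ?thesis using bilipschitz_quasi_isometry by blast
    qed
    show "(h (A \<otimes>\<^bsub>free_group S\<^esub> B), h A \<circ> h B) \<in> qi_rel"
      if "A \<in> carrier (free_group S)" "B \<in> carrier (free_group S)" for A B
    proof -
      have "h (A \<otimes>\<^bsub>free_group S\<^esub> B) = h A \<circ> h B" using h(1) that by (simp add: hom_def comp_group_def)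
      then show ?thesis using that qi
        by (auto simp: qi_rel_def quasi_isometry_comp intro: exI[of _ 0])
    qed
    show "A = \<one>\<^bsub>free_group S\<^esub>" if A: "A \<in> carrier (free_group S)" and near: "(h A, id) \<in> qi_rel" for A
    proof -
      obtain u where u: "u \<in> lists (S \<times> UNIV)" "A = free_rel S `` {u}"
        using A by (rule free_group_classE)
      obtain w where red: "reduced_word w" and uw: "(u, w) \<in> free_rel S" using exists_reduced u(1) by blast
      have w: "w \<in> lists (S \<times> UNIV)" "A = free_rel S `` {w}"
        using uw free_rel_words equiv_class_eq[OF equiv_free_rel] u(2) by blast+
      have "w = []"
      proof (rule ccontr)
        assume "w \<noteq> []"
        obtain M where M: "\<And>x. dist (h A x) x \<le> M" using near by (auto simp: qi_rel_def)
        let ?n = "\<lambda>N. to_nat (N, integer_word e N w)"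
        obtain N0 where N0: "\<And>N. N \<ge> N0 \<Longrightarrow> reduced_word (integer_word e N w)"
          using eventually_reduced_integer_word[OF e w(1) red] by (auto simp: eventually_sequentially)
        have bound: "4 ^ ?n N \<le> 3 * M" if "N \<ge> N0" for N
        proof -
          let ?x = "3 * 4 ^ ?n N + word_scale (?n N) w * length w"
          have "h A ?x = 3 * 4 ^ ?n N"
            using word_value_real_generators[OF N0[OF that] HOL.refl, of 0] h(2)[OF w(1)] by (simp add: w(2))
          then have "word_scale (?n N) w * length w \<le> M"
            using M[of ?x] word_scale_pos[of "?n N" w] by (simp add: dist_real_def abs_mult)
          moreover have "4 ^ ?n N \<le> 3 * (word_scale (?n N) w * length w)"
            using \<open>w \<noteq> []\<close> by (simp add: word_scale_def field_simps Suc_le_eq)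
          ultimately show ?thesis by linarith
        qed
        obtain m where m: "3 * M < 4 ^ m" using real_arch_pow[of 4] by auto
        have "inj_on ?n {N0..}" by (auto simp: inj_on_def)
        then have "infinite (?n ` {N0..})" by (simp add: finite_image_iff infinite_Ici)
        then obtain N where "N \<ge> N0" "?n N > m" by (auto simp: infinite_nat_iff_unbounded)
        then have "(4::real) ^ m \<le> 4 ^ ?n N" by simp
        then show False using bound[OF \<open>N \<ge> N0\<close>] m by linarith
      qed
      then show ?thesis using w by (simp add: free_group_def)
    qed
  qed
qed


section \<open>Subgroups of the quasi-isometry group of the line\<close>

theorem theorem1p3:
  shows "embeds_in (comp_group (lifts Diff_circle)) (QI :: (real \<Rightarrow> real) set monoid)
    \<and> embeds_in (comp_group (lifts PL_circle)) (QI :: (real \<Rightarrow> real) set monoid)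
    \<and> embeds_in (comp_group PL_kappa) (QI :: (real \<Rightarrow> real) set monoid)
    \<and> embeds_in Thompson_F (QI :: (real \<Rightarrow> real) set monoid)
    \<and> (\<forall>S :: 'a set. S \<approx> (UNIV :: real set) \<longrightarrow>
         embeds_in (free_group S) (QI :: (real \<Rightarrow> real) set monoid))"
proof (intro conjI allI impI)
  show "embeds_in (comp_group (lifts Diff_circle)) (QI :: (real \<Rightarrow> real) set monoid)"
    by (rule embeds_in_QI_Diff)
  show "embeds_in (comp_group (lifts PL_circle)) (QI :: (real \<Rightarrow> real) set monoid)"
    by (rule embeds_in_QI_PL)
  show "embeds_in (comp_group PL_kappa) (QI :: (real \<Rightarrow> real) set monoid)"
    by (rule embeds_in_QI_if_BL_compact[OF PL_kappa_BL_compact group_PL_kappa])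
  show "embeds_in Thompson_F (QI :: (real \<Rightarrow> real) set monoid)"
    using group_Thompson_F group_BL_compact group_QI embeds_in_Thompson_F
      embeds_in_QI_if_BL_compact[OF order.refl group_BL_compact]
    by (rule embeds_in_trans)
  show "embeds_in (free_group S) (QI :: (real \<Rightarrow> real) set monoid)"
    if S: "S \<approx> (UNIV :: real set)" for S :: "'a set"
  proof -
    obtain e :: "'a \<Rightarrow> real" where "bij_betw e S UNIV" using S unfolding eqpoll_def by blast
    then have "inj_on e S" by (rule bij_betw_imp_inj_on)
    then show ?thesis by (rule embeds_in_QI_free_group)
  qed
qed

end
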